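(* In the sequential collaborative-recommendation model described in the context, suppose that $|M|\ge2$ and that the regression function $\eta(\mathbf{x}^\star)=\mathbb{E}[Y\mid\mathbf{X}^\star=\mathbf{x}^\star]$ has the form $$\eta(\mathbf{x}^\star)=\|\mathbf{x}^\star\|\,\varphi(\mathbf{x}^\star),\qquad \varphi(\mathbf{x}^\star)=\mathbb{E}\left[\frac{Y}{\|\mathbf{X}^\star\|}\;\Big|\;\frac{\mathbf{X}^\star}{\|\mathbf{X}^\star\|}=\frac{\mathbf{x}^\star}{\|\mathbf{x}^\star\|}\right].$$ Suppose that $k_n\to\infty$, $|\mathcal{R}_n|\to\infty$ almost surely, and $\mathbb{E}[k_n/|\mathcal{R}_n|]\to0$ as $n\to\infty$. Then the cosine-type $k_n$-nearest neighbor regression estimate $\eta_n$ satisfies $$\mathbb{E}\,|\eta_n(\mathbf{X}^\star)-\eta(\mathbf{X}^\star)|\to0\quad\text{as }n\to\infty.$$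
   Context: Model. Fix an integer $d\ge 1$ and a real $s>1$. For a finite set $A$, $|A|$ is its cardinality; $\mathcal{P}^\star(A)$ is the set of nonempty subsets of $A$; $\|\cdot\|$ is the Euclidean norm on $\mathbb{R}^d$. - New user: $(\mathbf{X},Y)$ is a random pair in $[1,s]^d\times[1,s]$, $\mathbf{X}=(X_1,\dots,X_d)$, and $M$ is a random element of $\mathcal{P}^\star(\{1,\dots,d\})$. Define $\mathbf{X}^\star=(X_1^\star,\dots,X_d^\star)$ by $X_j^\star=X_j$ if $j\in M$ and $X_j^\star=0$ otherwise. - Database users: $(\mathbf{X}_1,Y_1),\dots,(\mathbf{X}_n,Y_n)$ are independent random pairs with the distribution of $(\mathbf{X},Y)$, $\mathbf{X}_i=(X_{i1},\dots,X_{id})$. - For each $i\ge1$, $(M_i^n)_{n\ge1}$ is a sequence of random elements of $\mathcal{P}^\star(\{1,\dots,d\})$ with $M_i^n\subset M_i^{n+1}$ for all $n$; its law does not depend on $i$ and is that of a generic sequence $(M^n)_{n\ge1}$, for which there is a positive random integer $n_0$ with $M^n=\{1,\dots,d\}$ for all $n\ge n_0$. $M$ has the same distribution as $M^1$. - The pairs $(\mathbf{X}_i,Y_i)$, $i=1,\dots,n$, the sequences $(M_1^n)_{n\ge1},(M_2^n)_{n\ge1},\dots$ and the random variable $M$ are mutually independent. - $(\mathcal{R}_n)_{n\ge1}$ is a sequence of random sets, $\mathcal{R}_n\in\mathcal{P}^\star(\{1,\dots,n\})$, with $\mathcal{R}_n$ independent of $M$ and of the sequences $(M_i^n)_{n\ge1}$,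 and $\mathcal{R}_n\subset\mathcal{R}_{n+1}$ for all $n\ge1$. Masked ratings. For $1\le i\le n$, $\mathbf{X}_i^{(n)}=(X_{i1}^{(n)},\dots,X_{id}^{(n)})$ with $X_{ij}^{(n)}=X_{ij}$ if $j\in M_i^{n+1-i}\cap M$ and $0$ otherwise. Similarity. For $\mathbf{x},\mathbf{x}'\in(\{0\}\cup[1,s])^d$, with $\mathcal{J}=\{j: x_j\ne0\text{ and }x_j'\neq0\}$, $$\bar S(\mathbf{x},\mathbf{x}')=\frac{\sum_{j\in\mathcal J}x_jx_j'}{\sqrt{\sum_{j\in\mathcal J}x_j^2}\sqrt{\sum_{j\in\mathcal J}x_j'^2}},$$ and $\bar S(\mathbf{x},\mathbf{x}')=0$ if $\mathcal{J}=\varnothing$. Put $S(\mathbf{x}^\star,\mathbf{X}_i^{(n)})=p_i^{(n)}\bar S(\mathbf{x}^\star,\mathbf{X}_i^{(n)})$ with $p_i^{(n)}=|M_i^{n+1-i}\cap M|/|M|$. Estimate. Let $k_n$ be integers with $1\le k_n\le n$. For $\mathbf{x}^\star\in(\{0\}\cup[1,s])^d\setminus\{\mathbf{0}\}$, $$\eta_n(\mathbf{x}^\star)=\|\mathbf{x}^\star\|\sum_{i\in\mathcal{R}_n}W_{ni}(\mathbf{x}^\star)\frac{Y_i}{\|\mathbf{X}_i^{(n)}\|},$$ where $W_{ni}(\mathbf{x}^\star)=1/k_n$ if $\mathbf{X}_i^{(n)}$ is among the $k_n$ most similar to $\mathbf{x}^\star$ (i.e. with the $k_n$ largest values of $S(\mathbf{x}^\star,\cdot)$)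 in $\{\mathbf{X}_i^{(n)}, i\in\mathcal{R}_n\}$, ties being broken by indices (the smaller index is declared closer), and $W_{ni}(\mathbf{x}^\star)=0$ otherwise. Conventions: if $|\mathcal{R}_n|<k_n$ all weights are $0$; if $\mathbf{X}_i^{(n)}=\mathbf{0}$ then $W_{ni}(\mathbf{x}^\star)=0$ and $0\times\infty=0$.
   Formalization: The formal theorem also assumes that the new user's pair (X,Y) is independent of M, the database pairs and the mask sequences, and that each R_n is independent of all of these jointly, ratings included; without this the claim fails, e.g. if R_n selects users with large Y_i. *)

theory Defs
  imports "HOL-Probability.Probability"
begin

text \<open>
  The coordinates \<open>1, \<dots>, d\<close> are the elements of a finite index type \<open>'d\<close>, so that a
  subset of \<open>{1, \<dots>, d}\<close> has type \<open>'d set\<close> and the full set is \<open>UNIV\<close>. Database users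
  and times are natural numbers \<open>\<ge> 1\<close>; the values at index \<open>0\<close> are irrelevant.
\<close>

definition masked :: "'d set \<Rightarrow> real^'d \<Rightarrow> real^'d" where
  "masked A x = (\<chi> j. if j \<in> A then x $ j else 0)"

definition revealed :: "('w \<Rightarrow> real^'d) \<Rightarrow> ('w \<Rightarrow> 'd set) \<Rightarrow> 'w \<Rightarrow> real^'d" where
  "revealed X M \<omega> = masked (M \<omega>) (X \<omega>)"

definition Sbar :: "real^'d::finite \<Rightarrow> real^'d \<Rightarrow> real" where
  "Sbar x x' = (let J = {j. x $ j \<noteq> 0 \<and> x' $ j \<noteq> 0} in
     if J = {} then 0
     else (\<Sum>j\<in>J. x $ j * x' $ j) / (sqrt (\<Sum>j\<in>J. (x $ j)\<^sup>2) * sqrt (\<Sum>j\<in>J. (x' $ j)\<^sup>2)))"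

text \<open>\<open>common_mask Ms M n i\<close> is \<open>M\<^sub>i\<^sup>n\<^sup>+\<^sup>1\<^sup>-\<^sup>i \<inter> M\<close>; it is only used for \<open>1 \<le> i \<le> n\<close>, where the
  natural number subtraction does not truncate.\<close>

definition common_mask ::
  "(nat \<Rightarrow> nat \<Rightarrow> 'w \<Rightarrow> 'd set) \<Rightarrow> ('w \<Rightarrow> 'd set) \<Rightarrow> nat \<Rightarrow> nat \<Rightarrow> 'w \<Rightarrow> 'd set" where
  "common_mask Ms M n i \<omega> = Ms i (n + 1 - i) \<omega> \<inter> M \<omega>"

definition db_rating ::
  "(nat \<Rightarrow> 'w \<Rightarrow> real^'d) \<Rightarrow> (nat \<Rightarrow> nat \<Rightarrow> 'w \<Rightarrow> 'd set) \<Rightarrow> ('w \<Rightarrow> 'd set) \<Rightarrow>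
    nat \<Rightarrow> nat \<Rightarrow> 'w \<Rightarrow> real^'d" where
  "db_rating Xs Ms M n i \<omega> = masked (common_mask Ms M n i \<omega>) (Xs i \<omega>)"

text \<open>\<open>similarity Xs Ms M n x i\<close> is \<open>S(x, X\<^sub>i\<^sup>(\<^sup>n\<^sup>)) = p\<^sub>i\<^sup>(\<^sup>n\<^sup>) * Sbar x X\<^sub>i\<^sup>(\<^sup>n\<^sup>)\<close>. It is indexed by
  \<open>i\<close> because \<open>p\<^sub>i\<^sup>(\<^sup>n\<^sup>)\<close> depends on the masks.\<close>

definition similarity ::
  "(nat \<Rightarrow> 'w \<Rightarrow> real^'d::finite) \<Rightarrow> (nat \<Rightarrow> nat \<Rightarrow> 'w \<Rightarrow> 'd set) \<Rightarrow> ('w \<Rightarrow> 'd set) \<Rightarrow>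
    nat \<Rightarrow> real^'d \<Rightarrow> nat \<Rightarrow> 'w \<Rightarrow> real" where
  "similarity Xs Ms M n x i \<omega> =
     real (card (common_mask Ms M n i \<omega>)) / real (card (M \<omega>)) * Sbar x (db_rating Xs Ms M n i \<omega>)"

definition closer :: "(nat \<Rightarrow> real) \<Rightarrow> nat \<Rightarrow> nat \<Rightarrow> bool" where
  "closer S j i \<longleftrightarrow> S j > S i \<or> S j = S i \<and> j < i"

text \<open>User \<open>i\<close> is among the \<open>k\<close> most similar users of \<open>A\<close> iff fewer than \<open>k\<close> users of \<open>A\<close>
  precede \<open>i\<close> in the total order by decreasing similarity, ties broken by indices.\<close>

definition knn_weight ::
  "(nat \<Rightarrow> 'w \<Rightarrow> real^'d::finite) \<Rightarrow> (nat \<Rightarrow> nat \<Rightarrow> 'w \<Rightarrow> 'd set) \<Rightarrow> ('w \<Rightarrow> 'd set) \<Rightarrow>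
    (nat \<Rightarrow> 'w \<Rightarrow> nat set) \<Rightarrow> (nat \<Rightarrow> nat) \<Rightarrow> nat \<Rightarrow> nat \<Rightarrow> real^'d \<Rightarrow> 'w \<Rightarrow> real" where
  "knn_weight Xs Ms M R k n i x \<omega> =
     (if k n \<le> card (R n \<omega>) \<and> db_rating Xs Ms M n i \<omega> \<noteq> 0 \<and>
         card {j \<in> R n \<omega>. closer (\<lambda>l. similarity Xs Ms M n x l \<omega>) j i} < k n
      then 1 / real (k n) else 0)"

definition knn_estimate ::
  "(nat \<Rightarrow> 'w \<Rightarrow> real^'d::finite) \<Rightarrow> (nat \<Rightarrow> 'w \<Rightarrow> real) \<Rightarrow> (nat \<Rightarrow> nat \<Rightarrow> 'w \<Rightarrow> 'd set) \<Rightarrow>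
    ('w \<Rightarrow> 'd set) \<Rightarrow> (nat \<Rightarrow> 'w \<Rightarrow> nat set) \<Rightarrow> (nat \<Rightarrow> nat) \<Rightarrow> nat \<Rightarrow> real^'d \<Rightarrow> 'w \<Rightarrow> real" where
  "knn_estimate Xs Ys Ms M R k n x \<omega> =
     norm x * (\<Sum>i\<in>R n \<omega>. knn_weight Xs Ms M R k n i x \<omega> *
                            (Ys i \<omega> / norm (db_rating Xs Ms M n i \<omega>)))"

text \<open>\<open>regression_fun P U Z f\<close>: the function \<open>f\<close> is a version of \<open>u \<mapsto> E[Z | U = u]\<close>.\<close>

definition regression_fun ::
  "'w measure \<Rightarrow> ('w \<Rightarrow> 'b::topological_space) \<Rightarrow> ('w \<Rightarrow> real) \<Rightarrow> ('b \<Rightarrow> real) \<Rightarrow> bool" where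
  "regression_fun P U Z f \<longleftrightarrow> f \<in> borel_measurable borel \<and>
     (AE \<omega> in P. f (U \<omega>) = real_cond_exp P (vimage_algebra (space P) U borel) Z \<omega>)"

text \<open>The sequence \<open>(A\<^sup>n)\<^bsub>n \<ge> 1\<^esub>\<close> as one random element of a product space.\<close>

abbreviation mask_seq_space :: "(nat \<Rightarrow> 'd set) measure" where
  "mask_seq_space \<equiv> \<Pi>\<^sub>M n\<in>{1..}. count_space UNIV"

definition mask_seq :: "(nat \<Rightarrow> 'w \<Rightarrow> 'd set) \<Rightarrow> 'w \<Rightarrow> nat \<Rightarrow> 'd set" where
  "mask_seq A \<omega> = (\<lambda>n\<in>{1..}. A n \<omega>)"

datatype source = New_User | New_Mask | Db_User nat | Db_Masks nat

definition sources :: "source set" where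
  "sources = {New_User, New_Mask} \<union> Db_User ` {1..} \<union> Db_Masks ` {1..}"

text \<open>The sigma-algebras generated by \<open>(X, Y)\<close>, \<open>M\<close>, \<open>(X\<^sub>i, Y\<^sub>i)\<close> and \<open>(M\<^sub>i\<^sup>n)\<^bsub>n \<ge> 1\<^esub>\<close>. Since these
  random elements have different types, their independence is stated with \<open>indep_sets\<close>
  instead of \<open>indep_vars\<close>.\<close>

primrec source_sigma ::
  "'w measure \<Rightarrow> ('w \<Rightarrow> real^'d::finite) \<Rightarrow> ('w \<Rightarrow> real) \<Rightarrow> ('w \<Rightarrow> 'd set) \<Rightarrow>
    (nat \<Rightarrow> 'w \<Rightarrow> real^'d) \<Rightarrow> (nat \<Rightarrow> 'w \<Rightarrow> real) \<Rightarrow> (nat \<Rightarrow> nat \<Rightarrow> 'w \<Rightarrow> 'd set) \<Rightarrow>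
    source \<Rightarrow> 'w set set" where
  "source_sigma P X Y M Xs Ys Ms New_User =
     sets (vimage_algebra (space P) (\<lambda>\<omega>. (X \<omega>, Y \<omega>)) (borel \<Otimes>\<^sub>M borel))"
| "source_sigma P X Y M Xs Ys Ms New_Mask =
     sets (vimage_algebra (space P) M (count_space UNIV))"
| "source_sigma P X Y M Xs Ys Ms (Db_User i) =
     sets (vimage_algebra (space P) (\<lambda>\<omega>. (Xs i \<omega>, Ys i \<omega>)) (borel \<Otimes>\<^sub>M borel))"
| "source_sigma P X Y M Xs Ys Ms (Db_Masks i) =
     sets (vimage_algebra (space P) (mask_seq (Ms i)) mask_seq_space)"

text \<open>
  \<open>(X, Y)\<close> and \<open>M\<close> describe the new user, \<open>(Xs i, Ys i)\<close> and \<open>Ms i\<close> the database user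
  \<open>i \<ge> 1\<close>, \<open>G\<close> is the generic mask sequence and \<open>R n\<close> the set of users available at time \<open>n\<close>.
  The new user \<open>(X, Y)\<close> is independent of everything else, and \<open>R n\<close> is independent of all the
  other sources of randomness, including the ratings: if \<open>R n\<close> were allowed to select
  the users \<open>i\<close> according to \<open>Y\<^sub>i\<close>, or \<open>M\<close> to depend on \<open>(X, Y)\<close>, the estimate would in general
  be asymptotically biased.
\<close>

locale recommendation_model = prob_space P
  for P :: "'w measure" +
  fixes s :: real
    and X :: "'w \<Rightarrow> real^'d::finite" and Y :: "'w \<Rightarrow> real" and M :: "'w \<Rightarrow> 'd set"
    and Xs :: "nat \<Rightarrow> 'w \<Rightarrow> real^'d" and Ys :: "nat \<Rightarrow> 'w \<Rightarrow> real"
    and G :: "nat \<Rightarrow> 'w \<Rightarrow> 'd set" and Ms :: "nat \<Rightarrow> nat \<Rightarrow> 'w \<Rightarrow> 'd set"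
    and R :: "nat \<Rightarrow> 'w \<Rightarrow> nat set"
  assumes s_gt_1: "s > 1"
    and new_user_measurable:
      "(\<lambda>\<omega>. (X \<omega>, Y \<omega>)) \<in> measurable P (borel \<Otimes>\<^sub>M borel)"
    and new_user_range:
      "\<And>\<omega>. \<omega> \<in> space P \<Longrightarrow> (\<forall>j. X \<omega> $ j \<in> {1..s}) \<and> Y \<omega> \<in> {1..s}"
    and new_mask_measurable: "M \<in> measurable P (count_space (UNIV - {{}}))"
    and db_user_measurable:
      "\<And>i. i \<ge> 1 \<Longrightarrow> (\<lambda>\<omega>. (Xs i \<omega>, Ys i \<omega>)) \<in> measurable P (borel \<Otimes>\<^sub>M borel)"
    and db_user_distr:
      "\<And>i. i \<ge> 1 \<Longrightarrow> distr P (borel \<Otimes>\<^sub>M borel) (\<lambda>\<omega>. (Xs i \<omega>, Ys i \<omega>)) =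
                      distr P (borel \<Otimes>\<^sub>M borel) (\<lambda>\<omega>. (X \<omega>, Y \<omega>))"
    and generic_mask_measurable:
      "\<And>n. n \<ge> 1 \<Longrightarrow> G n \<in> measurable P (count_space (UNIV - {{}}))"
    and generic_mask_full:
      "\<exists>n0 \<in> measurable P (count_space UNIV). \<forall>\<omega>\<in>space P. n0 \<omega> \<ge> (1::nat) \<and>
          (\<forall>n\<ge>n0 \<omega>. G n \<omega> = UNIV)"
    and db_mask_measurable:
      "\<And>i n. i \<ge> 1 \<Longrightarrow> n \<ge> 1 \<Longrightarrow> Ms i n \<in> measurable P (count_space (UNIV - {{}}))"
    and db_mask_mono:
      "\<And>i n \<omega>. i \<ge> 1 \<Longrightarrow> n \<ge> 1 \<Longrightarrow> \<omega> \<in> space P \<Longrightarrow> Ms i n \<omega> \<subseteq> Ms i (n + 1) \<omega>"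
    and db_mask_distr:
      "\<And>i. i \<ge> 1 \<Longrightarrow> distr P mask_seq_space (mask_seq (Ms i)) = distr P mask_seq_space (mask_seq G)"
    and new_mask_distr: "distr P (count_space UNIV) M = distr P (count_space UNIV) (G 1)"
    and sources_indep: "indep_sets (source_sigma P X Y M Xs Ys Ms) sources"
    and R_measurable:
      "\<And>n. n \<ge> 1 \<Longrightarrow> R n \<in> measurable P (count_space (Pow {1..n} - {{}}))"
    and R_mono: "\<And>n \<omega>. n \<ge> 1 \<Longrightarrow> \<omega> \<in> space P \<Longrightarrow> R n \<omega> \<subseteq> R (n + 1) \<omega>"
    and R_indep:
      "\<And>n. n \<ge> 1 \<Longrightarrow>
         indep_set (sets (vimage_algebra (space P) (R n) (count_space (Pow {1..n} - {{}}))))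
           (sigma_sets (space P) (\<Union>v\<in>sources. source_sigma P X Y M Xs Ys Ms v))"

end

theory Submission
  imports Defs
begin

text \<open>
  Fix a value \<open>m\<close> of \<open>M\<close>. A database user whose mask does not contain \<open>m\<close> has similarity at
  most \<open>1 - 1/|m|\<close> to the new user, while for the other users the similarity is the cosine
  \<open>1 - \<bar>z - z\<^sub>i\<bar>\<^sup>2/2\<close> of the revealed directions \<open>z\<close>, \<open>z\<^sub>i\<close>. Hence, as soon as \<open>k\<close> users with a mask
  containing \<open>m\<close> are close enough, the estimate is the ordinary \<open>k\<close>-nearest neighbour mean of the ratios
  \<open>Y\<^sub>i/\<bar>X\<^sub>i\<bar>\<close> over these users, up to the factor \<open>\<bar>X\<bar>\<close>.
  Masks and available users are independent of the ratings, so these users can be treated as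
  a fixed index set \<open>A\<close>, and the mean is consistent as \<open>k \<rightarrow> \<infinity>\<close>, \<open>k/|A| \<rightarrow> 0\<close> by Stone's
  argument: the regression function is approximated by a continuous function in \<open>L\<^sup>1\<close>, the error
  of this approximation at the neighbours is controlled by exchangeability, and the noise is
  uncorrelated. Finally, at most \<open>L\<close> of the available users entered the database during the last
  \<open>L\<close> steps, and the others are unlikely to have an incomplete mask, so \<open>|A|\<close> is of the order of
  the number of available users.
\<close>

subsection \<open>Nearest neighbours\<close>

text \<open>Two obstacles shape the proof. The function \<psi> regresses on a direction that mixes
  all masks, while the neighbour argument runs for one mask m. Valid ratings never vanish, so a
  revealed direction has support exactly \<open>M \<omega>\<close>; testing against functions that
  vanish unless the support is m makes the same \<psi> the regression function for every m of
  positive probability. Secondly, the set A of users whose mask contains m is random. Consistency is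
  therefore proved with thresholds K and \<delta> that serve all finite A with
  \<open>K \<le> k\<close> and \<open>k \<le> \<delta> * card A\<close>, and the error is then
  summed over the finitely many joint values of the available users, M and A. The gap in similarity
  turns into a radius: \<open>1 - d\<^sup>2 / 2 > 1 - 1 / card m\<close> means
  \<open>d < sqrt (2 / card m)\<close>, and k users within this radius are "close enough". The
  hypothesis on \<open>k / card R\<close> is used twice: it makes k small compared with A and, as
  \<open>k \<ge> 1\<close>, it makes the share of the L latest users vanish.\<close>

lemma closer_irrefl: "\<not> closer S i i"
  by (simp add: closer_def)

lemma closer_trans: "closer S i j \<Longrightarrow> closer S j l \<Longrightarrow> closer S i l"
  by (auto simp: closer_def)

lemma closer_total: "i \<noteq> j \<Longrightarrow> closer S i j \<or> closer S j i"
  by (auto simp: closer_def)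

definition nearest :: "nat \<Rightarrow> (nat \<Rightarrow> real) \<Rightarrow> nat set \<Rightarrow> nat set" where
  "nearest k S A = {i \<in> A. card {j \<in> A. closer S j i} < k}"

lemma nearest_subset: "nearest k S A \<subseteq> A"
  by (auto simp: nearest_def)

text \<open>The rank of a member, the number of members closer than it, strictly increases along a
  total order. Hence it is a bijection from A onto \<open>{..<card A}\<close>, and
  \<open>nearest\<close> is the preimage of \<open>{..<k}\<close>.\<close>

lemma card_nearest:
  assumes "finite A"
  shows "card (nearest k S A) = min k (card A)"
proof -
  define rank where "rank i = card {j \<in> A. closer S j i}" for i
  have less: "rank i < rank j" if "i \<in> A" "closer S i j" for i j
  proof -
    have "{l \<in> A. closer S l i} \<subseteq> {l \<in> A. closer S l j}"
      using that by (auto intro: closer_trans)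
    moreover have "i \<in> {l \<in> A. closer S l j} - {l \<in> A. closer S l i}"
      using that by (simp add: closer_irrefl)
    ultimately show ?thesis
      unfolding rank_def using assms by (intro psubset_card_mono) auto
  qed
  have inj: "inj_on rank A"
    by (rule inj_onI) (metis closer_total less nat_less_le)
  have "rank ` A \<subseteq> {..<card A}"
  proof (rule image_subsetI)
    fix i assume "i \<in> A"
    then have "{l \<in> A. closer S l i} \<subset> A"
      using closer_irrefl by blast
    then show "rank i \<in> {..<card A}"
      unfolding rank_def using assms by (auto intro: psubset_card_mono)
  qed
  moreover have "card (rank ` A) = card {..<card A}"
    by (simp add: card_image inj)
  ultimately have range: "rank ` A = {..<card A}"
    by (simp add: card_subset_eq)
  have "nearest k S A = {i \<in> A. rank i < k}"
    by (simp add: nearest_def rank_def)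
  then have "rank ` nearest k S A = {..<card A} \<inter> {..<k}"
    using range by auto
  also have "\<dots> = {..<min k (card A)}"
    by auto
  finally have "rank ` nearest k S A = {..<min k (card A)}" .
  moreover have "card (rank ` nearest k S A) = card (nearest k S A)"
    by (rule card_image) (rule inj_on_subset[OF inj nearest_subset])
  ultimately show ?thesis
    by simp
qed

text \<open>A member with score at most t is preceded by every member above t, so its rank is
  already at least k.\<close>

lemma nearest_above:
  assumes "finite A" "k \<le> card {i \<in> A. S i > t}" "i \<in> nearest k S A"
  shows "S i > t"
proof (rule ccontr)
  assume "\<not> S i > t"
  then have "{j \<in> A. S j > t} \<subseteq> {j \<in> A. closer S j i}"
    by (auto simp: closer_def)
  then have "card {j \<in> A. S j > t} \<le> card {j \<in> A. closer S j i}"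
    using assms(1) by (intro card_mono) auto
  then show False
    using assms(2,3) by (auto simp: nearest_def)
qed

text \<open>This discards the users with incomplete masks. Neither selection reaches down to t, and
  above t the members that precede a given one are the same in A and in B.\<close>

lemma nearest_superset_eq:
  assumes "finite B" "A \<subseteq> B" "k \<le> card {i \<in> A. S i > t}" "\<And>i. i \<in> B - A \<Longrightarrow> S i \<le> t"
  shows "nearest k S B = nearest k S A"
proof -
  have fin: "finite A"
    using assms finite_subset by blast
  have eq: "{i \<in> B. S i > t} = {i \<in> A. S i > t}"
    using assms(2,4) by (auto simp: not_less[symmetric])
  have *: "{j \<in> B. closer S j i} = {j \<in> A. closer S j i}" if "S i > t" for i
    using that assms(2,4) by (force simp: closer_def)
  have "i \<in> nearest k S B \<longleftrightarrow> i \<in> nearest k S A" for i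
  proof (cases "S i > t")
    case True
    with assms(2,4) have "i \<in> B \<longleftrightarrow> i \<in> A"
      by force
    with *[OF True] show ?thesis
      by (simp add: nearest_def)
  next
    case False
    with nearest_above[of A k t S i] nearest_above[of B k t S i] fin assms show ?thesis
      by (auto simp: eq)
  qed
  then show ?thesis
    by blast
qed

text \<open>The selection sees the scores only through their strict order on A; a tie is the failure
  of both strict comparisons. This allows similarities to be exchanged for negative
  distances.\<close>

lemma nearest_cong:
  assumes "\<And>i j. i \<in> A \<Longrightarrow> j \<in> A \<Longrightarrow> S i < S j \<longleftrightarrow> S' i < S' j"
  shows "nearest k S A = nearest k S' A"
proof -
  have "closer S j i \<longleftrightarrow> closer S' j i" if "i \<in> A" "j \<in> A" for i j
    using assms[of i j] assms[of j i] that by (auto simp: closer_def)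
  then have "{j \<in> A. closer S j i} = {j \<in> A. closer S' j i}" if "i \<in> A" for i
    using that by auto
  then show ?thesis
    by (auto simp: nearest_def)
qed

section \<open>Small covers and Stone's cone argument\<close>

lemma finite_small_cover:
  fixes K :: "'a::metric_space set"
  assumes "compact K" "e > 0"
  obtains \<B> where "finite \<B>" "K \<subseteq> \<Union>\<B>" "\<And>B a b. B \<in> \<B> \<Longrightarrow> a \<in> B \<Longrightarrow> b \<in> B \<Longrightarrow> dist a b < e"
proof -
  obtain C where C: "finite C" "K \<subseteq> (\<Union>c\<in>C. ball c (e/2))"
    using assms by (auto simp: compact_eq_totally_bounded) (metis half_gt_zero)
  show thesis
  proof (rule that[of "(\<lambda>c. ball c (e/2)) ` C"])
    fix B a b assume "B \<in> (\<lambda>c. ball c (e/2)) ` C" "a \<in> B" "b \<in> B"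
    then show "dist a b < e"
      by (auto intro: dist_triangle_half_r)
  qed (use C in auto)
qed

text \<open>Unit vectors at distance below 1 enclose an angle below 60 degrees, so their inner
  product exceeds 1/2. Then \<open>2 * inner u v\<close> exceeds \<open>norm u * norm v\<close>,
  which is at least \<open>(norm u)\<^sup>2\<close>, and expanding the square of
  \<open>norm (v - u)\<close> gives the claim.\<close>

lemma dist_less_norm_of_directions_close:
  fixes u v :: "'a::real_inner"
  assumes "u \<noteq> 0" "v \<noteq> 0" "norm u \<le> norm v" "dist (u /\<^sub>R norm u) (v /\<^sub>R norm v) < 1"
  shows "dist v u < norm v"
proof -
  define a where "a = u /\<^sub>R norm u"
  define b where "b = v /\<^sub>R norm v"
  have ab: "norm a = 1" "norm b = 1"
    using assms by (auto simp: a_def b_def)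
  have "(norm (a - b))\<^sup>2 < 1"
    using assms(4) by (simp add: a_def b_def dist_norm power_less_one_iff)
  then have *: "inner a b > 1/2"
    using ab dot_norm_neg[of a b] by simp
  have uv: "u = norm u *\<^sub>R a" "v = norm v *\<^sub>R b"
    using assms by (auto simp: a_def b_def)
  have "inner u v = norm u * norm v * inner a b"
    by (subst uv(1), subst uv(2)) simp
  then have "2 * inner u v > norm u * norm v"
    using * assms mult_strict_left_mono[of "1/2" "inner a b" "norm u * norm v"] by simp
  moreover have "norm u * norm u \<le> norm u * norm v"
    using assms by (intro mult_left_mono) auto
  moreover have "(norm (v - u))\<^sup>2 = (norm v)\<^sup>2 + (norm u)\<^sup>2 - 2 * inner u v"
    by (simp add: power2_norm_eq_inner inner_diff inner_commute)
  ultimately have "(norm (v - u))\<^sup>2 < (norm v)\<^sup>2"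
    by (simp add: power2_eq_square)
  then show ?thesis
    unfolding dist_norm by (rule power2_less_imp_less) simp
qed

text \<open>Stone's geometric lemma: within a cone with apex \<open>x\<close> that is narrow enough, a point has
  every point of the cone nearer to \<open>x\<close> as a strictly nearer neighbour than \<open>x\<close> itself, so
  only the \<open>k\<close> points nearest to \<open>x\<close> can have \<open>x\<close> among their \<open>k\<close> nearest neighbours. The
  points equal to \<open>x\<close> are ordered by their indices and counted apart.\<close>

lemma stone_count:
  fixes zs :: "nat \<Rightarrow> 'a::real_inner" and \<B> :: "'a set set"
  assumes "finite A" "finite \<B>" "sphere 0 1 \<subseteq> \<Union>\<B>"
    and diam: "\<And>B a b. B \<in> \<B> \<Longrightarrow> a \<in> B \<Longrightarrow> b \<in> B \<Longrightarrow> dist a b < 1"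
  shows "card {i \<in> A. i \<in> nearest k (\<lambda>l. - dist (zs i) ((zs(i := x)) l)) A} \<le> (card \<B> + 1) * k"
    (is "card ?N \<le> _")
proof -
  define dir where "dir i = (zs i - x) /\<^sub>R norm (zs i - x)" for i
  define T0 where "T0 = {i \<in> A. zs i = x}"
  define T :: "'a set \<Rightarrow> nat set" where "T B = {i \<in> A. zs i \<noteq> x \<and> dir i \<in> B}" for B
  let ?S = "\<lambda>l. - dist x (zs l)"
  let ?S' = "\<lambda>i l. - dist (zs i) ((zs(i := x)) l)"
  have "dir i \<in> sphere 0 1" if "zs i \<noteq> x" for i
    using that by (simp add: dir_def)
  then have cover: "A \<subseteq> T0 \<union> (\<Union>B\<in>\<B>. T B)"
    using assms(3) unfolding T0_def T_def by blast
  \<comment> \<open>Seen from a point equal to x, all of T0 is at distance 0, the best possible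
    score. Only the indices rank these points, as under a constant score.\<close>
  have 0: "?N \<inter> T0 \<subseteq> nearest k (\<lambda>_. 0) T0"
  proof
    fix i assume i: "i \<in> ?N \<inter> T0"
    have "{j \<in> T0. closer (\<lambda>_. 0) j i} \<subseteq> {j \<in> A. closer (?S' i) j i}"
      using i by (auto simp: T0_def closer_def)
    then have "card {j \<in> T0. closer (\<lambda>_. 0) j i} \<le> card {j \<in> A. closer (?S' i) j i}"
      using assms(1) by (intro card_mono) auto
    then show "i \<in> nearest k (\<lambda>_. 0) T0"
      using i by (auto simp: nearest_def)
  qed
  have 1: "?N \<inter> T B \<subseteq> nearest k ?S (T B)" if B: "B \<in> \<B>" for B
  proof
    fix i assume i: "i \<in> ?N \<inter> T B"
    have "{j \<in> T B. closer ?S j i} \<subseteq> {j \<in> A. closer (?S' i) j i}"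
    proof safe
      fix j assume j: "j \<in> T B" "closer ?S j i"
      then have "norm (zs j - x) \<le> norm (zs i - x)" "j \<noteq> i"
        by (auto simp: closer_def dist_norm norm_minus_commute)
      moreover have "dist (dir j) (dir i) < 1"
        using i j B diam by (auto simp: T_def)
      ultimately have "dist (zs i - x) (zs j - x) < norm (zs i - x)"
        using i j by (intro dist_less_norm_of_directions_close) (auto simp: T_def dir_def)
      \<comment> \<open>In the score \<open>?S' i\<close> the slot i holds x, so j precedes i as
        soon as \<open>zs j\<close> is strictly nearer to \<open>zs i\<close> than x is.\<close>
      then have "dist (zs i) (zs j) < dist (zs i) x"
        by (simp add: dist_norm)
      then show "closer (?S' i) j i"
        using \<open>j \<noteq> i\<close> by (simp add: closer_def)
    qed (simp add: T_def)
    then have "card {j \<in> T B. closer ?S j i} \<le> card {j \<in> A. closer (?S' i) j i}"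
      using assms(1) by (intro card_mono) auto
    then show "i \<in> nearest k ?S (T B)"
      using i by (auto simp: nearest_def)
  qed
  have fin: "finite (nearest k S T0)" "finite (nearest k S (T B))" for S B
    using assms(1) by (auto simp: nearest_def T0_def T_def)
  have "?N \<subseteq> nearest k (\<lambda>_. 0) T0 \<union> (\<Union>B\<in>\<B>. nearest k ?S (T B))"
    using cover 0 1 by blast
  then have "card ?N \<le> card (nearest k (\<lambda>_. 0) T0 \<union> (\<Union>B\<in>\<B>. nearest k ?S (T B)))"
    using fin assms(2) by (intro card_mono) auto
  also have "\<dots> \<le> card (nearest k (\<lambda>_. 0) T0) + (\<Sum>B\<in>\<B>. card (nearest k ?S (T B)))"
    by (intro order.trans[OF card_Un_le] add_left_mono card_UN_le assms)
  also have "\<dots> \<le> k + (\<Sum>B\<in>\<B>. k)"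
    using assms(1) by (intro add_mono sum_mono) (auto simp: card_nearest T0_def T_def)
  finally show ?thesis
    by simp
qed

text \<open>All points in one set of the cover are within \<rho> of each other. If more than k of
  the isolated points lay in the same set, each of them would have at least k others close to
  it.\<close>

lemma card_few_close_le:
  fixes zs :: "nat \<Rightarrow> 'a::metric_space"
  assumes "finite I" "finite \<B>" "zs ` I \<subseteq> \<Union>\<B>"
    and diam: "\<And>B a b. B \<in> \<B> \<Longrightarrow> a \<in> B \<Longrightarrow> b \<in> B \<Longrightarrow> dist a b < \<rho>"
  shows "card {j \<in> I. card {i \<in> I - {j}. dist (zs j) (zs i) < \<rho>} < k} \<le> card \<B> * k"
    (is "card ?N \<le> _")
proof -
  have "card (?N \<inter> zs -` B) \<le> k" if B: "B \<in> \<B>" for B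
  proof (rule ccontr)
    assume k: "\<not> card (?N \<inter> zs -` B) \<le> k"
    then have "?N \<inter> zs -` B \<noteq> {}"
      by (auto simp del: Int_iff simp: card_gt_0_iff not_le)
    then obtain j where j: "j \<in> ?N \<inter> zs -` B"
      by blast
    then have "k \<le> card (?N \<inter> zs -` B - {j})"
      using k by (simp add: card_Diff_singleton)
    also have "\<dots> \<le> card {i \<in> I - {j}. dist (zs j) (zs i) < \<rho>}"
      using assms(1) j B diam by (intro card_mono) auto
    also have "\<dots> < k"
      using j by simp
    finally show False
      by simp
  qed
  moreover have "card ?N \<le> (\<Sum>B\<in>\<B>. card (?N \<inter> zs -` B))"
  proof -
    have "?N \<subseteq> (\<Union>B\<in>\<B>. ?N \<inter> zs -` B)"
      using assms(3) by blast
    then have "card ?N \<le> card (\<Union>B\<in>\<B>. ?N \<inter> zs -` B)"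
      using assms(1,2) by (intro card_mono) auto
    also have "\<dots> \<le> (\<Sum>B\<in>\<B>. card (?N \<inter> zs -` B))"
      by (intro card_UN_le assms)
    finally show ?thesis .
  qed
  ultimately show ?thesis
    using sum_bounded_above[of \<B> "\<lambda>B. card (?N \<inter> zs -` B)" k] by simp
qed

subsection \<open>Approximation by continuous functions\<close>

text \<open>Regularity encloses B between a compact K and an open U with \<open>U - K\<close> of
  measure at most \<epsilon>. A Urysohn function for K and the complement of U differs from the
  indicator of B only on \<open>U - K\<close>, and there by at most 1.\<close>

lemma indicator_approx_continuous:
  fixes N :: "'a::euclidean_space measure"
  assumes "finite_measure N" "sets N = sets borel" "B \<in> sets N" "\<epsilon> > 0"
  obtains g :: "'a \<Rightarrow> real" where "continuous_on UNIV g" "integrable N g"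
    "(\<integral>x. \<bar>indicator B x - g x\<bar> \<partial>N) \<le> \<epsilon>"
proof -
  interpret finite_measure N by fact
  have B: "B \<in> sets borel"
    using assms by simp
  have fin: "emeasure N B < \<infinity>" "emeasure N (space N) \<noteq> \<infinity>"
    by (simp_all add: less_top[symmetric])
  have "emeasure N B < emeasure N B + ennreal (\<epsilon>/2)"
    using assms(4) fin(1) by (simp add: ennreal_add_left_cancel_less less_top)
  then obtain U where U: "B \<subseteq> U" "open U" "emeasure N U < emeasure N B + ennreal (\<epsilon>/2)"
    unfolding outer_regular[OF assms(2) fin(2) B, symmetric]
    by (subst (asm) (1) outer_regular[OF assms(2) fin(2) B]) (auto simp: INF_less_iff)
  have "\<exists>K. K \<subseteq> B \<and> compact K \<and> measure N B - \<epsilon>/2 < measure N K"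
  \<comment> \<open>\<open>ennreal\<close> sends a negative bound to 0, and being strictly above 0
    fails for a null set B. In that case the empty compact set does.\<close>
  proof (cases "measure N B - \<epsilon>/2 < 0")
    case True
    then show ?thesis
      by (intro exI[of _ "{}"]) auto
  next
    case False
    have "ennreal (measure N B - \<epsilon>/2) < emeasure N B"
      using False assms(4) unfolding emeasure_eq_measure by (subst ennreal_less_iff) auto
    then obtain K where "K \<subseteq> B" "compact K" "ennreal (measure N B - \<epsilon>/2) < emeasure N K"
      unfolding inner_regular[OF assms(2) fin(2) B] by (auto simp: less_SUP_iff)
    then show ?thesis
      using False unfolding emeasure_eq_measure by (subst (asm) ennreal_less_iff) auto
  qed
  then obtain K where K: "K \<subseteq> B" "compact K" "measure N B - \<epsilon>/2 < measure N K"
    by blast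
  have "measure N U < measure N B + \<epsilon>/2"
    using U(3) assms(4) unfolding emeasure_eq_measure
    by (subst (asm) ennreal_plus[symmetric]) (auto simp: ennreal_less_iff simp del: ennreal_plus)
  moreover have sets: "K \<in> sets N" "U \<in> sets N"
    using K(2) U(2) assms(2) by (auto intro: borel_compact)
  ultimately have diff: "measure N (U - K) \<le> \<epsilon>"
    using K U by (subst finite_measure_Diff) auto
  obtain g where g: "continuous_on UNIV g" "\<And>x. g x \<in> closed_segment (1::real) 0"
      "\<And>x. x \<in> K \<Longrightarrow> g x = 1" "\<And>x. x \<in> - U \<Longrightarrow> g x = 0"
    using K U by (rule_tac Urysohn[of K "- U" "1::real" 0]) (auto intro: compact_imp_closed)
  have [measurable]: "g \<in> borel_measurable N"
    using borel_measurable_continuous_onI[OF g(1)] assms(2) by (simp cong: measurable_cong_sets)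
  have g01: "0 \<le> g x" "g x \<le> 1" for x
    using g(2)[of x] by (auto simp: closed_segment_eq_real_ivl)
  have int: "integrable N g"
    using g01 by (intro integrable_const_bound[where B=1]) auto
  have "(\<integral>x. \<bar>indicator B x - g x\<bar> \<partial>N) \<le> (\<integral>x. indicator (U - K) x \<partial>N)"
  proof (rule integral_mono')
    show "\<bar>indicator B x - g x\<bar> \<le> indicator (U - K) x" for x
      using g(3,4)[of x] g01[of x] K U by (auto simp: indicator_def)
  qed (use sets in \<open>auto simp: emeasure_eq_measure\<close>)
  also have "\<dots> \<le> \<epsilon>"
    using diff sets by simp
  finally show thesis
    using that g(1) int by blast
qed

text \<open>The functions that can be approximated contain the multiples of indicators and are
  closed under sums and dominated limits, so the induction principle for integrable functions
  reaches all of them.\<close>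

lemma integrable_approx_continuous:
  fixes N :: "'a::euclidean_space measure" and f :: "'a \<Rightarrow> real"
  assumes "finite_measure N" "sets N = sets borel" "integrable N f" "\<epsilon> > 0"
  shows "\<exists>g. continuous_on UNIV g \<and> integrable N g \<and> (\<integral>x. \<bar>f x - g x\<bar> \<partial>N) \<le> \<epsilon>"
  using assms(3,4)
proof (induction arbitrary: \<epsilon> rule: integrable_induct)
  case (base A c)
  \<comment> \<open>The summand 1 keeps the tolerance finite when \<open>c = 0\<close>.\<close>
  have "\<epsilon> / (\<bar>c\<bar> + 1) > 0"
    using base by simp
  then obtain g where g: "continuous_on UNIV g" "integrable N g"
      "(\<integral>x. \<bar>indicator A x - g x\<bar> \<partial>N) \<le> \<epsilon> / (\<bar>c\<bar> + 1)"
    using indicator_approx_continuous[OF assms(1,2) base(1)] by blast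
  have "(\<integral>x. \<bar>indicator A x *\<^sub>R c - g x * c\<bar> \<partial>N) = (\<integral>x. \<bar>indicator A x - g x\<bar> * \<bar>c\<bar> \<partial>N)"
    by (intro Bochner_Integration.integral_cong) (auto simp: left_diff_distrib abs_mult[symmetric])
  also have "\<dots> = (\<integral>x. \<bar>indicator A x - g x\<bar> \<partial>N) * \<bar>c\<bar>"
    by simp
  also have "\<dots> \<le> \<epsilon> / (\<bar>c\<bar> + 1) * \<bar>c\<bar>"
    by (intro mult_right_mono g) auto
  also have "\<dots> \<le> \<epsilon>"
    using base by (simp add: field_simps)
  finally show ?case
    using g by (intro exI[of _ "\<lambda>x. g x * c"]) (auto intro!: continuous_intros)
next
  case (add f1 f2)
  obtain g1 where g1: "continuous_on UNIV g1" "integrable N g1" "(\<integral>x. \<bar>f1 x - g1 x\<bar> \<partial>N) \<le> \<epsilon>/2"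
    using add.IH(1)[of "\<epsilon>/2"] add.prems by auto
  obtain g2 where g2: "continuous_on UNIV g2" "integrable N g2" "(\<integral>x. \<bar>f2 x - g2 x\<bar> \<partial>N) \<le> \<epsilon>/2"
    using add.IH(2)[of "\<epsilon>/2"] add.prems by auto
  have "(\<integral>x. \<bar>(f1 x + f2 x) - (g1 x + g2 x)\<bar> \<partial>N) \<le> (\<integral>x. \<bar>f1 x - g1 x\<bar> + \<bar>f2 x - g2 x\<bar> \<partial>N)"
    using add.hyps g1 g2 by (intro integral_mono) auto
  also have "\<dots> \<le> \<epsilon>"
    using add.hyps g1 g2 by (subst Bochner_Integration.integral_add) auto
  finally show ?case
    using g1 g2 by (intro exI[of _ "\<lambda>x. g1 x + g2 x"]) (auto intro!: continuous_intros)
next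
  case (lim f sq)
  have [measurable]: "sq i \<in> borel_measurable N" "f \<in> borel_measurable N" for i
    using lim.hyps by auto
  have "(\<lambda>i. \<integral>x. \<bar>f x - sq i x\<bar> \<partial>N) \<longlonglongrightarrow> (\<integral>x. 0 \<partial>N)"
  \<comment> \<open>The induction principle provides approximants bounded by
    \<open>2 * \<bar>f x\<bar>\<close>, so the differences are bounded by
    \<open>3 * \<bar>f x\<bar>\<close>.\<close>
  proof (rule integral_dominated_convergence[where w="\<lambda>x. 3 * \<bar>f x\<bar>"])
    show "AE x in N. (\<lambda>i. \<bar>f x - sq i x\<bar>) \<longlonglongrightarrow> 0"
    proof (rule AE_I2)
      fix x assume "x \<in> space N"
      then have "(\<lambda>i. \<bar>f x - sq i x\<bar>) \<longlonglongrightarrow> \<bar>f x - f x\<bar>"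
        by (intro tendsto_intros lim.hyps)
      then show "(\<lambda>i. \<bar>f x - sq i x\<bar>) \<longlonglongrightarrow> 0"
        by simp
    qed
    show "AE x in N. norm \<bar>f x - sq i x\<bar> \<le> 3 * \<bar>f x\<bar>" for i
    proof (rule AE_I2)
      fix x assume "x \<in> space N"
      then show "norm \<bar>f x - sq i x\<bar> \<le> 3 * \<bar>f x\<bar>"
        using lim.hyps(3)[of x i] by auto
    qed
  qed (use lim.hyps in auto)
  then have "(\<lambda>i. \<integral>x. \<bar>f x - sq i x\<bar> \<partial>N) \<longlonglongrightarrow> 0"
    by simp
  then have "eventually (\<lambda>i. (\<integral>x. \<bar>f x - sq i x\<bar> \<partial>N) < \<epsilon>/2) sequentially"
    using lim.prems by (intro order_tendstoD) auto
  then obtain i where i: "(\<integral>x. \<bar>f x - sq i x\<bar> \<partial>N) < \<epsilon>/2"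
    by (auto simp: eventually_sequentially)
  obtain g where g: "continuous_on UNIV g" "integrable N g" "(\<integral>x. \<bar>sq i x - g x\<bar> \<partial>N) \<le> \<epsilon>/2"
    using lim.IH[of "\<epsilon>/2" i] lim.prems by auto
  have "(\<integral>x. \<bar>f x - g x\<bar> \<partial>N) \<le> (\<integral>x. \<bar>f x - sq i x\<bar> + \<bar>sq i x - g x\<bar> \<partial>N)"
    using lim.hyps g by (intro integral_mono) auto
  also have "\<dots> \<le> \<epsilon>"
    using lim.hyps g i by (subst Bochner_Integration.integral_add) auto
  finally show ?case
    using g by auto
qed

subsection \<open>Exchangeable samples\<close>

lemma measurable_nearest [measurable]:
  assumes "finite A" and [measurable]: "\<And>l. l \<in> A \<Longrightarrow> (\<lambda>w. f w l) \<in> borel_measurable N"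
  shows "Measurable.pred N (\<lambda>w. i \<in> nearest k (f w) A)"
proof (cases "i \<in> A")
  case True
  have "card {j \<in> A. closer (f w) j i} = (\<Sum>j\<in>A. if closer (f w) j i then 1 else 0)" for w
    using assms(1) by (simp add: sum.If_cases Int_def)
  then have eq: "i \<in> nearest k (f w) A \<longleftrightarrow> (\<Sum>j\<in>A. if closer (f w) j i then 1 else 0) < k" for w
    using True by (simp add: nearest_def)
  have [measurable]: "Measurable.pred N (\<lambda>w. closer (f w) j i)" if "j \<in> A" for j
  proof -
    have [measurable]: "(\<lambda>w. f w j) \<in> borel_measurable N" "(\<lambda>w. f w i) \<in> borel_measurable N"
      using assms(2) that True by auto
    show ?thesis
      unfolding closer_def by measurable
  qed
  show ?thesis
    unfolding eq by measurable
qed (simp add: nearest_def)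

text \<open>This is the nonnegativity of the variance of the absolute value. It converts the second
  moment of the noise into a bound in mean.\<close>

lemma (in prob_space) expectation_abs_le_sqrt:
  assumes "integrable M f" "integrable M (\<lambda>x. (f x)\<^sup>2)"
  shows "expectation (\<lambda>x. \<bar>f x\<bar>) \<le> sqrt (expectation (\<lambda>x. (f x)\<^sup>2))"
proof (rule real_le_rsqrt)
  have "0 \<le> variance (\<lambda>x. \<bar>f x\<bar>)"
    by (rule variance_positive)
  then show "(expectation (\<lambda>x. \<bar>f x\<bar>))\<^sup>2 \<le> expectation (\<lambda>x. (f x)\<^sup>2)"
    using assms by (subst (asm) variance_eq) auto
qed

lemma integral_of_bool:
  "(\<integral>x. of_bool (P x) \<partial>N) = measure N {x \<in> space N. P x}"
proof -
  have "(\<integral>x. of_bool (P x) \<partial>N) = (\<integral>x. indicator {x. P x} x \<partial>N)"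
    by (intro Bochner_Integration.integral_cong) (auto simp: indicator_def)
  also have "\<dots> = measure N {x \<in> space N. P x}"
    by (simp add: Int_def conj_commute)
  finally show ?thesis .
qed

text \<open>Index \<open>0\<close> of a sample is the point of prediction and \<open>A\<close> indexes the data. The assumption
  \<open>orthogonal\<close> says that \<open>\<psi>\<close> is the regression function of \<open>v\<close> on \<open>z\<close>.\<close>

locale iid_regression = prob_space D
  for D :: "'b measure" +
  fixes z :: "'b \<Rightarrow> 'a::euclidean_space" and v :: "'b \<Rightarrow> real" and \<psi> :: "'a \<Rightarrow> real" and s :: real
  assumes z_measurable [measurable]: "z \<in> borel_measurable D"
    and v_measurable [measurable]: "v \<in> borel_measurable D"
    and \<psi>_measurable [measurable]: "\<psi> \<in> borel_measurable borel"
    and norm_z_le: "x \<in> space D \<Longrightarrow> norm (z x) \<le> 1"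
    and v_bounds: "x \<in> space D \<Longrightarrow> 0 \<le> v x \<and> v x \<le> s"
    and \<psi>_bounds: "0 \<le> \<psi> y" "\<psi> y \<le> s"
    and orthogonal: "h \<in> borel_measurable borel \<Longrightarrow> (\<And>y. \<bar>h y\<bar> \<le> C) \<Longrightarrow>
      (\<integral>x. h (z x) * (v x - \<psi> (z x)) \<partial>D) = 0"
begin

abbreviation sample :: "nat set \<Rightarrow> (nat \<Rightarrow> 'b) measure" where
  "sample I \<equiv> Pi\<^sub>M I (\<lambda>_. D)"

definition sel :: "nat \<Rightarrow> nat set \<Rightarrow> (nat \<Rightarrow> 'b) \<Rightarrow> nat set" where
  "sel k A w = nearest k (\<lambda>l. - dist (z (w 0)) (z (w l))) A"

text \<open>Off this event all the selected points lie within \<rho> of the point of prediction, by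
  \<open>nearest_above\<close>. It is the bad event both for the continuity argument and for the
  similarity gap, with different radii.\<close>

definition few :: "real \<Rightarrow> nat \<Rightarrow> nat set \<Rightarrow> (nat \<Rightarrow> 'b) \<Rightarrow> bool" where
  "few \<rho> k A w \<longleftrightarrow> card {i \<in> A. dist (z (w 0)) (z (w i)) < \<rho>} < k"

lemma s_nonneg: "0 \<le> s"
  using \<psi>_bounds[of 0] by linarith

lemma prob_space_sample: "prob_space (sample I)"
  by (intro prob_space_PiM prob_space_axioms)

lemma product_prob_space_sample: "product_prob_space (\<lambda>_::nat. D)"
  by unfold_locales

lemma sample_component_space: "w \<in> space (sample I) \<Longrightarrow> i \<in> I \<Longrightarrow> w i \<in> space D"
  by (auto simp: space_PiM)

lemma integral_component:
  fixes f :: "'b \<Rightarrow> real"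
  assumes "i \<in> I" "f \<in> borel_measurable D"
  shows "(\<integral>w. f (w i) \<partial>sample I) = (\<integral>x. f x \<partial>D)"
proof -
  interpret product_prob_space "\<lambda>_::nat. D"
    by (rule product_prob_space_sample)
  have "(\<integral>x. f x \<partial>D) = (\<integral>x. f x \<partial>distr (sample I) D (\<lambda>w. w i))"
    using PiM_component[OF assms(1)] by simp
  also have "\<dots> = (\<integral>w. f (w i) \<partial>sample I)"
    using assms by (intro integral_distr) auto
  finally show ?thesis ..
qed

text \<open>A product of identical factors is invariant under a transposition of coordinates; this
  is the form in which exchangeability enters.\<close>

lemma integral_swap:
  fixes f :: "(nat \<Rightarrow> 'b) \<Rightarrow> real"
  assumes "i \<in> I" "j \<in> I" "f \<in> borel_measurable (sample I)"
  shows "(\<integral>w. f w \<partial>sample I) = (\<integral>w. f (w(i := w j, j := w i)) \<partial>sample I)"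
proof -
  let ?t = "Transposition.transpose i j"
  have "?t \<in> I \<rightarrow> I" "inj_on ?t I"
    using assms by (auto simp: Transposition.transpose_def inj_on_def)
  then have "distr (sample I) (sample I) (\<lambda>w. \<lambda>n\<in>I. w (?t n)) = sample I"
    using distr_PiM_reindex[of I "\<lambda>_. D" ?t I] prob_space_axioms by simp
  then have "(\<integral>w. f w \<partial>sample I) = (\<integral>w. f w \<partial>distr (sample I) (sample I) (\<lambda>w. \<lambda>n\<in>I. w (?t n)))"
    by simp
  also have "\<dots> = (\<integral>w. f (\<lambda>n\<in>I. w (?t n)) \<partial>sample I)"
    using assms \<open>?t \<in> I \<rightarrow> I\<close>
    by (intro integral_distr measurable_restrict measurable_component_singleton) auto
  also have "\<dots> = (\<integral>w. f (w(i := w j, j := w i)) \<partial>sample I)"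
  proof (rule Bochner_Integration.integral_cong[OF refl])
    fix w assume "w \<in> space (sample I)"
    then have "(\<lambda>n\<in>I. w (?t n)) = w(i := w j, j := w i)"
      using assms
      by (auto simp: fun_eq_iff space_PiM PiE_def extensional_def Transposition.transpose_def)
    then show "f (\<lambda>n\<in>I. w (?t n)) = f (w(i := w j, j := w i))"
      by simp
  qed
  finally show ?thesis .
qed

lemma measurable_sel [measurable]:
  assumes "finite A"
  shows "Measurable.pred (sample (insert 0 A)) (\<lambda>w. i \<in> sel k A w)"
  unfolding sel_def using assms by (intro measurable_nearest) measurable

lemma measurable_few [measurable]:
  assumes "finite A"
  shows "Measurable.pred (sample (insert 0 A)) (few \<rho> k A)"
proof -
  have "few \<rho> k A w \<longleftrightarrow> (\<Sum>i\<in>A. if dist (z (w 0)) (z (w i)) < \<rho> then 1 else 0) < k" for w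
    using assms by (simp add: few_def sum.If_cases Int_def)
  then have eq: "few \<rho> k A = (\<lambda>w. (\<Sum>i\<in>A. if dist (z (w 0)) (z (w i)) < \<rho> then 1 else 0) < k)"
    by blast
  show ?thesis
    unfolding eq by measurable
qed

lemma sel_subset: "sel k A w \<subseteq> A"
  by (auto simp: sel_def nearest_def)

lemma card_sel: "finite A \<Longrightarrow> card (sel k A w) = min k (card A)"
  by (simp add: sel_def card_nearest)

text \<open>Replaces the random range of summation by the fixed A, so that sum and integral can be
  interchanged.\<close>

lemma sum_sel:
  fixes f :: "nat \<Rightarrow> real"
  assumes "finite A"
  shows "(\<Sum>i\<in>sel k A w. f i) = (\<Sum>i\<in>A. of_bool (i \<in> sel k A w) * f i)"
proof -
  have "(\<Sum>i\<in>A. of_bool (i \<in> sel k A w) * f i) = (\<Sum>i\<in>A. if i \<in> sel k A w then f i else 0)"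
    by (intro sum.cong) auto
  also have "\<dots> = (\<Sum>i\<in>A \<inter> sel k A w. f i)"
    using assms by (simp add: sum.inter_restrict)
  also have "A \<inter> sel k A w = sel k A w"
    using sel_subset by blast
  finally show ?thesis ..
qed

text \<open>Exchanging the point of prediction with datum i preserves the integral of the i-th term
  and turns it into f at the point of prediction, counted if that point is among the neighbours of
  datum i. By \<open>stone_count\<close> this happens for at most \<gamma> k indices, where \<gamma>
  is the number of cones plus one and depends on the ambient space only. The bounds on f are asked
  on the unit ball only, where z takes its values, because f will be the distance from \<psi> to a
  continuous function that may be unbounded elsewhere.\<close>

lemma stone_inequality:
  "\<exists>\<gamma>::nat. \<forall>A k f C. finite A \<longrightarrow> 0 \<notin> A \<longrightarrow> f \<in> borel_measurable borel \<longrightarrow>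
    (\<forall>y\<in>cball 0 1. 0 \<le> f y \<and> f y \<le> C) \<longrightarrow>
    (\<integral>w. (\<Sum>i\<in>sel k A w. f (z (w i))) \<partial>sample (insert 0 A)) \<le> real (\<gamma> * k) * (\<integral>x. f (z x) \<partial>D)"
proof -
  obtain \<B> :: "'a set set" where \<B>: "finite \<B>" "sphere 0 1 \<subseteq> \<Union>\<B>"
      "\<And>B a b. B \<in> \<B> \<Longrightarrow> a \<in> B \<Longrightarrow> b \<in> B \<Longrightarrow> dist a b < 1"
    using finite_small_cover[of "sphere (0::'a) 1" 1] by auto
  show ?thesis
  proof (intro exI[of _ "card \<B> + 1"] allI impI)
    fix A :: "nat set" and k :: nat and f :: "'a \<Rightarrow> real" and C :: real
    assume A: "finite A" "0 \<notin> A" and f[measurable]: "f \<in> borel_measurable borel"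
      and f_bound: "\<forall>y\<in>cball 0 1. 0 \<le> f y \<and> f y \<le> C"
    let ?Q = "sample (insert 0 A)"
    interpret Q: prob_space ?Q
      by (rule prob_space_sample)
    note [measurable] = measurable_sel[OF A(1)]
    have fz: "0 \<le> f (z (w i))" "f (z (w i)) \<le> C" "\<bar>f (z (w i))\<bar> \<le> C"
      if "w \<in> space ?Q" "i \<in> insert 0 A" for w i
      using f_bound norm_z_le[OF sample_component_space[OF that]] by auto
    have swap_space: "w(0 := w i, i := w 0) \<in> space ?Q" if "w \<in> space ?Q" "i \<in> A" for w i
      using that by (auto simp: space_PiM PiE_def extensional_def Pi_def)
    let ?g = "\<lambda>i w. of_bool (i \<in> sel k A w) * f (z (w i))"
    have g_meas: "?g i \<in> borel_measurable ?Q" if "i \<in> A" for i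
    proof -
      have [measurable]: "(\<lambda>w. w i) \<in> measurable ?Q D"
        using that by auto
      show ?thesis
        by measurable
    qed
    have swap_meas: "(\<lambda>w. w(0 := w i, i := w 0)) \<in> measurable ?Q ?Q" if "i \<in> A" for i
    proof -
      have [measurable]: "(\<lambda>w. w i) \<in> measurable ?Q D" "(\<lambda>w. w 0) \<in> measurable ?Q D"
        using that by auto
      show ?thesis
      proof (rule measurable_PiM_single')
        show "(\<lambda>w n. (w(0 := w i, i := w 0)) n) \<in> space ?Q \<rightarrow> (\<Pi>\<^sub>E i\<in>insert 0 A. space D)"
        proof (rule Pi_I)
          fix w assume "w \<in> space ?Q"
          then have "w(0 := w i, i := w 0) \<in> space ?Q"
            using that by (rule swap_space)
          then show "(\<lambda>n. (w(0 := w i, i := w 0)) n) \<in> (\<Pi>\<^sub>E i\<in>insert 0 A. space D)"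
            unfolding space_PiM .
        qed
        show "(\<lambda>w. (w(0 := w i, i := w 0)) n) \<in> measurable ?Q D" if "n \<in> insert 0 A" for n
          using that by (cases "n = i"; cases "n = 0") auto
      qed
    qed
    have g_bound: "norm (?g i w) \<le> C" if "w \<in> space ?Q" "i \<in> A" for w i
      using fz[OF that(1), of i] that(2) by (cases "i \<in> sel k A w") auto
    have g_int: "integrable ?Q (?g i)" if "i \<in> A" for i
      using that g_meas g_bound by (intro Q.integrable_const_bound[where B=C] AE_I2) auto
    have gs_int: "integrable ?Q (\<lambda>w. ?g i (w(0 := w i, i := w 0)))" if "i \<in> A" for i
      using that measurable_compose[OF swap_meas[OF that] g_meas[OF that]]
      by (intro Q.integrable_const_bound[where B=C] AE_I2 g_bound swap_space)
    \<comment> \<open>After the exchange one predicts at \<open>z (w i)\<close>, and slot i of the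
      data holds the former point of prediction. This is the configuration counted in
      \<open>stone_count\<close>.\<close>
    have sel_swap: "sel k A (w(0 := w i, i := w 0)) =
        nearest k (\<lambda>l. - dist (z (w i)) (((z \<circ> w)(i := z (w 0))) l)) A" if "i \<in> A" for w i
    proof -
      have "i \<noteq> 0"
        using that A(2) by metis
      then show ?thesis
        unfolding sel_def by (intro nearest_cong) (use A in \<open>auto\<close>)
    qed
    have "(\<integral>w. (\<Sum>i\<in>sel k A w. f (z (w i))) \<partial>?Q) = (\<Sum>i\<in>A. \<integral>w. ?g i w \<partial>?Q)"
      unfolding sum_sel[OF A(1)] using g_int by (rule Bochner_Integration.integral_sum)
    also have "\<dots> = (\<Sum>i\<in>A. \<integral>w. ?g i (w(0 := w i, i := w 0)) \<partial>?Q)"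
      by (intro sum.cong refl integral_swap g_meas) auto
    also have "\<dots> = (\<integral>w. (\<Sum>i\<in>A. ?g i (w(0 := w i, i := w 0))) \<partial>?Q)"
      using gs_int by (rule Bochner_Integration.integral_sum[symmetric])
    also have "\<dots> \<le> (\<integral>w. real ((card \<B> + 1) * k) * f (z (w 0)) \<partial>?Q)"
    proof (rule integral_mono)
      show "integrable ?Q (\<lambda>w. real ((card \<B> + 1) * k) * f (z (w 0)))"
        using fz by (intro integrable_mult_right Q.integrable_const_bound[where B=C]) auto
      show "integrable ?Q (\<lambda>w. \<Sum>i\<in>A. ?g i (w(0 := w i, i := w 0)))"
        using gs_int by (rule Bochner_Integration.integrable_sum)
      fix w assume w: "w \<in> space ?Q"
      let ?S = "\<lambda>i l. - dist (z (w i)) (((z \<circ> w)(i := z (w 0))) l)"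
      have "(\<Sum>i\<in>A. ?g i (w(0 := w i, i := w 0))) = (\<Sum>i\<in>A. of_bool (i \<in> nearest k (?S i) A) * f (z (w 0)))"
        using A by (intro sum.cong) (auto simp: sel_swap)
      also have "\<dots> = real (card {i \<in> A. i \<in> nearest k (?S i) A}) * f (z (w 0))"
        using A(1) by (simp add: sum_distrib_right[symmetric] Int_def)
      also have "\<dots> \<le> real ((card \<B> + 1) * k) * f (z (w 0))"
        using stone_count[OF A(1) \<B>, where k=k and zs="z \<circ> w" and x="z (w 0)"] fz(1)[OF w]
        by (intro mult_right_mono of_nat_mono) auto
      finally show "(\<Sum>i\<in>A. ?g i (w(0 := w i, i := w 0))) \<le> real ((card \<B> + 1) * k) * f (z (w 0))" .
    qed
    also have "\<dots> = real ((card \<B> + 1) * k) * (\<integral>x. f (z x) \<partial>D)"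
      using integral_component[of 0 "insert 0 A" "\<lambda>x. f (z x)"] by simp
    finally show "(\<integral>w. (\<Sum>i\<in>sel k A w. f (z (w i))) \<partial>?Q) \<le> real ((card \<B> + 1) * k) * (\<integral>x. f (z x) \<partial>D)" .
  qed
qed

text \<open>By exchangeability the point of prediction is no more likely to be isolated than any of the
  other \<open>|A|\<close> points, and a cover of the unit ball by small sets bounds the number of isolated points.\<close>

lemma prob_few_le:
  assumes "\<rho> > 0"
  shows "\<exists>L::nat. \<forall>A k. finite A \<longrightarrow> 0 \<notin> A \<longrightarrow>
    measure (sample (insert 0 A)) {w \<in> space (sample (insert 0 A)). few \<rho> k A w} \<le> real (L * k) / real (card A + 1)"
proof -
  obtain \<B> :: "'a set set" where \<B>: "finite \<B>" "cball 0 1 \<subseteq> \<Union>\<B>"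
      "\<And>B a b. B \<in> \<B> \<Longrightarrow> a \<in> B \<Longrightarrow> b \<in> B \<Longrightarrow> dist a b < \<rho>"
    using finite_small_cover[of "cball (0::'a) 1" \<rho>] assms by auto
  show ?thesis
  proof (intro exI[of _ "card \<B>"] allI impI)
    fix A :: "nat set" and k :: nat
    assume A: "finite A" "0 \<notin> A"
    let ?I = "insert 0 A"
    let ?Q = "sample ?I"
    interpret Q: prob_space ?Q
      by (rule prob_space_sample)
    define bad where "bad j w \<longleftrightarrow> card {i \<in> ?I - {j}. dist (z (w j)) (z (w i)) < \<rho>} < k" for j w
    have bad_0: "bad 0 w \<longleftrightarrow> few \<rho> k A w" for w
      using A by (simp add: bad_def few_def)
    have [measurable]: "Measurable.pred ?Q (bad j)" if "j \<in> ?I" for j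
    proof -
      have [measurable]: "(\<lambda>w. w j) \<in> measurable ?Q D"
        using that by (rule measurable_component_singleton)
      have "bad j w \<longleftrightarrow> (\<Sum>i\<in>?I - {j}. if dist (z (w j)) (z (w i)) < \<rho> then 1 else 0) < k" for w
        using A by (simp add: bad_def sum.If_cases Int_def)
      then have eq: "bad j = (\<lambda>w. (\<Sum>i\<in>?I - {j}. if dist (z (w j)) (z (w i)) < \<rho> then 1 else 0) < k)"
        by blast
      show ?thesis
        unfolding eq by measurable
    qed
    have int: "integrable ?Q (\<lambda>w. of_bool (bad j w) :: real)" if "j \<in> ?I" for j
      using that by (intro Q.integrable_const_bound[where B=1]) auto
    have swap: "bad 0 (w(0 := w j, j := w 0)) = bad j w" if "j \<in> ?I" for j w
    proof -
      let ?t = "Transposition.transpose 0 j"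
      let ?w = "w(0 := w j, j := w 0)"
      have w: "?w i = w (?t i)" for i
        by (simp add: Transposition.transpose_def)
      \<comment> \<open>The transposition matches the indices close to position 0 after the exchange
        with those close to position j before it.\<close>
      have *: "bij_betw ?t {i \<in> ?I - {0}. dist (z (?w 0)) (z (?w i)) < \<rho>}
              {i \<in> ?I - {j}. dist (z (w j)) (z (w i)) < \<rho>}"
        unfolding w using that
        by (intro bij_betw_byWitness[where f'="?t"]) (auto simp: Transposition.transpose_def)
      then show ?thesis
        unfolding bad_def using bij_betw_same_card[OF *] by simp
    qed
    have "real (card A + 1) * measure ?Q {w \<in> space ?Q. few \<rho> k A w} = (\<Sum>j\<in>?I. \<integral>w. of_bool (bad 0 w) \<partial>?Q)"
      using A by (simp add: bad_0 integral_of_bool)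
    also have "\<dots> = (\<Sum>j\<in>?I. \<integral>w. of_bool (bad 0 (w(0 := w j, j := w 0))) \<partial>?Q)"
      by (intro sum.cong refl integral_swap) auto
    also have "\<dots> = (\<Sum>j\<in>?I. \<integral>w. of_bool (bad j w) \<partial>?Q)"
      by (simp only: swap cong: sum.cong)
    also have "\<dots> = (\<integral>w. (\<Sum>j\<in>?I. of_bool (bad j w)) \<partial>?Q)"
      using int by (rule Bochner_Integration.integral_sum[symmetric])
    also have "\<dots> \<le> (\<integral>w. real (card \<B> * k) \<partial>?Q)"
    proof (rule integral_mono)
      show "integrable ?Q (\<lambda>w. \<Sum>j\<in>?I. of_bool (bad j w) :: real)"
        using int by (rule Bochner_Integration.integrable_sum)
      fix w assume w: "w \<in> space ?Q"
      have "(z \<circ> w) ` ?I \<subseteq> \<Union>\<B>"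
      proof (rule image_subsetI)
        fix i assume "i \<in> ?I"
        then have "z (w i) \<in> cball 0 1"
          using norm_z_le[OF sample_component_space[OF w]] by simp
        then show "(z \<circ> w) i \<in> \<Union>\<B>"
          using \<B>(2) by auto
      qed
      then have "card {j \<in> ?I. bad j w} \<le> card \<B> * k"
        unfolding bad_def using card_few_close_le[of ?I \<B> "z \<circ> w" \<rho> k] A \<B> by simp
      then have "real (card {j \<in> ?I. bad j w}) \<le> real (card \<B> * k)"
        by (rule of_nat_mono)
      moreover have "(\<Sum>j\<in>?I. of_bool (bad j w)) = real (card {j \<in> ?I. bad j w})"
        using A by (simp only: sum_of_bool_eq finite_insert Int_def mem_Collect_eq)
      ultimately show "(\<Sum>j\<in>?I. of_bool (bad j w)) \<le> real (card \<B> * k)"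
        by simp
    qed simp
    also have "\<dots> = real (card \<B> * k)"
      by (simp add: Q.prob_space)
    finally show "measure ?Q {w \<in> space ?Q. few \<rho> k A w} \<le> real (card \<B> * k) / real (card A + 1)"
      by (simp add: field_simps)
  qed
qed

section \<open>The noise at the selected points\<close>

lemma residual_bound: "x \<in> space D \<Longrightarrow> \<bar>v x - \<psi> (z x)\<bar> \<le> s"
  using v_bounds[of x] \<psi>_bounds[of "z x"] by auto

text \<open>With all coordinates but i fixed, the selection depends on coordinate i only through its
  z-value, and the residual at j is a constant. The integrand is thus a bounded function of
  \<open>z (w i)\<close> times the residual at i, and the inner integral vanishes by
  \<open>orthogonal\<close>.\<close>

lemma residuals_uncorrelated:
  assumes A: "finite A" "0 \<notin> A" and ij: "i \<in> A" "j \<in> A" "i \<noteq> j"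
  shows "(\<integral>w. of_bool (i \<in> sel k A w) * (v (w i) - \<psi> (z (w i))) *
           (of_bool (j \<in> sel k A w) * (v (w j) - \<psi> (z (w j)))) \<partial>sample (insert 0 A)) = 0"
    (is "integral\<^sup>L _ ?F = 0")
proof -
  let ?I = "insert 0 A - {i}"
  interpret product_prob_space "\<lambda>_::nat. D"
    by (rule product_prob_space_sample)
  interpret Q: prob_space "sample (insert 0 A)"
    by (rule prob_space_sample)
  have I: "insert i ?I = insert 0 A" "finite ?I" "i \<notin> ?I"
    using A ij by auto
  have 0: "0 \<noteq> i" "0 \<noteq> j"
    using A(2) ij by metis+
  note [measurable] = measurable_sel[OF A(1)]
  have [measurable]: "(\<lambda>w. w i) \<in> measurable (sample (insert 0 A)) D"
      "(\<lambda>w. w j) \<in> measurable (sample (insert 0 A)) D"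
    using ij by auto
  have bound: "norm (?F w) \<le> s * s" if "w \<in> space (sample (insert 0 A))" for w
  proof -
    have "\<bar>v (w i) - \<psi> (z (w i))\<bar> \<le> s" "\<bar>v (w j) - \<psi> (z (w j))\<bar> \<le> s"
      using ij sample_component_space[OF that] by (auto intro!: residual_bound)
    then show ?thesis
      using s_nonneg by (auto simp: abs_mult mult_mono)
  qed
  have int: "integrable (sample (insert 0 A)) ?F"
    using bound by (intro Q.integrable_const_bound[where B="s * s"]) auto
  have "(\<integral>y. ?F (w(i := y)) \<partial>D) = 0" if w: "w \<in> space (sample ?I)" for w
  proof -
    \<comment> \<open>The location of datum i becomes a free variable y in the scores, so that h is
      a Borel function on the whole space, as \<open>orthogonal\<close> demands.\<close>
    define S where "S y = (\<lambda>l. - dist (z (w 0)) (((z \<circ> w)(i := y)) l))" for y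
    define h where "h y = of_bool (i \<in> nearest k (S y) A) * of_bool (j \<in> nearest k (S y) A) *
      (v (w j) - \<psi> (z (w j)))" for y
    have "(\<lambda>y. S y l) \<in> borel_measurable borel" for l
      unfolding S_def by (cases "l = i") auto
    then have [measurable]: "Measurable.pred borel (\<lambda>y. n \<in> nearest k (S y) A)" for n
      using A(1) by (intro measurable_nearest)
    have h: "h \<in> borel_measurable borel"
      unfolding h_def by measurable
    have "w j \<in> space D"
      using sample_component_space[OF w] ij by auto
    then have h_bound: "\<bar>h y\<bar> \<le> s" for y
      using residual_bound[of "w j"] s_nonneg by (auto simp: h_def)
    have "sel k A (w(i := y)) = nearest k (S (z y)) A" for y
      unfolding sel_def S_def using 0 by (intro nearest_cong) auto
    then have "?F (w(i := y)) = h (z y) * (v y - \<psi> (z y))" for y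
      using ij by (simp add: h_def)
    then have "(\<integral>y. ?F (w(i := y)) \<partial>D) = (\<integral>y. h (z y) * (v y - \<psi> (z y)) \<partial>D)"
      by (intro Bochner_Integration.integral_cong refl)
    also have "\<dots> = 0"
      using h h_bound by (rule orthogonal)
    finally show ?thesis .
  qed
  then have "(\<integral>w. (\<integral>y. ?F (w(i := y)) \<partial>D) \<partial>sample ?I) = (\<integral>w. 0 \<partial>sample ?I)"
    by (intro Bochner_Integration.integral_cong) auto
  moreover have "(\<integral>w. ?F w \<partial>sample (insert 0 A)) = (\<integral>w. (\<integral>y. ?F (w(i := y)) \<partial>D) \<partial>sample ?I)"
    using product_integral_insert[OF I(2,3), where f="?F"] int I(1) by simp
  ultimately show ?thesis
    by simp
qed

text \<open>The cross terms vanish and only the selected indices, at most k of them, contribute to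
  the diagonal. The second moment is therefore at most \<open>s\<^sup>2 * k\<close>, however large A
  is.\<close>

lemma residual_sum_le:
  assumes A: "finite A" "0 \<notin> A"
  shows "(\<integral>w. \<bar>\<Sum>i\<in>sel k A w. v (w i) - \<psi> (z (w i))\<bar> \<partial>sample (insert 0 A)) \<le> s * sqrt k"
proof -
  let ?Q = "sample (insert 0 A)"
  interpret Q: prob_space ?Q
    by (rule prob_space_sample)
  note [measurable] = measurable_sel[OF A(1)]
  define U where "U i w = of_bool (i \<in> sel k A w) * (v (w i) - \<psi> (z (w i)))" for i w
  have [measurable]: "U i \<in> borel_measurable ?Q" if "i \<in> A" for i
  proof -
    have [measurable]: "(\<lambda>w. w i) \<in> measurable ?Q D"
      using that by auto
    show ?thesis
      unfolding U_def by measurable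
  qed
  have U_bound: "\<bar>U i w\<bar> \<le> of_bool (i \<in> sel k A w) * s" if "w \<in> space ?Q" "i \<in> A" for i w
    using residual_bound[OF sample_component_space[OF that(1)], of i] that(2) by (auto simp: U_def)
  have U_bound': "\<bar>U i w\<bar> \<le> s" if "w \<in> space ?Q" "i \<in> A" for i w
    using U_bound[OF that] s_nonneg by (auto simp: of_bool_def split: if_splits)
  have U_int: "integrable ?Q (U i)" if "i \<in> A" for i
    using U_bound' that by (intro Q.integrable_const_bound[where B=s]) auto
  have UU_int: "integrable ?Q (\<lambda>w. U i w * U j w)" if "i \<in> A" "j \<in> A" for i j
  proof (rule Q.integrable_const_bound[where B="s * s"])
    show "AE w in ?Q. norm (U i w * U j w) \<le> s * s"
      using U_bound' that s_nonneg by (intro AE_I2) (auto simp: abs_mult intro!: mult_mono)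
  qed (use that in measurable)
  have sq: "(\<Sum>i\<in>A. U i w)\<^sup>2 = (\<Sum>i\<in>A. \<Sum>j\<in>A. U i w * U j w)" for w
    by (simp add: power2_eq_square sum_product)
  have sq_int: "integrable ?Q (\<lambda>w. (\<Sum>i\<in>A. U i w)\<^sup>2)"
    unfolding sq by (intro Bochner_Integration.integrable_sum UU_int)
  have "(\<integral>w. (\<Sum>i\<in>A. U i w)\<^sup>2 \<partial>?Q) = (\<Sum>i\<in>A. \<Sum>j\<in>A. \<integral>w. U i w * U j w \<partial>?Q)"
    unfolding sq by (simp add: Bochner_Integration.integral_sum UU_int)
  also have "\<dots> = (\<Sum>i\<in>A. \<Sum>j\<in>A. if j = i then \<integral>w. U i w * U i w \<partial>?Q else 0)"
    using residuals_uncorrelated[OF A] by (intro sum.cong) (auto simp: U_def)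
  also have "\<dots> = (\<integral>w. (\<Sum>i\<in>A. U i w * U i w) \<partial>?Q)"
    using A(1) UU_int by (simp add: Bochner_Integration.integral_sum)
  also have "\<dots> \<le> (\<integral>w. s\<^sup>2 * k \<partial>?Q)"
  proof (rule integral_mono)
    show "integrable ?Q (\<lambda>w. \<Sum>i\<in>A. U i w * U i w)"
      by (intro Bochner_Integration.integrable_sum UU_int)
    fix w assume w: "w \<in> space ?Q"
    have "(\<Sum>i\<in>A. U i w * U i w) \<le> (\<Sum>i\<in>A. of_bool (i \<in> sel k A w) * s\<^sup>2)"
    proof (rule sum_mono)
      fix i assume "i \<in> A"
      then have "\<bar>U i w\<bar>\<^sup>2 \<le> (of_bool (i \<in> sel k A w) * s)\<^sup>2"
        using U_bound[OF w] by (intro power_mono) auto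
      then show "U i w * U i w \<le> of_bool (i \<in> sel k A w) * s\<^sup>2"
        by (auto simp: power2_eq_square[symmetric] power_mult_distrib of_bool_def split: if_splits)
    qed
    also have "\<dots> = s\<^sup>2 * real (card (sel k A w))"
      using sum_sel[OF A(1), of "\<lambda>_. s\<^sup>2" k w] by (simp add: mult.commute)
    also have "\<dots> \<le> s\<^sup>2 * k"
      using A(1) by (intro mult_left_mono) (auto simp: card_sel)
    finally show "(\<Sum>i\<in>A. U i w * U i w) \<le> s\<^sup>2 * k" .
  qed simp
  also have "\<dots> = s\<^sup>2 * k"
    by (simp add: Q.prob_space)
  finally have le: "sqrt (\<integral>w. (\<Sum>i\<in>A. U i w)\<^sup>2 \<partial>?Q) \<le> s * sqrt k"
    using s_nonneg by (intro real_le_lsqrt) (auto simp: power_mult_distrib)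
  have "(\<integral>w. \<bar>\<Sum>i\<in>A. U i w\<bar> \<partial>?Q) \<le> sqrt (\<integral>w. (\<Sum>i\<in>A. U i w)\<^sup>2 \<partial>?Q)"
    using sq_int by (intro Q.expectation_abs_le_sqrt Bochner_Integration.integrable_sum U_int)
  with le show ?thesis
    unfolding sum_sel[OF A(1)] U_def by linarith
qed

section \<open>Consistency of the nearest neighbour mean for a fixed index set\<close>

definition knn_mean :: "nat \<Rightarrow> nat set \<Rightarrow> (nat \<Rightarrow> 'b) \<Rightarrow> real" where
  "knn_mean k A w = (\<Sum>i\<in>sel k A w. v (w i)) / real k"

lemma knn_mean_bounds:
  assumes "finite A" "w \<in> space (sample (insert 0 A))"
  shows "0 \<le> knn_mean k A w" "knn_mean k A w \<le> s"
proof -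
  have v: "0 \<le> v (w i)" "v (w i) \<le> s" if "i \<in> sel k A w" for i
    using v_bounds[OF sample_component_space[OF assms(2)]] that sel_subset[of k A w] by auto
  show "0 \<le> knn_mean k A w"
    unfolding knn_mean_def using v by (intro divide_nonneg_nonneg sum_nonneg) auto
  have "(\<Sum>i\<in>sel k A w. v (w i)) \<le> real (card (sel k A w)) * s"
    using v by (intro sum_bounded_above) auto
  also have "\<dots> \<le> real k * s"
    using s_nonneg assms(1) by (intro mult_right_mono) (auto simp: card_sel)
  finally show "knn_mean k A w \<le> s"
    unfolding knn_mean_def using s_nonneg by (cases "k = 0") (auto simp: field_simps)
qed

lemma measurable_knn_mean [measurable]:
  assumes "finite A"
  shows "knn_mean k A \<in> borel_measurable (sample (insert 0 A))"
proof -
  note [measurable] = measurable_sel[OF assms]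
  have eq: "knn_mean k A = (\<lambda>w. (\<Sum>i\<in>A. of_bool (i \<in> sel k A w) * v (w i)) / real k)"
    by (simp add: fun_eq_iff knn_mean_def sum_sel[OF assms])
  show ?thesis
    unfolding eq by measurable
qed

text \<open>The approximation is taken in mean under the law of z. Boundedness and uniform
  continuity of g come from compactness of the unit ball, hence are stated there only.\<close>

lemma continuous_approx_regression:
  assumes "\<epsilon> > 0"
  shows "\<exists>g B \<rho>. g \<in> borel_measurable borel \<and> (\<integral>x. \<bar>\<psi> (z x) - g (z x)\<bar> \<partial>D) \<le> \<epsilon> \<and>
    (\<forall>y\<in>cball 0 1. \<bar>g y\<bar> \<le> B) \<and> 0 \<le> B \<and> \<rho> > 0 \<and>
    (\<forall>x\<in>cball 0 1. \<forall>y\<in>cball 0 1. dist x y < \<rho> \<longrightarrow> \<bar>g x - g y\<bar> \<le> \<epsilon>)"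
proof -
  interpret N: prob_space "distr D borel z"
    by (rule prob_space_distr) measurable
  have "integrable (distr D borel z) \<psi>"
    using \<psi>_bounds by (intro N.integrable_const_bound[where B=s]) auto
  then obtain g where g: "continuous_on UNIV g" "integrable (distr D borel z) g"
      "(\<integral>x. \<bar>\<psi> x - g x\<bar> \<partial>distr D borel z) \<le> \<epsilon>"
    using integrable_approx_continuous[OF N.finite_measure_axioms _ _ assms] by auto
  have g_meas: "g \<in> borel_measurable borel"
    using g(1) by (rule borel_measurable_continuous_onI)
  have cont: "continuous_on (cball 0 1) g"
    using g(1) by (rule continuous_on_subset) simp
  have "bounded (g ` cball 0 1)"
    by (intro compact_imp_bounded compact_continuous_image cont compact_cball)
  then obtain B where "\<forall>y\<in>g ` cball 0 1. norm y \<le> B"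
    unfolding bounded_iff by blast
  then have B: "\<bar>g y\<bar> \<le> B" if "y \<in> cball 0 1" for y
    using that by force
  have "uniformly_continuous_on (cball 0 1) g"
    by (intro compact_uniformly_continuous cont compact_cball)
  then obtain \<rho> where \<rho>: "\<rho> > 0"
      "\<And>x y. x \<in> cball 0 1 \<Longrightarrow> y \<in> cball 0 1 \<Longrightarrow> dist y x < \<rho> \<Longrightarrow> dist (g y) (g x) < \<epsilon>"
    using assms unfolding uniformly_continuous_on_def by blast
  have "(\<integral>x. \<bar>\<psi> (z x) - g (z x)\<bar> \<partial>D) \<le> \<epsilon>"
    using g(3) g_meas by (subst (asm) integral_distr) auto
  moreover have "0 \<le> B"
    using B[of 0] by simp
  moreover have "\<forall>x\<in>cball 0 1. \<forall>y\<in>cball 0 1. dist x y < \<rho> \<longrightarrow> \<bar>g x - g y\<bar> \<le> \<epsilon>"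
    using \<rho>(2) by (metis dist_commute dist_real_def less_imp_le)
  ultimately show ?thesis
    using g_meas B \<rho>(1) by blast
qed

text \<open>Inserting g at the neighbours and at the point of prediction splits the error into
  noise, approximation error at the neighbours, oscillation of g, and approximation error at the
  point of prediction. The oscillation is at most \<epsilon> when all the neighbours are within
  \<rho>, and at most 2 B in any case.\<close>

lemma knn_mean_error_le:
  assumes A: "finite A" "k \<le> card A" "0 < k"
    and g: "\<And>y. y \<in> cball 0 1 \<Longrightarrow> \<bar>g y\<bar> \<le> B" "0 \<le> B" "0 \<le> \<epsilon>"
      "\<And>x y. x \<in> cball 0 1 \<Longrightarrow> y \<in> cball 0 1 \<Longrightarrow> dist x y < \<rho> \<Longrightarrow> \<bar>g x - g y\<bar> \<le> \<epsilon>"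
    and w: "w \<in> space (sample (insert 0 A))"
  shows "\<bar>knn_mean k A w - \<psi> (z (w 0))\<bar> \<le>
    \<bar>\<Sum>i\<in>sel k A w. v (w i) - \<psi> (z (w i))\<bar> / k + (\<Sum>i\<in>sel k A w. \<bar>\<psi> (z (w i)) - g (z (w i))\<bar>) / k
      + (\<epsilon> + 2 * B * of_bool (few \<rho> k A w)) + \<bar>\<psi> (z (w 0)) - g (z (w 0))\<bar>"
proof -
  let ?N = "sel k A w"
  let ?e = "\<epsilon> + 2 * B * of_bool (few \<rho> k A w)"
  have card: "card ?N = k"
    using A by (simp add: card_sel)
  have z_ball: "z (w i) \<in> cball 0 1" if "i \<in> insert 0 A" for i
    using norm_z_le[OF sample_component_space[OF w that]] by simp
  have g_diff: "\<bar>g (z (w i)) - g (z (w 0))\<bar> \<le> ?e" if i: "i \<in> ?N" for i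
  proof (cases "few \<rho> k A w")
    case True
    then show ?thesis
      using g(1)[OF z_ball[of 0]] g(1)[OF z_ball[of i]] i sel_subset[of k A w] g(3) by auto
  next
    case False
    have "- dist (z (w 0)) (z (w i)) > - \<rho>"
    proof (rule nearest_above[OF A(1)])
      show "k \<le> card {i \<in> A. - dist (z (w 0)) (z (w i)) > - \<rho>}"
        using False by (simp add: few_def)
    qed (use i in \<open>simp add: sel_def\<close>)
    then show ?thesis
      using g(4)[OF z_ball[of i] z_ball[of 0]] i sel_subset[of k A w] False
      by (auto simp: dist_commute)
  qed
  have 1: "\<bar>\<Sum>i\<in>?N. \<psi> (z (w i)) - g (z (w i))\<bar> \<le> (\<Sum>i\<in>?N. \<bar>\<psi> (z (w i)) - g (z (w i))\<bar>)"
    by (rule sum_abs)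
  have "\<bar>\<Sum>i\<in>?N. g (z (w i)) - g (z (w 0))\<bar> \<le> (\<Sum>i\<in>?N. \<bar>g (z (w i)) - g (z (w 0))\<bar>)"
    by (rule sum_abs)
  also have "\<dots> \<le> real (card ?N) * ?e"
    using g_diff by (intro sum_bounded_above) auto
  finally have 2: "\<bar>\<Sum>i\<in>?N. g (z (w i)) - g (z (w 0))\<bar> \<le> real k * ?e"
    by (simp only: card)
  have "real k * (knn_mean k A w - \<psi> (z (w 0))) = (\<Sum>i\<in>?N. v (w i) - \<psi> (z (w 0)))"
    using A(3) by (simp add: knn_mean_def sum_subtractf card right_diff_distrib)
  also have "\<dots> = (\<Sum>i\<in>?N. v (w i) - \<psi> (z (w i))) + (\<Sum>i\<in>?N. \<psi> (z (w i)) - g (z (w i)))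
      + (\<Sum>i\<in>?N. g (z (w i)) - g (z (w 0))) + (\<Sum>i\<in>?N. g (z (w 0)) - \<psi> (z (w 0)))"
    by (simp add: sum_subtractf right_diff_distrib)
  also have "(\<Sum>i\<in>?N. g (z (w 0)) - \<psi> (z (w 0))) = real k * (g (z (w 0)) - \<psi> (z (w 0)))"
    by (simp add: card)
  finally have "real k * \<bar>knn_mean k A w - \<psi> (z (w 0))\<bar> =
      \<bar>(\<Sum>i\<in>?N. v (w i) - \<psi> (z (w i))) + (\<Sum>i\<in>?N. \<psi> (z (w i)) - g (z (w i)))
      + (\<Sum>i\<in>?N. g (z (w i)) - g (z (w 0))) + real k * (g (z (w 0)) - \<psi> (z (w 0)))\<bar>"
    using abs_mult[of "real k" "knn_mean k A w - \<psi> (z (w 0))"] by simp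
  also have "\<dots> \<le> \<bar>\<Sum>i\<in>?N. v (w i) - \<psi> (z (w i))\<bar> + (\<Sum>i\<in>?N. \<bar>\<psi> (z (w i)) - g (z (w i))\<bar>)
      + real k * ?e + real k * \<bar>g (z (w 0)) - \<psi> (z (w 0))\<bar>"
    using 1 2 abs_mult[of "real k" "g (z (w 0)) - \<psi> (z (w 0))"] by linarith
  also have "\<dots> = real k * (\<bar>\<Sum>i\<in>?N. v (w i) - \<psi> (z (w i))\<bar> / k + (\<Sum>i\<in>?N. \<bar>\<psi> (z (w i)) - g (z (w i))\<bar>) / k
      + ?e + \<bar>\<psi> (z (w 0)) - g (z (w 0))\<bar>)"
    using A(3) by (simp add: distrib_left abs_minus_commute)
  finally show ?thesis
    using A(3) by (simp only: mult_le_cancel_left_pos of_nat_0_less_iff)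
qed

text \<open>K and \<delta> do not depend on A or k, because A will be random. The radius \<rho> is
  prescribed from outside, by the similarity gap; the proof uses a second radius \<rho>', at which
  the approximating function oscillates little.\<close>

theorem knn_mean_consistent:
  assumes "\<epsilon> > 0" "\<rho> > 0"
  shows "\<exists>(K::nat) (\<delta>::real). \<delta> > 0 \<and> (\<forall>A k. finite A \<longrightarrow> 0 \<notin> A \<longrightarrow> K \<le> k \<longrightarrow> real k \<le> \<delta> * card A \<longrightarrow>
    (\<integral>w. \<bar>knn_mean k A w - \<psi> (z (w 0))\<bar> \<partial>sample (insert 0 A)) \<le> \<epsilon> \<and>
    measure (sample (insert 0 A)) {w \<in> space (sample (insert 0 A)). few \<rho> k A w} \<le> \<epsilon>)"
proof -
  obtain \<gamma> :: nat where "\<forall>A k f C. finite A \<longrightarrow> 0 \<notin> A \<longrightarrow> f \<in> borel_measurable borel \<longrightarrow>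
      (\<forall>y\<in>cball 0 1. 0 \<le> f y \<and> f y \<le> C) \<longrightarrow>
      (\<integral>w. (\<Sum>i\<in>sel k A w. f (z (w i))) \<partial>sample (insert 0 A)) \<le> real (\<gamma> * k) * (\<integral>x. f (z x) \<partial>D)"
    using stone_inequality by (rule exE)
  then have \<gamma>: "(\<integral>w. (\<Sum>i\<in>sel k A w. f (z (w i))) \<partial>sample (insert 0 A)) \<le> real (\<gamma> * k) * (\<integral>x. f (z x) \<partial>D)"
    if "finite A" "0 \<notin> A" "f \<in> borel_measurable borel" "\<And>y. y \<in> cball 0 1 \<Longrightarrow> 0 \<le> f y \<and> f y \<le> C" for A k f C
    using that by blast
  \<comment> \<open>The approximation error is paid \<gamma> times at the neighbours, through
    Stone's inequality, and once at the point of prediction; together this makes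
    \<epsilon>/4.\<close>
  define \<epsilon>' where "\<epsilon>' = \<epsilon> / (4 * (real \<gamma> + 1))"
  have \<epsilon>': "\<epsilon>' > 0" "(real \<gamma> + 1) * \<epsilon>' = \<epsilon> / 4" "\<epsilon>' \<le> \<epsilon> / 4"
    using assms(1) by (auto simp: \<epsilon>'_def field_simps)
  from continuous_approx_regression[OF \<epsilon>'(1)] obtain g B \<rho>'
    where g_meas[measurable]: "g \<in> borel_measurable borel"
      and g_int: "(\<integral>x. \<bar>\<psi> (z x) - g (z x)\<bar> \<partial>D) \<le> \<epsilon>'"
      and g': "\<forall>y\<in>cball 0 1. \<bar>g y\<bar> \<le> B" "0 \<le> B" "\<rho>' > 0"
      "\<forall>x\<in>cball 0 1. \<forall>y\<in>cball 0 1. dist x y < \<rho>' \<longrightarrow> \<bar>g x - g y\<bar> \<le> \<epsilon>'"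
    by (elim exE conjE)
  have g: "\<And>y. y \<in> cball 0 1 \<Longrightarrow> \<bar>g y\<bar> \<le> B" "0 \<le> B" "\<rho>' > 0"
      "\<And>x y. x \<in> cball 0 1 \<Longrightarrow> y \<in> cball 0 1 \<Longrightarrow> dist x y < \<rho>' \<Longrightarrow> \<bar>g x - g y\<bar> \<le> \<epsilon>'"
    using g' by blast+
  obtain L :: nat where "\<forall>A k. finite A \<longrightarrow> 0 \<notin> A \<longrightarrow>
      measure (sample (insert 0 A)) {w \<in> space (sample (insert 0 A)). few \<rho> k A w} \<le> real (L * k) / real (card A + 1)"
    using prob_few_le[OF assms(2)] by (rule exE)
  then have L: "measure (sample (insert 0 A)) {w \<in> space (sample (insert 0 A)). few \<rho> k A w} \<le> real (L * k) / real (card A + 1)"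
    if "finite A" "0 \<notin> A" for A k
    using that by blast
  obtain L' :: nat where "\<forall>A k. finite A \<longrightarrow> 0 \<notin> A \<longrightarrow>
      measure (sample (insert 0 A)) {w \<in> space (sample (insert 0 A)). few \<rho>' k A w} \<le> real (L' * k) / real (card A + 1)"
    using prob_few_le[OF g(3)] by (rule exE)
  then have L': "measure (sample (insert 0 A)) {w \<in> space (sample (insert 0 A)). few \<rho>' k A w} \<le> real (L' * k) / real (card A + 1)"
    if "finite A" "0 \<notin> A" for A k
    using that by blast
  \<comment> \<open>The summands 1 make c positive even if \<open>B = 0\<close> or
    \<open>L' = 0\<close>; c dominates \<open>2 * B * L'\<close>.\<close>
  define c where "c = (2 * B + 1) * (real L' + 1)"
  have "c > 0"
    using g(2) by (simp add: c_def)
  \<comment> \<open>From K on, \<open>s / sqrt k\<close>, the bound on the mean noise, is at most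
    \<epsilon>/4.\<close>
  define K where "K = nat \<lceil>(4 * s / \<epsilon>)\<^sup>2\<rceil> + 1"
  \<comment> \<open>The three entries ensure in turn that \<open>k \<le> card A\<close>, that
    \<open>few \<rho>\<close> has probability at most \<epsilon>, and that
    \<open>few \<rho>'\<close> costs at most \<epsilon>/4 after multiplication by 2 B.\<close>
  define \<delta> where "\<delta> = min 1 (min (\<epsilon> / (real L + 1)) (\<epsilon> / (4 * c)))"
  have \<delta>: "\<delta> > 0" "\<delta> \<le> 1" "real L * \<delta> \<le> \<epsilon>" "2 * B * (real L' * \<delta>) \<le> \<epsilon> / 4"
  proof -
    show "\<delta> > 0" "\<delta> \<le> 1"
      using assms(1) \<open>c > 0\<close> by (auto simp: \<delta>_def)
    have "\<delta> \<le> \<epsilon> / (real L + 1)"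
      by (simp add: \<delta>_def)
    then have "(real L + 1) * \<delta> \<le> \<epsilon>"
      by (simp add: field_simps)
    then show "real L * \<delta> \<le> \<epsilon>"
      using \<open>\<delta> > 0\<close> by (simp add: distrib_right)
    have "\<delta> \<le> \<epsilon> / (4 * c)"
      by (simp add: \<delta>_def)
    then have "c * \<delta> \<le> \<epsilon> / 4"
      using \<open>c > 0\<close> by (simp add: field_simps)
    then have "(2 * B + 1) * ((real L' + 1) * \<delta>) \<le> \<epsilon> / 4"
      by (simp add: c_def mult.assoc)
    moreover have "2 * B * (real L' * \<delta>) \<le> (2 * B + 1) * ((real L' + 1) * \<delta>)"
      using g(2) \<open>\<delta> > 0\<close> by (intro mult_mono) auto
    ultimately show "2 * B * (real L' * \<delta>) \<le> \<epsilon> / 4"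
      by linarith
  qed
  show ?thesis
  proof (intro exI[of _ K] exI[of _ \<delta>] conjI allI impI \<delta>(1))
    fix A :: "nat set" and k :: nat
    assume A: "finite A" "0 \<notin> A" and k: "K \<le> k" "real k \<le> \<delta> * real (card A)"
    let ?Q = "sample (insert 0 A)"
    interpret Q: prob_space ?Q
      by (rule prob_space_sample)
    note [measurable] = measurable_sel[OF A(1)] measurable_few[OF A(1)] measurable_knn_mean[OF A(1)]
    have comp: "(\<lambda>w. w i) \<in> measurable ?Q D" if "i \<in> insert 0 A" for i
      using that by auto
    have k0: "0 < k"
      using k(1) by (simp add: K_def)
    have "real k \<le> real (card A)"
      using k(2) \<delta>(2) mult_right_mono[of \<delta> 1 "real (card A)"] by simp
    then have kA: "k \<le> card A"
      by simp
    have ratio: "real (l * k) / real (card A + 1) \<le> real l * \<delta>" for l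
    proof -
      have "real k \<le> \<delta> * real (card A + 1)"
        using k(2) \<delta>(1) by (simp add: distrib_left)
      then have "real l * real k \<le> real l * (\<delta> * real (card A + 1))"
        by (intro mult_left_mono) auto
      then show ?thesis
        by (simp add: field_simps)
    qed

    show "measure ?Q {w \<in> space ?Q. few \<rho> k A w} \<le> \<epsilon>"
      using L[OF A, of k] ratio[of L] \<delta>(3) by linarith
    let ?f = "\<lambda>y. \<bar>\<psi> y - g y\<bar>"
    have f_bound: "0 \<le> ?f y \<and> ?f y \<le> s + B" if "y \<in> cball 0 1" for y
      using \<psi>_bounds[of y] g(1)[OF that] by auto
    have fz: "0 \<le> ?f (z (w i))" "?f (z (w i)) \<le> s + B" if "w \<in> space ?Q" "i \<in> insert 0 A" for w i
      using f_bound[of "z (w i)"] norm_z_le[OF sample_component_space[OF that]] by auto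
    have vz: "\<bar>v (w i) - \<psi> (z (w i))\<bar> \<le> s" if "w \<in> space ?Q" "i \<in> insert 0 A" for w i
      using residual_bound[OF sample_component_space[OF that]] .
    let ?T1 = "\<lambda>w. \<bar>\<Sum>i\<in>sel k A w. v (w i) - \<psi> (z (w i))\<bar>"
    let ?T2 = "\<lambda>w. (\<Sum>i\<in>sel k A w. ?f (z (w i)))"
    let ?T3 = "\<lambda>w. of_bool (few \<rho>' k A w) :: real"
    let ?T4 = "\<lambda>w. ?f (z (w 0))"
    have int: "integrable ?Q (\<lambda>w. \<Sum>i\<in>sel k A w. h (w i))"
      if h: "h \<in> borel_measurable D" "\<And>w i. w \<in> space ?Q \<Longrightarrow> i \<in> A \<Longrightarrow> \<bar>h (w i)\<bar> \<le> C" "0 \<le> C"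
      for h :: "'b \<Rightarrow> real" and C
      unfolding sum_sel[OF A(1)]
    proof (rule Bochner_Integration.integrable_sum)
      fix i assume i: "i \<in> A"
      note [measurable] = h(1) comp[of i]
      show "integrable ?Q (\<lambda>w. of_bool (i \<in> sel k A w) * h (w i))"
        using h(2) i h(3)
        by (intro Q.integrable_const_bound[where B=C] AE_I2) (auto simp: of_bool_def)
    qed
    have "integrable ?Q (\<lambda>w. \<Sum>i\<in>sel k A w. v (w i) - \<psi> (z (w i)))"
      by (rule int[of "\<lambda>x. v x - \<psi> (z x)" s]) (use vz s_nonneg in auto)
    then have i1: "integrable ?Q ?T1"
      by (rule integrable_abs)
    have i2: "integrable ?Q ?T2"
      by (rule int[of "\<lambda>x. ?f (z x)" "s + B"]) (use fz s_nonneg g(2) in auto)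
    have i3: "integrable ?Q ?T3"
      by (intro Q.integrable_const_bound[where B=1]) auto
    have i4: "integrable ?Q ?T4"
      using fz by (intro Q.integrable_const_bound[where B="s + B"]) auto
    have "(\<integral>w. \<bar>knn_mean k A w - \<psi> (z (w 0))\<bar> \<partial>?Q) \<le>
        (\<integral>w. ?T1 w / k + ?T2 w / k + (\<epsilon>' + 2 * B * ?T3 w) + ?T4 w \<partial>?Q)"
    proof (rule integral_mono')
      show "integrable ?Q (\<lambda>w. ?T1 w / k + ?T2 w / k + (\<epsilon>' + 2 * B * ?T3 w) + ?T4 w)"
        using i1 i2 i3 i4 by simp
      show "\<bar>knn_mean k A w - \<psi> (z (w 0))\<bar> \<le> ?T1 w / k + ?T2 w / k + (\<epsilon>' + 2 * B * ?T3 w) + ?T4 w"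
        if "w \<in> space ?Q" for w
        using A(1) kA k0 g(1,2) less_imp_le[OF \<epsilon>'(1)] g(4) that by (rule knn_mean_error_le)
      show "0 \<le> ?T1 w / k + ?T2 w / k + (\<epsilon>' + 2 * B * ?T3 w) + ?T4 w" for w
        using g(2) \<epsilon>'(1) by (intro add_nonneg_nonneg divide_nonneg_nonneg sum_nonneg mult_nonneg_nonneg) auto
    qed
    also have "\<dots> = (\<integral>w. ?T1 w \<partial>?Q) / k + (\<integral>w. ?T2 w \<partial>?Q) / k + (\<epsilon>' + 2 * B * (\<integral>w. ?T3 w \<partial>?Q)) + (\<integral>w. ?T4 w \<partial>?Q)"
      using i1 i2 i3 i4 by (simp add: Q.prob_space)
    also have "\<dots> \<le> \<epsilon> / 4 + real \<gamma> * \<epsilon>' + (\<epsilon> / 4 + \<epsilon> / 4) + \<epsilon>'"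
    proof (intro add_mono)
      have "4 * s / \<epsilon> \<le> sqrt (real k)"
      proof (rule real_le_rsqrt)
        have "(4 * s / \<epsilon>)\<^sup>2 \<le> real K"
          unfolding K_def by linarith
        also have "\<dots> \<le> real k"
          using k(1) by simp
        finally show "(4 * s / \<epsilon>)\<^sup>2 \<le> real k" .
      qed
      then have "s \<le> \<epsilon> / 4 * sqrt k"
        using assms(1) by (simp add: field_simps)
      then have "s * sqrt k \<le> \<epsilon> / 4 * sqrt k * sqrt k"
        by (intro mult_right_mono) auto
      then have "(\<integral>w. ?T1 w \<partial>?Q) \<le> \<epsilon> / 4 * k"
        using residual_sum_le[OF A, of k] by (simp add: mult.assoc)
      then show "(\<integral>w. ?T1 w \<partial>?Q) / k \<le> \<epsilon> / 4"
        using k0 by (simp add: field_simps)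
      have "(\<integral>w. ?T2 w \<partial>?Q) \<le> real (\<gamma> * k) * (\<integral>x. ?f (z x) \<partial>D)"
        using f_bound by (intro \<gamma>[OF A, of _ "s + B"]) auto
      also have "\<dots> \<le> real (\<gamma> * k) * \<epsilon>'"
        using g_int by (intro mult_left_mono) auto
      finally show "(\<integral>w. ?T2 w \<partial>?Q) / k \<le> real \<gamma> * \<epsilon>'"
        using k0 by (simp add: field_simps)
      show "\<epsilon>' \<le> \<epsilon> / 4"
        by (rule \<epsilon>'(3))
      have "(\<integral>w. ?T3 w \<partial>?Q) \<le> real L' * \<delta>"
        unfolding integral_of_bool using L'[OF A, of k] ratio[of L'] by linarith
      then have "2 * B * (\<integral>w. ?T3 w \<partial>?Q) \<le> 2 * B * (real L' * \<delta>)"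
        using g(2) by (intro mult_left_mono) auto
      then show "2 * B * (\<integral>w. ?T3 w \<partial>?Q) \<le> \<epsilon> / 4"
        using \<delta>(4) by linarith
      show "(\<integral>w. ?T4 w \<partial>?Q) \<le> \<epsilon>'"
        using g_int integral_component[of 0 "insert 0 A" "\<lambda>x. ?f (z x)"] by simp
    qed
    also have "\<dots> = \<epsilon>"
      using \<epsilon>'(2) by (simp add: distrib_right)
    finally show "(\<integral>w. \<bar>knn_mean k A w - \<psi> (z (w 0))\<bar> \<partial>?Q) \<le> \<epsilon>" .
  qed
qed

end

subsection \<open>Independence in the recommendation model\<close>

text \<open>Reads the independence of the family indexed by \<open>source\<close> as independence of
  users numbered by naturals: intersections and products over a finite index set carry over along an
  injection.\<close>

lemma (in prob_space) indep_sets_reindex: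
  assumes "indep_sets F I" "inj_on f J" "f ` J \<subseteq> I"
  shows "indep_sets (\<lambda>j. F (f j)) J"
  unfolding indep_sets_def
proof (intro conjI ballI allI impI)
  show "F (f j) \<subseteq> events" if "j \<in> J" for j
    using assms that by (auto simp: indep_sets_def)
  fix K A assume K: "K \<subseteq> J" "K \<noteq> {}" "finite K" and A: "A \<in> Pi K (\<lambda>j. F (f j))"
  have inj: "inj_on f K"
    using assms(2) K(1) by (rule inj_on_subset)
  define A' where "A' i = A (the_inv_into K f i)" for i
  have A': "A' (f j) = A j" if "j \<in> K" for j
    using the_inv_into_f_f[OF inj that] by (simp add: A'_def)
  have "prob (\<Inter>i\<in>f ` K. A' i) = (\<Prod>i\<in>f ` K. prob (A' i))"
    using K A A' assms(3) by (intro indep_setsD[OF assms(1)] subset_trans[OF image_mono assms(3)]) auto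
  moreover have "(\<Inter>i\<in>f ` K. A' i) = (\<Inter>j\<in>K. A j)"
    using A' by simp
  moreover have "(\<Prod>i\<in>f ` K. prob (A' i)) = (\<Prod>j\<in>K. prob (A j))"
    using A' by (simp add: prod.reindex[OF inj])
  ultimately show "prob (\<Inter>j\<in>K. A j) = (\<Prod>j\<in>K. prob (A j))"
    by simp
qed

text \<open>The indicator of B generates only the empty set, B, its complement and the whole space.
  The product rule for B extends to these four events, so the indicator is independent of f and the
  expectation factors.\<close>

lemma (in prob_space) expectation_indep_event:
  fixes f :: "'a \<Rightarrow> real"
  assumes B: "B \<in> events" and f: "integrable M f"
    and indep: "\<And>S. S \<in> sets borel \<Longrightarrow> prob (B \<inter> (f -` S \<inter> space M)) = prob B * prob (f -` S \<inter> space M)"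
  shows "expectation (\<lambda>x. indicator B x * f x) = prob B * expectation f"
    "integrable M (\<lambda>x. indicator B x * f x)"
proof -
  let ?A = "{indicator B -` S \<inter> space M | S. S \<in> sets (borel :: real measure)}"
  let ?F = "{f -` S \<inter> space M | S. S \<in> sets borel}"
  have [measurable]: "random_variable borel f"
    using f by simp
  have stable: "Int_stable {g -` S \<inter> space M | S. S \<in> sets borel}" for g :: "'a \<Rightarrow> real"
  proof (rule Int_stableI)
    fix a b assume "a \<in> {g -` S \<inter> space M | S. S \<in> sets borel}" "b \<in> {g -` S \<inter> space M | S. S \<in> sets borel}"
    then obtain S T where "a = g -` S \<inter> space M" "b = g -` T \<inter> space M" "S \<in> sets borel" "T \<in> sets borel"
      by auto
    then have "a \<inter> b = g -` (S \<inter> T) \<inter> space M" "S \<inter> T \<in> sets borel"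
      by auto
    then show "a \<inter> b \<in> {g -` S \<inter> space M | S. S \<in> sets borel}"
      by blast
  qed
  have "prob (a \<inter> b) = prob a * prob b" if "a \<in> ?A" "b \<in> ?F" for a b
  proof -
    obtain S :: "real set" where S: "a = indicator B -` S \<inter> space M"
      using \<open>a \<in> ?A\<close> by auto
    obtain T where T: "b = f -` T \<inter> space M" "T \<in> sets borel"
      using \<open>b \<in> ?F\<close> by auto
    then have b: "b \<in> events" "b \<subseteq> space M"
      by auto
    have Bb: "prob (B \<inter> b) = prob B * prob b"
      using T indep by simp
    have "prob ((space M - B) \<inter> b) = prob (b - B \<inter> b)"
      using b by (intro arg_cong[where f=prob]) auto
    also have "\<dots> = prob b - prob (B \<inter> b)"
      using B b by (intro finite_measure_Diff) auto
    also have "\<dots> = prob (space M - B) * prob b"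
      using B by (simp add: Bb prob_compl left_diff_distrib)
    finally have Cb: "prob ((space M - B) \<inter> b) = prob (space M - B) * prob b" .
    have "B \<subseteq> space M"
      using B by (rule sets.sets_into_space)
    then have "a = {} \<or> a = B \<or> a = space M - B \<or> a = space M"
      unfolding S by (cases "(1::real) \<in> S"; cases "(0::real) \<in> S") (auto simp: indicator_def of_bool_def split: if_splits)
    then show ?thesis
      using Bb Cb b prob_space by (auto simp: Int_absorb1)
  qed
  moreover have "?A \<subseteq> events" "?F \<subseteq> events"
    using B by auto
  ultimately have "indep_set ?A ?F"
    unfolding indep_sets2_eq by blast
  then have "indep_set (sigma_sets (space M) ?A) (sigma_sets (space M) ?F)"
    by (intro indep_set_sigma_sets stable)
  then have "indep_var borel (indicator B) borel f"
    unfolding indep_var_eq using B by simp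
  then show "expectation (\<lambda>x. indicator B x * f x) = prob B * expectation f"
    "integrable M (\<lambda>x. indicator B x * f x)"
    using indep_var_lebesgue_integral[of "indicator B" f] indep_var_integrable[of "indicator B" f] B f
    by (auto simp: emeasure_eq_measure)
qed

context recommendation_model
begin

text \<open>The new user takes slot 0, which is free because database users start at 1. It thereby
  becomes the point of prediction of a sample in \<open>iid_regression\<close>.\<close>

definition user :: "nat \<Rightarrow> 'w \<Rightarrow> (real^'d) \<times> real" where
  "user i \<omega> = (if i = 0 then (X \<omega>, Y \<omega>) else (Xs i \<omega>, Ys i \<omega>))"

definition user_distr :: "((real^'d) \<times> real) measure" where
  "user_distr = distr P (borel \<Otimes>\<^sub>M borel) (user 0)"

abbreviation user_source :: "nat \<Rightarrow> source" where
  "user_source i \<equiv> (if i = 0 then New_User else Db_User i)"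

abbreviation src :: "source \<Rightarrow> 'w set set" where
  "src \<equiv> source_sigma P X Y M Xs Ys Ms"

definition mask_events :: "'w set set" where
  "mask_events = sigma_sets (space P) (\<Union>v\<in>{New_Mask} \<union> Db_Masks ` {1..}. src v)"

definition user_events :: "'w set set" where
  "user_events = sigma_sets (space P) (\<Union>v\<in>range user_source. src v)"

lemma measurable_user [measurable]: "user i \<in> measurable P (borel \<Otimes>\<^sub>M borel)"
  using new_user_measurable db_user_measurable[of i] by (cases "i = 0") (auto simp: user_def[abs_def])

lemma src_user: "src (user_source i) = sets (vimage_algebra (space P) (user i) (borel \<Otimes>\<^sub>M borel))"
  by (auto simp: user_def[abs_def])

lemma sets_user_distr [measurable_cong]: "sets user_distr = sets (borel \<Otimes>\<^sub>M borel)"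
  by (simp add: user_distr_def)

lemma space_user_distr [simp]: "space user_distr = UNIV"
  by (simp add: user_distr_def space_pair_measure)

lemma prob_space_user_distr: "prob_space user_distr"
  unfolding user_distr_def by (rule prob_space_distr) measurable

lemma distr_user: "distr P (borel \<Otimes>\<^sub>M borel) (user i) = user_distr"
  using db_user_distr[of i] by (cases "i = 0") (auto simp: user_distr_def user_def[abs_def])

lemma src_events: "v \<in> sources \<Longrightarrow> src v \<subseteq> events"
  using sources_indep by (auto simp: indep_sets_def)

lemma Int_stable_src: "Int_stable (src v)"
  by (cases v) (auto intro: sets.Int_stable)

lemma user_source_in: "user_source i \<in> sources"
  by (auto simp: sources_def)

lemma indep_users: "indep_vars (\<lambda>_. borel \<Otimes>\<^sub>M borel) user UNIV"
  unfolding indep_vars_def2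
proof (intro conjI ballI)
  have "indep_sets (\<lambda>i. src (user_source i)) UNIV"
    by (rule indep_sets_reindex[OF sources_indep])
      (auto intro!: inj_onI simp: sources_def split: if_splits)
  then show "indep_sets (\<lambda>i. {user i -` A \<inter> space P |A. A \<in> sets (borel \<Otimes>\<^sub>M borel)}) UNIV"
    unfolding src_user by (subst (asm) sets_vimage_algebra2) (auto simp: space_pair_measure)
qed measurable

lemma measurable_users [measurable]:
  "(\<lambda>\<omega>. \<lambda>i\<in>I. user i \<omega>) \<in> measurable P (Pi\<^sub>M I (\<lambda>_. user_distr))"
  by (rule measurable_restrict) measurable

text \<open>Independence together with the common law makes the joint law a product, so the sample
  integrals of \<open>iid_regression\<close> are expectations in the model.\<close>

lemma distr_users:
  assumes "I \<noteq> {}"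
  shows "distr P (Pi\<^sub>M I (\<lambda>_. user_distr)) (\<lambda>\<omega>. \<lambda>i\<in>I. user i \<omega>) = Pi\<^sub>M I (\<lambda>_. user_distr)"
proof -
  have "indep_vars (\<lambda>_. borel \<Otimes>\<^sub>M borel) user I"
    using indep_users by (rule indep_vars_subset) auto
  then have "distr P (Pi\<^sub>M I (\<lambda>_. borel \<Otimes>\<^sub>M borel)) (\<lambda>\<omega>. \<lambda>i\<in>I. user i \<omega>) = Pi\<^sub>M I (\<lambda>_. user_distr)"
    using assms by (subst (asm) indep_vars_iff_distr_eq_PiM) (auto simp: distr_user)
  moreover have "sets (Pi\<^sub>M I (\<lambda>_. user_distr)) = sets (Pi\<^sub>M I (\<lambda>_. borel \<Otimes>\<^sub>M borel))"
    by (intro sets_PiM_cong) (auto simp: sets_user_distr)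
  ultimately show ?thesis
    by (metis distr_cong)
qed

text \<open>Disjoint blocks of an independent family of intersection-stable systems generate
  independent sigma-algebras.\<close>

lemma indep_masks_users: "indep_set mask_events user_events"
proof -
  let ?I = "case_bool ({New_Mask} \<union> Db_Masks ` {1..}) (range user_source)"
  have "range user_source = {New_User} \<union> Db_User ` {1..}"
    by (auto simp: image_iff Bex_def)
  then have "(\<Union>b. ?I b) = sources"
    by (auto simp: sources_def UNIV_bool)
  then have "indep_sets (\<lambda>b. sigma_sets (space P) (\<Union>v\<in>?I b. src v)) UNIV"
    using sources_indep Int_stable_src
    by (intro indep_sets_collect_sigma) (auto simp: disjoint_family_on_def UNIV_bool split: if_splits)
  moreover have "(\<lambda>b. sigma_sets (space P) (\<Union>v\<in>?I b. src v)) = case_bool mask_events user_events"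
    by (auto simp: fun_eq_iff mask_events_def user_events_def split: bool.split)
  ultimately show ?thesis
    by (simp add: indep_set_def)
qed

lemma users_in_events:
  assumes "S \<in> sets (Pi\<^sub>M I (\<lambda>_. user_distr))"
  shows "(\<lambda>\<omega>. \<lambda>i\<in>I. user i \<omega>) -` S \<inter> space P \<in> user_events"
proof -
  let ?N = "sigma (space P) (\<Union>v\<in>range user_source. src v)"
  have sub: "(\<Union>v\<in>range user_source. src v) \<subseteq> Pow (space P)"
    using src_events[OF user_source_in] sets.space_closed by blast
  have N: "space ?N = space P" "sets ?N = sigma_sets (space P) (\<Union>v\<in>range user_source. src v)"
    by (rule space_measure_of[OF sub], rule sets_measure_of[OF sub])
  have "user i \<in> measurable ?N (borel \<Otimes>\<^sub>M borel)" for i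
  proof (rule measurableI)
    fix A :: "((real^'d) \<times> real) set" assume "A \<in> sets (borel \<Otimes>\<^sub>M borel)"
    then have "user i -` A \<inter> space P \<in> src (user_source i)"
      unfolding src_user by (rule in_vimage_algebra)
    then show "user i -` A \<inter> space ?N \<in> sets ?N"
      unfolding N by (intro sigma_sets.Basic UN_I[of "user_source i"] rangeI)
  qed (simp add: space_pair_measure)
  then have "(\<lambda>\<omega>. \<lambda>i\<in>I. user i \<omega>) \<in> measurable ?N (Pi\<^sub>M I (\<lambda>_. user_distr))"
    by (intro measurable_restrict) (simp add: measurable_cong_sets[OF refl sets_user_distr])
  from measurable_sets[OF this assms] show ?thesis
    unfolding N user_events_def .
qed

lemma New_Mask_event: "{\<omega> \<in> space P. M \<omega> = m} \<in> mask_events"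
proof -
  have "M -` {m} \<inter> space P \<in> src New_Mask"
    by (auto intro: in_vimage_algebra)
  then have "M -` {m} \<inter> space P \<in> mask_events"
    unfolding mask_events_def by (intro sigma_sets.Basic) auto
  moreover have "M -` {m} \<inter> space P = {\<omega> \<in> space P. M \<omega> = m}"
    by auto
  ultimately show ?thesis
    by simp
qed

lemma Db_Mask_event:
  assumes "i \<ge> 1" "n \<ge> 1"
  shows "{\<omega> \<in> space P. Q (Ms i n \<omega>)} \<in> mask_events"
proof -
  let ?S = "(\<lambda>a. a n) -` {A. Q A} \<inter> space (mask_seq_space :: (nat \<Rightarrow> 'd set) measure)"
  have "(\<lambda>a. a n) \<in> measurable mask_seq_space (count_space UNIV)"
    using assms(2) by (intro measurable_component_singleton) auto
  then have "?S \<in> sets mask_seq_space"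
    by (rule measurable_sets) simp
  then have "mask_seq (Ms i) -` ?S \<inter> space P \<in> src (Db_Masks i)"
    unfolding source_sigma.simps by (rule in_vimage_algebra)
  then have "mask_seq (Ms i) -` ?S \<inter> space P \<in> mask_events"
    unfolding mask_events_def using assms(1) by (intro sigma_sets.Basic) auto
  moreover have "mask_seq (Ms i) -` ?S \<inter> space P = {\<omega> \<in> space P. Q (Ms i n \<omega>)}"
    using assms(2) by (auto simp: mask_seq_def space_PiM)
  ultimately show ?thesis
    by simp
qed

lemma R_event: "n \<ge> 1 \<Longrightarrow> {\<omega> \<in> space P. R n \<omega> = r} \<in> sets (vimage_algebra (space P) (R n) (count_space (Pow {1..n} - {{}})))"
proof (cases "r \<in> Pow {1..n} - {{}}")
  case True
  have "R n -` {r} \<inter> space P \<in> sets (vimage_algebra (space P) (R n) (count_space (Pow {1..n} - {{}})))"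
    using True by (intro in_vimage_algebra) auto
  moreover have "R n -` {r} \<inter> space P = {\<omega> \<in> space P. R n \<omega> = r}"
    by auto
  ultimately show ?thesis
    by simp
next
  case False
  assume "n \<ge> 1"
  then have "R n \<omega> \<noteq> r" if "\<omega> \<in> space P" for \<omega>
    using False measurable_space[OF R_measurable, of n \<omega>] that by auto
  then have "{\<omega> \<in> space P. R n \<omega> = r} = {}"
    by auto
  then show ?thesis
    by (simp only: sets.empty_sets)
qed

text \<open>For \<open>m = M \<omega>\<close> these are the available users whose
  \<open>common_mask\<close> is all of m, the set A of the overview. With r and m as parameters, its
  value is determined by the masks alone.\<close>

definition good_users :: "nat \<Rightarrow> nat set \<Rightarrow> 'd set \<Rightarrow> 'w \<Rightarrow> nat set" where
  "good_users n r m \<omega> = {i \<in> r. m \<subseteq> Ms i (n + 1 - i) \<omega>}"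

lemma algebra_mask_events: "sigma_algebra (space P) mask_events"
  unfolding mask_events_def
proof (rule sigma_algebra_sigma_sets)
  have "src v \<subseteq> events" if "v \<in> {New_Mask} \<union> Db_Masks ` {1..}" for v
    using that by (intro src_events) (auto simp: sources_def)
  then show "(\<Union>v\<in>{New_Mask} \<union> Db_Masks ` {1..}. src v) \<subseteq> Pow (space P)"
    using sets.space_closed by blast
qed

lemma good_users_event:
  assumes "r \<subseteq> {1..n}"
  shows "{\<omega> \<in> space P. M \<omega> = m \<and> good_users n r m \<omega> = a} \<in> mask_events"
proof -
  interpret sigma_algebra "space P" mask_events
    by (rule algebra_mask_events)
  have eq: "{\<omega> \<in> space P. M \<omega> = m \<and> good_users n r m \<omega> = a} =
      {\<omega> \<in> space P. M \<omega> = m} \<inter> {\<omega> \<in> space P. \<forall>i\<in>r. m \<subseteq> Ms i (n + 1 - i) \<omega> \<longleftrightarrow> i \<in> a} \<inter> {\<omega> \<in> space P. a \<subseteq> r}"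
    by (auto simp: good_users_def)
  have "finite r"
    using assms finite_subset by blast
  then have "{\<omega> \<in> space P. \<forall>i\<in>r. m \<subseteq> Ms i (n + 1 - i) \<omega> \<longleftrightarrow> i \<in> a} \<in> mask_events"
    using assms by (intro sets_Collect_finite_All Db_Mask_event) (auto simp: subset_eq)
  then show ?thesis
    unfolding eq by (intro Int New_Mask_event sets_Collect_const)
qed

text \<open>For an event C of the users, B1 splits off from \<open>B2 \<inter> C\<close> because the
  available users are independent of all sources, and then B2 splits off from C by
  \<open>indep_masks_users\<close>. Availability and masks can thus be frozen while the users keep
  their product law.\<close>

lemma users_indep_R_masks:
  fixes f :: "(nat \<Rightarrow> (real^'d) \<times> real) \<Rightarrow> real"
  assumes "n \<ge> 1" and B1: "B1 \<in> sets (vimage_algebra (space P) (R n) (count_space (Pow {1..n} - {{}})))"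
    and B2: "B2 \<in> mask_events" and I: "I \<noteq> {}" and f: "integrable (Pi\<^sub>M I (\<lambda>_. user_distr)) f"
  shows "(\<integral>\<omega>. indicator (B1 \<inter> B2) \<omega> * f (\<lambda>i\<in>I. user i \<omega>) \<partial>P) = prob (B1 \<inter> B2) * (\<integral>w. f w \<partial>Pi\<^sub>M I (\<lambda>_. user_distr))"
    "integrable P (\<lambda>\<omega>. indicator (B1 \<inter> B2) \<omega> * f (\<lambda>i\<in>I. user i \<omega>))"
    "prob (B1 \<inter> B2) = prob B1 * prob B2"
proof -
  let ?S = "sigma_sets (space P) (\<Union>v\<in>sources. src v)"
  let ?R = "sets (vimage_algebra (space P) (R n) (count_space (Pow {1..n} - {{}})))"
  have subS: "(\<Union>v\<in>sources. src v) \<subseteq> Pow (space P)"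
    using src_events sets.space_closed by blast
  interpret S: sigma_algebra "space P" ?S
    by (rule sigma_algebra_sigma_sets[OF subS])
  have ind: "indep_set ?R ?S"
    using R_indep[OF assms(1)] .
  have mask_sub: "mask_events \<subseteq> ?S"
    unfolding mask_events_def by (intro sigma_sets_mono') (auto simp: sources_def)
  have user_sub: "user_events \<subseteq> ?S"
    unfolding user_events_def using user_source_in by (intro sigma_sets_mono') blast
  have ev: "B1 \<in> events" "B2 \<in> events"
    using indep_set_def indep_setD_ev1[OF ind] indep_setD_ev2[OF ind] B1 B2 mask_sub by auto
  show prod: "prob (B1 \<inter> B2) = prob B1 * prob B2"
    using indep_setD[OF ind B1] B2 mask_sub by blast
  let ?f = "\<lambda>\<omega>. f (\<lambda>i\<in>I. user i \<omega>)"
  have f_int: "integrable P ?f"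
  proof -
    have "integrable (distr P (Pi\<^sub>M I (\<lambda>_. user_distr)) (\<lambda>\<omega>. \<lambda>i\<in>I. user i \<omega>)) f"
      using f distr_users[OF I] by simp
    then show ?thesis
      by (rule integrable_distr[OF measurable_users])
  qed
  have "(\<integral>w. f w \<partial>Pi\<^sub>M I (\<lambda>_. user_distr)) = (\<integral>w. f w \<partial>distr P (Pi\<^sub>M I (\<lambda>_. user_distr)) (\<lambda>\<omega>. \<lambda>i\<in>I. user i \<omega>))"
    using distr_users[OF I] by simp
  also have "\<dots> = expectation ?f"
    using f by (intro integral_distr measurable_users) auto
  finally have f_eq: "(\<integral>w. f w \<partial>Pi\<^sub>M I (\<lambda>_. user_distr)) = expectation ?f" .
  have *: "prob ((B1 \<inter> B2) \<inter> (?f -` T \<inter> space P)) = prob (B1 \<inter> B2) * prob (?f -` T \<inter> space P)"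
    if T: "T \<in> sets borel" for T
  proof -
    let ?C = "?f -` T \<inter> space P"
    have "f \<in> borel_measurable (Pi\<^sub>M I (\<lambda>_. user_distr))"
      using f by simp
    then have "f -` T \<inter> space (Pi\<^sub>M I (\<lambda>_. user_distr)) \<in> sets (Pi\<^sub>M I (\<lambda>_. user_distr))"
      using T by (rule measurable_sets)
    from users_in_events[OF this]
    have "(\<lambda>\<omega>. \<lambda>i\<in>I. user i \<omega>) -` (f -` T \<inter> space (Pi\<^sub>M I (\<lambda>_. user_distr))) \<inter> space P \<in> user_events" .
    also have "(\<lambda>\<omega>. \<lambda>i\<in>I. user i \<omega>) -` (f -` T \<inter> space (Pi\<^sub>M I (\<lambda>_. user_distr))) \<inter> space P = ?C"
      by (auto simp: space_PiM)
    finally have C: "?C \<in> user_events" .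
    have "prob (B1 \<inter> (B2 \<inter> ?C)) = prob B1 * prob (B2 \<inter> ?C)"
      by (intro indep_setD[OF ind B1] S.Int subsetD[OF mask_sub B2] subsetD[OF user_sub C])
    also have "prob (B2 \<inter> ?C) = prob B2 * prob ?C"
      using indep_setD[OF indep_masks_users B2 C] .
    finally show ?thesis
      by (simp only: prod Int_assoc mult.assoc)
  qed
  have B: "B1 \<inter> B2 \<in> events"
    using ev by auto
  show "(\<integral>\<omega>. indicator (B1 \<inter> B2) \<omega> * ?f \<omega> \<partial>P) = prob (B1 \<inter> B2) * (\<integral>w. f w \<partial>Pi\<^sub>M I (\<lambda>_. user_distr))"
    unfolding f_eq by (rule expectation_indep_event(1)[OF B f_int *])
  show "integrable P (\<lambda>\<omega>. indicator (B1 \<inter> B2) \<omega> * ?f \<omega>)"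
    by (rule expectation_indep_event(2)[OF B f_int *])
qed

end

subsection \<open>Regression on the revealed direction\<close>

text \<open>The zero vector gets direction 0, since inversion sends 0 to 0. So the norm is at most 1
  for every argument, valid or not.\<close>

definition direction :: "'d set \<Rightarrow> (real^'d::finite) \<times> real \<Rightarrow> real^'d" where
  "direction m p = masked m (fst p) /\<^sub>R norm (masked m (fst p))"

text \<open>The truncation is inactive for valid ratings; it makes the bounds hold everywhere instead of
  almost everywhere.\<close>

definition rating_ratio :: "real \<Rightarrow> 'd set \<Rightarrow> (real^'d::finite) \<times> real \<Rightarrow> real" where
  "rating_ratio s m p = max 0 (min s (snd p / norm (masked m (fst p))))"

definition valid_user :: "real \<Rightarrow> (real^'d::finite) \<times> real \<Rightarrow> bool" where
  "valid_user s p \<longleftrightarrow> (\<forall>j. fst p $ j \<in> {1..s}) \<and> snd p \<in> {1..s}"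

lemma masked_nth [simp]: "masked m x $ j = (if j \<in> m then x $ j else 0)"
  by (simp add: masked_def)

lemma measurable_masked [measurable]:
  fixes m :: "'d::finite set"
  shows "masked m \<in> borel_measurable borel"
proof (rule borel_measurable_continuous_onI)
  have "continuous_on UNIV (\<lambda>x::real^'d. if j \<in> m then x $ j else 0)" for j
    by (cases "j \<in> m") (auto intro!: continuous_intros)
  then have "continuous_on UNIV (\<lambda>x::real^'d. \<chi> j. if j \<in> m then x $ j else 0)"
    by (rule continuous_on_vec_lambda)
  then show "continuous_on UNIV (masked m :: real^'d \<Rightarrow> _)"
    by (simp add: masked_def[abs_def])
qed

lemma measurable_direction [measurable]: "direction m \<in> borel_measurable (borel \<Otimes>\<^sub>M borel)"
  unfolding direction_def by measurable

lemma measurable_rating_ratio [measurable]: "rating_ratio s m \<in> borel_measurable (borel \<Otimes>\<^sub>M borel)"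
  unfolding rating_ratio_def by measurable

lemma norm_direction_le: "norm (direction m p) \<le> 1"
  by (cases "masked m (fst p) = 0") (auto simp: direction_def)

lemma rating_ratio_bounds: "0 \<le> s \<Longrightarrow> 0 \<le> rating_ratio s m p \<and> rating_ratio s m p \<le> s"
  by (auto simp: rating_ratio_def)

lemma one_le_norm_masked:
  assumes "\<forall>j. x $ j \<in> {1..s}" "m \<noteq> {}"
  shows "1 \<le> norm (masked m x)"
proof -
  obtain j where "j \<in> m"
    using assms by auto
  then have "1 \<le> \<bar>masked m x $ j\<bar>"
    using assms(1) by (auto intro: order_trans[OF _ abs_ge_self])
  also have "\<dots> \<le> norm (masked m x)"
    by (rule component_le_norm_cart)
  finally show ?thesis .
qed

lemma norm_masked_le:
  fixes x :: "real^'d::finite"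
  assumes "\<forall>j. x $ j \<in> {1..s}"
  shows "norm (masked m x) \<le> s * CARD('d)"
proof -
  have *: "1 \<le> x $ j \<and> x $ j \<le> s" for j
    using assms by auto
  then have "0 \<le> s"
    by (meson order_trans zero_le_one)
  have abs: "\<bar>masked m x $ j\<bar> \<le> s" for j
    using *[of j] \<open>0 \<le> s\<close> by auto
  have "norm (masked m x) \<le> (\<Sum>j\<in>UNIV. \<bar>masked m x $ j\<bar>)"
    by (rule norm_le_l1_cart)
  also have "\<dots> \<le> (\<Sum>j\<in>(UNIV::'d set). s)"
    by (intro sum_mono abs)
  finally show ?thesis
    by (simp add: mult.commute)
qed

lemma norm_direction:
  assumes "valid_user s p" "m \<noteq> {}"
  shows "norm (direction m p) = 1"
proof -
  have "1 \<le> norm (masked m (fst p))"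
    using one_le_norm_masked[of "fst p" s m] assms by (auto simp: valid_user_def)
  then have "norm (masked m (fst p)) \<noteq> 0"
    by linarith
  then show ?thesis
    by (simp add: direction_def)
qed

lemma rating_ratio_eq:
  assumes "valid_user s p" "m \<noteq> {}"
  shows "rating_ratio s m p = snd p / norm (masked m (fst p))"
proof -
  have p: "1 \<le> norm (masked m (fst p))" "1 \<le> snd p" "snd p \<le> s"
    using one_le_norm_masked[of "fst p" s m] assms by (auto simp: valid_user_def)
  then have "snd p / norm (masked m (fst p)) \<le> snd p / 1"
    by (intro divide_left_mono) auto
  then show ?thesis
    using p by (auto simp: rating_ratio_def)
qed

text \<open>Valid ratings are at least 1, hence a direction reveals the mask from which it was
  formed. This is what lets the regression on the direction be localised to a single mask.\<close>

lemma direction_support: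
  assumes "valid_user s p" "m \<noteq> {}"
  shows "{j. direction m p $ j \<noteq> 0} = m"
proof -
  have "1 \<le> fst p $ j" for j
    using assms(1) by (auto simp: valid_user_def)
  then have "fst p $ j \<noteq> 0" for j
    by (metis not_one_le_zero)
  then show ?thesis
    using one_le_norm_masked[of "fst p" s m] assms by (auto simp: direction_def valid_user_def)
qed

text \<open>Cauchy-Schwarz on the common coordinates; the quotient is 0 if the denominator
  vanishes.\<close>

lemma Sbar_le_1: "Sbar x y \<le> 1"
proof -
  define J where "J = {j. x $ j \<noteq> 0 \<and> y $ j \<noteq> 0}"
  have "(\<Sum>j\<in>J. x $ j * y $ j) \<le> (\<Sum>j\<in>J. \<bar>x $ j\<bar> * \<bar>y $ j\<bar>)"
    by (intro sum_mono) (simp flip: abs_mult)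
  also have "\<dots> \<le> L2_set (\<lambda>j. x $ j) J * L2_set (\<lambda>j. y $ j) J"
    by (rule L2_set_mult_ineq)
  finally have "(\<Sum>j\<in>J. x $ j * y $ j) \<le> sqrt (\<Sum>j\<in>J. (x $ j)\<^sup>2) * sqrt (\<Sum>j\<in>J. (y $ j)\<^sup>2)"
    by (simp add: L2_set_def)
  moreover have "0 \<le> sqrt (\<Sum>j\<in>J. (x $ j)\<^sup>2) * sqrt (\<Sum>j\<in>J. (y $ j)\<^sup>2)"
    by (simp add: sum_nonneg)
  moreover have "a / d \<le> 1" if "a \<le> d" "0 \<le> d" for a d :: real
    using that by (cases "d = 0") auto
  ultimately have "(\<Sum>j\<in>J. x $ j * y $ j) / (sqrt (\<Sum>j\<in>J. (x $ j)\<^sup>2) * sqrt (\<Sum>j\<in>J. (y $ j)\<^sup>2)) \<le> 1"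
    by blast
  then show ?thesis
    unfolding Sbar_def J_def Let_def by simp
qed

text \<open>Both vectors have support m, so the sums over common coordinates are full inner products
  and norms. For unit vectors the inner product is one minus half the squared distance, and ranking
  by cosine becomes ranking by distance.\<close>

lemma Sbar_masked:
  assumes p: "valid_user s p" and q: "valid_user s q" and m: "m \<noteq> {}"
  shows "Sbar (masked m (fst p)) (masked m (fst q)) = 1 - (dist (direction m p) (direction m q))\<^sup>2 / 2"
proof -
  let ?x = "masked m (fst p)" and ?y = "masked m (fst q)"
  have nz: "fst p $ j \<noteq> 0" "fst q $ j \<noteq> 0" for j
    using p q unfolding valid_user_def by (metis atLeastAtMost_iff not_one_le_zero)+
  then have J: "{j. ?x $ j \<noteq> 0 \<and> ?y $ j \<noteq> 0} = m"
    by auto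
  have sums: "(\<Sum>j\<in>m. ?x $ j * ?y $ j) = inner ?x ?y" "(\<Sum>j\<in>m. (?x $ j)\<^sup>2) = (norm ?x)\<^sup>2"
      "(\<Sum>j\<in>m. (?y $ j)\<^sup>2) = (norm ?y)\<^sup>2"
    unfolding power2_norm_eq_inner inner_vec_def
    by (rule sum.mono_neutral_cong_left, auto simp: power2_eq_square)+
  have "Sbar ?x ?y = inner ?x ?y / (norm ?x * norm ?y)"
    unfolding Sbar_def Let_def J using m by (simp only: sums if_False real_sqrt_abs abs_norm_cancel)
  also have "\<dots> = inner (direction m p) (direction m q)"
    by (simp add: direction_def divide_inverse mult.commute)
  also have "\<dots> = 1 - (dist (direction m p) (direction m q))\<^sup>2 / 2"
    using norm_direction[OF p m] norm_direction[OF q m]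
      dot_norm_neg[of "direction m p" "direction m q"] by (simp add: dist_norm field_simps)
  finally show ?thesis .
qed

context recommendation_model
begin

lemma valid_new_user: "\<omega> \<in> space P \<Longrightarrow> valid_user s (user 0 \<omega>)"
  using new_user_range[of \<omega>] by (auto simp: valid_user_def user_def)

lemma measurable_valid_user [measurable]: "Measurable.pred (borel \<Otimes>\<^sub>M borel) (valid_user s)"
proof -
  have [measurable]: "(\<lambda>p::(real^'d) \<times> real. fst p $ j) \<in> borel_measurable (borel \<Otimes>\<^sub>M borel)" for j
    by (rule measurable_compose[OF measurable_fst borel_measurable_nth])
  show ?thesis
    unfolding valid_user_def atLeastAtMost_iff by measurable
qed

text \<open>The range is prescribed for the new user only. The database users inherit it almost
  surely through the common law, and all at once since they are countably many.\<close>

lemma AE_valid_users: "AE \<omega> in P. \<forall>i. valid_user s (user i \<omega>)"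
proof -
  have "AE \<omega> in P. valid_user s (user i \<omega>)" for i
  proof -
    have "AE \<omega> in P. valid_user s (user 0 \<omega>)"
      by (intro AE_I2 valid_new_user)
    then have "AE p in distr P (borel \<Otimes>\<^sub>M borel) (user 0). valid_user s p"
      by (subst AE_distr_iff) measurable
    then have "AE p in distr P (borel \<Otimes>\<^sub>M borel) (user i). valid_user s p"
      unfolding distr_user .
    then show ?thesis
      by (subst (asm) AE_distr_iff) measurable
  qed
  then show ?thesis
    by (simp add: AE_all_countable)
qed

lemma M_nonempty: "\<omega> \<in> space P \<Longrightarrow> M \<omega> \<noteq> {}"
  using measurable_space[OF new_mask_measurable] by auto

lemma measurable_M [measurable]: "M \<in> measurable P (count_space UNIV)"
  by (rule measurable_compose[OF new_mask_measurable]) simp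

lemma revealed_eq: "M \<omega> = m \<Longrightarrow> revealed X M \<omega> = masked m (fst (user 0 \<omega>))"
  by (simp add: revealed_def user_def)

lemma measurable_X [measurable]: "X \<in> borel_measurable P"
  and measurable_Y [measurable]: "Y \<in> borel_measurable P"
  using measurable_compose[OF new_user_measurable measurable_fst]
    measurable_compose[OF new_user_measurable measurable_snd] by simp_all

lemma measurable_revealed [measurable]: "revealed X M \<in> borel_measurable P"
  unfolding revealed_def[abs_def]
  by (rule measurable_compose_countable[where g=M and f="\<lambda>m \<omega>. masked m (X \<omega>)"]) measurable

text \<open>A version of the regression function obeys the bounds of the ratio only almost surely,
  whereas \<open>iid_regression\<close> wants them at every point.\<close>

definition clip :: "(real^'d \<Rightarrow> real) \<Rightarrow> real^'d \<Rightarrow> real" where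
  "clip \<psi> y = max 0 (min s (\<psi> y))"

text \<open>The ratio lies in \<open>{0..s}\<close>, so its conditional expectation does too almost
  surely and clipping changes nothing there. For the second claim, orthogonality in the model is
  tested on the event \<open>M \<omega> = m\<close>; as M is independent of the new user, this gives
  \<open>prob {\<omega> \<in> space P. M \<omega> = m}\<close> times the wanted integral, and the
  positive factor is cancelled.\<close>

lemma
  assumes "regression_fun P (\<lambda>\<omega>. revealed X M \<omega> /\<^sub>R norm (revealed X M \<omega>))
             (\<lambda>\<omega>. Y \<omega> / norm (revealed X M \<omega>)) \<psi>"
  shows AE_clip: "AE \<omega> in P. \<psi> (revealed X M \<omega> /\<^sub>R norm (revealed X M \<omega>)) =
      clip \<psi> (revealed X M \<omega> /\<^sub>R norm (revealed X M \<omega>))"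
    and iid_regression_direction:
      "prob {\<omega> \<in> space P. M \<omega> = m} > 0 \<Longrightarrow> iid_regression user_distr (direction m) (rating_ratio s m) (clip \<psi>) s"
proof -
  define Z where "Z \<omega> = revealed X M \<omega> /\<^sub>R norm (revealed X M \<omega>)" for \<omega>
  define V where "V \<omega> = Y \<omega> / norm (revealed X M \<omega>)" for \<omega>
  define F where "F = vimage_algebra (space P) Z borel"
  have [measurable]: "\<psi> \<in> borel_measurable borel"
    and cond: "AE \<omega> in P. \<psi> (Z \<omega>) = real_cond_exp P F V \<omega>"
    using assms by (auto simp: regression_fun_def Z_def[abs_def] V_def[abs_def] F_def)
  have [measurable]: "clip \<psi> \<in> borel_measurable borel"
    unfolding clip_def by measurable
  have [measurable]: "Z \<in> borel_measurable P" "V \<in> borel_measurable P"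
    unfolding Z_def V_def by measurable
  have ZF[measurable]: "Z \<in> borel_measurable F"
    unfolding F_def by (rule measurable_vimage_algebra1) simp
  interpret sigma_finite_subalgebra P F
  proof (rule finite_measure_subalgebra_is_sigma_finite)
    have "sets F \<subseteq> events"
      unfolding F_def by (subst sets_vimage_algebra2) auto
    then show "finite_measure_subalgebra P F"
      by unfold_locales (auto simp: subalgebra_def F_def)
  qed
  have ZV: "Z \<omega> = direction (M \<omega>) (user 0 \<omega>)" "V \<omega> = rating_ratio s (M \<omega>) (user 0 \<omega>)"
    if "\<omega> \<in> space P" for \<omega>
    using rating_ratio_eq[OF valid_new_user[OF that] M_nonempty[OF that]]
    by (auto simp: Z_def V_def direction_def revealed_eq user_def)
  have V: "0 \<le> V \<omega>" "V \<omega> \<le> s" if "\<omega> \<in> space P" for \<omega>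
    using rating_ratio_bounds[of s "M \<omega>" "user 0 \<omega>"] s_gt_1 ZV(2)[OF that] by auto
  have V_int: "integrable P V"
    using V by (intro integrable_const_bound[where B=s]) auto
  have "AE \<omega> in P. 0 \<le> real_cond_exp P F V \<omega>" "AE \<omega> in P. real_cond_exp P F V \<omega> \<le> s"
    using V V_int by (auto intro!: real_cond_exp_ge_c real_cond_exp_le_c)
  then have clip: "AE \<omega> in P. \<psi> (Z \<omega>) = clip \<psi> (Z \<omega>)"
    using cond by eventually_elim (auto simp: clip_def)
  then show "AE \<omega> in P. \<psi> (revealed X M \<omega> /\<^sub>R norm (revealed X M \<omega>)) =
      clip \<psi> (revealed X M \<omega> /\<^sub>R norm (revealed X M \<omega>))"
    by (simp add: Z_def)
  have clip_bounds: "0 \<le> clip \<psi> y" "clip \<psi> y \<le> s" for y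
    using s_gt_1 by (auto simp: clip_def)
  interpret D: prob_space user_distr
    by (rule prob_space_user_distr)
  show "iid_regression user_distr (direction m) (rating_ratio s m) (clip \<psi>) s"
    if m: "prob {\<omega> \<in> space P. M \<omega> = m} > 0"
  proof unfold_locales
    show "direction m \<in> borel_measurable user_distr" "rating_ratio s m \<in> borel_measurable user_distr"
      by measurable
    show "0 \<le> rating_ratio s m x \<and> rating_ratio s m x \<le> s" for x
      using s_gt_1 by (intro rating_ratio_bounds) simp
    fix h :: "real^'d \<Rightarrow> real" and C
    assume h[measurable]: "h \<in> borel_measurable borel" and C: "\<And>y. \<bar>h y\<bar> \<le> C"
    \<comment> \<open>The second factor is the indicator of \<open>M \<omega> = m\<close>, read off
      the support of Z so that \<open>h'\<close> is measurable for the conditioning sigma-algebra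
      F.\<close>
    define h' where "h' \<omega> = h (Z \<omega>) * of_bool (\<forall>j. Z \<omega> $ j \<noteq> 0 \<longleftrightarrow> j \<in> m)" for \<omega>
    have h'F[measurable]: "h' \<in> borel_measurable F"
      unfolding h'_def by measurable
    have h'[measurable]: "h' \<in> borel_measurable P"
      unfolding h'_def by measurable
    have "0 \<le> C"
      using C[of 0] abs_ge_zero order_trans by blast
    then have h'_bound: "\<bar>h' \<omega>\<bar> \<le> C" for \<omega>
      using C by (auto simp: h'_def)
    have bound: "\<bar>h' \<omega> * g\<bar> \<le> C * s" if "0 \<le> g" "g \<le> s" for g \<omega>
      using h'_bound that \<open>0 \<le> C\<close> by (auto simp: abs_mult intro!: mult_mono)
    have int: "integrable P (\<lambda>\<omega>. h' \<omega> * V \<omega>)" "integrable P (\<lambda>\<omega>. h' \<omega> * clip \<psi> (Z \<omega>))"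
      using bound V clip_bounds by (auto intro!: integrable_const_bound[where B="C * s"] AE_I2)
    define f where "f w = h (direction m (w 0)) * (rating_ratio s m (w 0) - clip \<psi> (direction m (w 0)))"
      for w :: "nat \<Rightarrow> (real^'d) \<times> real"
    define B where "B = {\<omega> \<in> space P. M \<omega> = m}"
    have f_int: "integrable (Pi\<^sub>M {0} (\<lambda>_. user_distr)) f"
    proof -
      interpret S: prob_space "Pi\<^sub>M {0::nat} (\<lambda>_. user_distr)"
        by (intro prob_space_PiM prob_space_user_distr)
      have "norm (f w) \<le> C * s" for w
      proof -
        have "\<bar>rating_ratio s m (w 0) - clip \<psi> (direction m (w 0))\<bar> \<le> s"
          using rating_ratio_bounds[of s m "w 0"] clip_bounds[of "direction m (w 0)"] s_gt_1 by linarith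
        then show ?thesis
          unfolding f_def real_norm_def abs_mult using C \<open>0 \<le> C\<close> by (intro mult_mono) auto
      qed
      moreover have "f \<in> borel_measurable (Pi\<^sub>M {0} (\<lambda>_. user_distr))"
        unfolding f_def by measurable
      ultimately show ?thesis
        by (intro S.integrable_const_bound[where B="C * s"] AE_I2)
    qed
    have "(\<integral>\<omega>. h' \<omega> * V \<omega> \<partial>P) = (\<integral>\<omega>. h' \<omega> * real_cond_exp P F V \<omega> \<partial>P)"
      using int(1) by (intro real_cond_exp_intg(2)[symmetric]) auto
    also have "\<dots> = (\<integral>\<omega>. h' \<omega> * clip \<psi> (Z \<omega>) \<partial>P)"
      using clip cond by (intro integral_cong_AE) (auto elim: eventually_elim2)
    finally have "(\<integral>\<omega>. h' \<omega> * V \<omega> - h' \<omega> * clip \<psi> (Z \<omega>) \<partial>P) = 0"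
      using int by simp
    also have "(\<integral>\<omega>. h' \<omega> * V \<omega> - h' \<omega> * clip \<psi> (Z \<omega>) \<partial>P) =
        (\<integral>\<omega>. indicator (space P \<inter> B) \<omega> * f (\<lambda>i\<in>{0}. user i \<omega>) \<partial>P)"
    proof (rule Bochner_Integration.integral_cong[OF refl])
      fix \<omega> assume \<omega>: "\<omega> \<in> space P"
      have "(\<forall>j. Z \<omega> $ j \<noteq> 0 \<longleftrightarrow> j \<in> m) \<longleftrightarrow> M \<omega> = m"
        unfolding ZV(1)[OF \<omega>] using direction_support[OF valid_new_user[OF \<omega>] M_nonempty[OF \<omega>]] by blast
      then show "h' \<omega> * V \<omega> - h' \<omega> * clip \<psi> (Z \<omega>) = indicator (space P \<inter> B) \<omega> * f (\<lambda>i\<in>{0}. user i \<omega>)"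
        using \<omega> by (auto simp: h'_def B_def ZV f_def right_diff_distrib)
    qed
    \<comment> \<open>At time 1 with the whole space as the event of the available users, so only
      the independence of masks and users is exploited.\<close>
    also have "\<dots> = prob (space P \<inter> B) * (\<integral>w. f w \<partial>Pi\<^sub>M {0} (\<lambda>_. user_distr))"
      by (rule users_indep_R_masks(1)[of 1, OF _ _ _ _ f_int])
        (auto simp: B_def intro: New_Mask_event sets.top[of "vimage_algebra (space P) _ _", simplified])
    also have "space P \<inter> B = B"
      by (auto simp: B_def)
    finally have "(\<integral>w. f w \<partial>Pi\<^sub>M {0} (\<lambda>_. user_distr)) = 0"
      using m by (simp add: B_def)
    moreover have "(\<integral>w. f w \<partial>Pi\<^sub>M {0} (\<lambda>_. user_distr)) =
        (\<integral>p. h (direction m p) * (rating_ratio s m p - clip \<psi> (direction m p)) \<partial>user_distr)"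
    proof -
      interpret product_sigma_finite "\<lambda>_::nat. user_distr"
        by unfold_locales
      show ?thesis
        unfolding f_def by (rule product_integral_singleton) measurable
    qed
    ultimately show "(\<integral>p. h (direction m p) * (rating_ratio s m p - clip \<psi> (direction m p)) \<partial>user_distr) = 0"
      by simp
  qed (use clip_bounds norm_direction_le in auto)
qed

subsection \<open>Reduction of the estimate to the users with complete masks\<close>

lemma finite_R: "n \<ge> 1 \<Longrightarrow> \<omega> \<in> space P \<Longrightarrow> R n \<omega> \<subseteq> {1..n} \<and> R n \<omega> \<noteq> {} \<and> finite (R n \<omega>)"
  using measurable_space[OF R_measurable, of n \<omega>] by (auto intro: finite_subset)

text \<open>A user with zero masked rating may occupy one of the k places; it then contributes 0, in
  accordance with the convention on weights.\<close>

lemma knn_estimate_eq: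
  assumes "finite (R n \<omega>)" "k n \<le> card (R n \<omega>)"
  shows "knn_estimate Xs Ys Ms M R k n x \<omega> = norm x *
    (\<Sum>i\<in>nearest (k n) (\<lambda>l. similarity Xs Ms M n x l \<omega>) (R n \<omega>).
      if db_rating Xs Ms M n i \<omega> = 0 then 0 else Ys i \<omega> / norm (db_rating Xs Ms M n i \<omega>) / k n)"
proof -
  let ?N = "nearest (k n) (\<lambda>l. similarity Xs Ms M n x l \<omega>) (R n \<omega>)"
  have "(\<Sum>i\<in>R n \<omega>. knn_weight Xs Ms M R k n i x \<omega> * (Ys i \<omega> / norm (db_rating Xs Ms M n i \<omega>))) =
      (\<Sum>i\<in>?N. if db_rating Xs Ms M n i \<omega> = 0 then 0 else Ys i \<omega> / norm (db_rating Xs Ms M n i \<omega>) / k n)"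
    using assms by (intro sum.mono_neutral_cong_right) (auto simp: knn_weight_def nearest_def)
  then show ?thesis
    by (simp add: knn_estimate_def)
qed

text \<open>A nonzero masked rating comes from a nonempty common mask and has norm at least 1, so
  each of the at most k terms is at most \<open>s / k\<close>. This covers outcomes in which users
  with incomplete masks may be selected.\<close>

lemma knn_estimate_bound:
  assumes "\<forall>i. valid_user s (user i \<omega>)" "\<omega> \<in> space P" "n \<ge> 1"
  shows "\<bar>knn_estimate Xs Ys Ms M R k n x \<omega>\<bar> \<le> norm x * s"
proof (cases "k n \<le> card (R n \<omega>)")
  case True
  let ?N = "nearest (k n) (\<lambda>l. similarity Xs Ms M n x l \<omega>) (R n \<omega>)"
  let ?t = "\<lambda>i. if db_rating Xs Ms M n i \<omega> = 0 then 0 else Ys i \<omega> / norm (db_rating Xs Ms M n i \<omega>) / k n"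
  note R = finite_R[OF assms(3,2)]
  have t: "\<bar>?t i\<bar> \<le> s / k n" if i: "i \<in> R n \<omega>" for i
  proof (cases "db_rating Xs Ms M n i \<omega> = 0")
    case False
    have valid: "valid_user s (Xs i \<omega>, Ys i \<omega>)"
      using assms(1)[rule_format, of i] R i by (auto simp: user_def split: if_splits)
    have ne: "common_mask Ms M n i \<omega> \<noteq> {}"
    proof
      assume "common_mask Ms M n i \<omega> = {}"
      then have "db_rating Xs Ms M n i \<omega> = 0"
        by (simp add: db_rating_def vec_eq_iff)
      with False show False
        by contradiction
    qed
    have "Ys i \<omega> / norm (db_rating Xs Ms M n i \<omega>) = rating_ratio s (common_mask Ms M n i \<omega>) (Xs i \<omega>, Ys i \<omega>)"
      using rating_ratio_eq[OF valid ne] by (simp add: db_rating_def)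
    moreover have "0 \<le> s"
      using s_gt_1 by simp
    ultimately show ?thesis
      using rating_ratio_bounds[of s "common_mask Ms M n i \<omega>" "(Xs i \<omega>, Ys i \<omega>)"] False
      by (auto intro!: divide_right_mono)
  qed (use s_gt_1 in auto)
  have "\<bar>\<Sum>i\<in>?N. ?t i\<bar> \<le> (\<Sum>i\<in>?N. \<bar>?t i\<bar>)"
    by (rule sum_abs)
  also have "\<dots> \<le> real (card ?N) * (s / k n)"
    using t nearest_subset by (intro sum_bounded_above) blast
  also have "\<dots> \<le> real (k n) * (s / k n)"
    using R s_gt_1 by (intro mult_right_mono) (auto simp: card_nearest)
  also have "\<dots> \<le> s"
    using s_gt_1 by simp
  finally have "\<bar>\<Sum>i\<in>?N. ?t i\<bar> \<le> s" .
  then show ?thesis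
    unfolding knn_estimate_eq[where k=k, OF conjunct2[OF conjunct2[OF R]] True] abs_mult
    by (simp add: mult_left_mono)
next
  case False
  then show ?thesis
    using s_gt_1 by (simp add: knn_estimate_def knn_weight_def)
qed

lemma nearest_similarity_eq:
  assumes valid: "\<forall>i. valid_user s (user i \<omega>)" and \<omega>: "\<omega> \<in> space P" "n \<ge> 1"
    and m: "M \<omega> = m" and a: "good_users n (R n \<omega>) m \<omega> = a"
    and many: "k \<le> card {i \<in> a. dist (direction m (user 0 \<omega>)) (direction m (user i \<omega>)) < sqrt (2 / card m)}"
  shows "nearest k (\<lambda>l. similarity Xs Ms M n (revealed X M \<omega>) l \<omega>) (R n \<omega>) =
    nearest k (\<lambda>l. - dist (direction m (user 0 \<omega>)) (direction m (user l \<omega>))) a"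
    (is "nearest k ?S _ = nearest k ?S' _")
proof -
  note R = finite_R[OF \<omega>(2,1)]
  have mne: "m \<noteq> {}"
    using M_nonempty[OF \<omega>(1)] m by auto
  then have cm: "0 < card m"
    by (simp add: card_gt_0_iff)
  have aR: "a \<subseteq> R n \<omega>"
    using a by (auto simp: good_users_def)
  have pos: "i \<noteq> 0" if "i \<in> R n \<omega>" for i
    using R that by force
  let ?d = "\<lambda>i. dist (direction m (user 0 \<omega>)) (direction m (user i \<omega>))"
  have S: "?S i = 1 - (?d i)\<^sup>2 / 2" if i: "i \<in> a" for i
  proof -
    have "common_mask Ms M n i \<omega> = m"
      using i a m by (auto simp: good_users_def common_mask_def)
    moreover have "Xs i \<omega> = fst (user i \<omega>)"
      using pos[of i] i aR by (auto simp: user_def)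
    ultimately have "?S i = Sbar (masked m (fst (user 0 \<omega>))) (masked m (fst (user i \<omega>)))"
      using cm m mne by (simp add: similarity_def db_rating_def revealed_eq[OF m])
    then show ?thesis
      using Sbar_masked valid mne by metis
  qed
  have close: "?d i < sqrt (2 / card m) \<longleftrightarrow> ?S i > 1 - 1 / card m" if "i \<in> a" for i
  proof -
    have "?d i < sqrt (2 / card m) \<longleftrightarrow> sqrt ((?d i)\<^sup>2) < sqrt (2 / card m)"
      by simp
    also have "\<dots> \<longleftrightarrow> ?S i > 1 - 1 / card m"
      unfolding S[OF that] real_sqrt_less_iff by (simp add: field_simps)
    finally show ?thesis .
  qed
  have "nearest k ?S (R n \<omega>) = nearest k ?S a"
  proof (rule nearest_superset_eq[OF _ aR])
    show "finite (R n \<omega>)"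
      using R by simp
    have "{i \<in> a. ?d i < sqrt (2 / card m)} = {i \<in> a. 1 - 1 / card m < ?S i}"
      using close by blast
    then show "k \<le> card {i \<in> a. 1 - 1 / card m < ?S i}"
      using many by simp
    fix i assume i: "i \<in> R n \<omega> - a"
    have "common_mask Ms M n i \<omega> \<subset> m"
      using i a m by (auto simp: good_users_def common_mask_def)
    then have "card (common_mask Ms M n i \<omega>) < card m"
      by (intro psubset_card_mono) auto
    \<comment> \<open>An incomplete mask misses at least one of the items in m, which costs
      \<open>1 / card m\<close>.\<close>
    then have "(real (card (common_mask Ms M n i \<omega>)) + 1) / card m \<le> 1"
      using cm by simp
    then have p: "real (card (common_mask Ms M n i \<omega>)) / card m \<le> 1 - 1 / card m"
      by (simp add: add_divide_distrib)
    have "?S i \<le> real (card (common_mask Ms M n i \<omega>)) / card m * 1"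
      unfolding similarity_def m by (intro mult_left_mono Sbar_le_1) auto
    with p show "?S i \<le> 1 - 1 / card m"
      by simp
  qed
  also have "\<dots> = nearest k ?S' a"
  proof (rule nearest_cong)
    fix i j assume "i \<in> a" "j \<in> a"
    moreover have "(?d j)\<^sup>2 < (?d i)\<^sup>2 \<longleftrightarrow> ?d j < ?d i"
      by (auto intro: power2_less_imp_less power_strict_mono)
    ultimately show "?S i < ?S j \<longleftrightarrow> ?S' i < ?S' j"
      by (simp add: S)
  qed
  finally show ?thesis .
qed

text \<open>The constant \<open>s * CARD('d)\<close> bounds the norm of the revealed ratings. If k
  complete users are close, the estimate is this norm times \<open>knn_mean\<close>; otherwise
  estimate and target are each at most s times the constant. The regression value enters only as a
  number t between 0 and s.\<close>

lemma knn_estimate_error: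
  assumes valid: "\<forall>i. valid_user s (user i \<omega>)" and \<omega>: "\<omega> \<in> space P" "n \<ge> 1"
    and m: "M \<omega> = m" and a: "good_users n (R n \<omega>) m \<omega> = a" and t: "0 \<le> t" "t \<le> s"
    and iid: "iid_regression user_distr (direction m) (rating_ratio s m) \<psi> s"
    and w: "w = (\<lambda>i\<in>insert 0 a. user i \<omega>)"
  shows "\<bar>knn_estimate Xs Ys Ms M R k n (revealed X M \<omega>) \<omega> - norm (revealed X M \<omega>) * t\<bar> \<le>
    s * CARD('d) * \<bar>iid_regression.knn_mean (direction m) (rating_ratio s m) (k n) a w - t\<bar> +
    2 * s * (s * CARD('d)) * of_bool (iid_regression.few (direction m) (sqrt (2 / card m)) (k n) a w)"
proof -
  interpret I: iid_regression user_distr "direction m" "rating_ratio s m" \<psi> s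
    by fact
  let ?x = "revealed X M \<omega>" and ?c = "s * CARD('d)" and ?\<rho> = "sqrt (2 / card m)"
  have x: "norm ?x \<le> ?c" "0 \<le> ?c"
    using valid_new_user[OF \<omega>(1)] norm_masked_le[of "fst (user 0 \<omega>)" s m] s_gt_1
    by (auto simp: revealed_eq[OF m] valid_user_def)
  note R = finite_R[OF \<omega>(2,1)]
  have mne: "m \<noteq> {}"
    using M_nonempty[OF \<omega>(1)] m by auto
  have aR: "a \<subseteq> R n \<omega>"
    using a by (auto simp: good_users_def)
  have fin: "finite a"
    using R aR finite_subset by blast
  have wi: "w i = user i \<omega>" if "i \<in> insert 0 a" for i
    using that by (simp add: w)
  show ?thesis
  proof (cases "I.few ?\<rho> (k n) a w")
    case True
    have "\<bar>knn_estimate Xs Ys Ms M R k n ?x \<omega>\<bar> \<le> norm ?x * s"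
      using valid \<omega> by (rule knn_estimate_bound)
    moreover have "\<bar>norm ?x * t\<bar> \<le> norm ?x * s"
      using t s_gt_1 by (simp add: abs_mult mult_left_mono)
    moreover have "norm ?x * s \<le> ?c * s"
      using x s_gt_1 by (intro mult_right_mono) auto
    moreover have "0 \<le> ?c * \<bar>I.knn_mean (k n) a w - t\<bar>"
      using x(2) abs_ge_zero by (rule mult_nonneg_nonneg)
    moreover have "2 * s * ?c = 2 * (?c * s)"
      by simp
    ultimately show ?thesis
      using True by (simp only: of_bool_eq mult_1_right)
  next
    case False
    have "{i \<in> a. dist (direction m (w 0)) (direction m (w i)) < ?\<rho>} =
        {i \<in> a. dist (direction m (user 0 \<omega>)) (direction m (user i \<omega>)) < ?\<rho>}"
      using wi by auto
    then have many: "k n \<le> card {i \<in> a. dist (direction m (user 0 \<omega>)) (direction m (user i \<omega>)) < ?\<rho>}"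
      using False by (simp add: I.few_def not_less)
    also have "\<dots> \<le> card (R n \<omega>)"
      using R aR by (intro card_mono) auto
    finally have kR: "k n \<le> card (R n \<omega>)" .
    have sel: "nearest (k n) (\<lambda>l. similarity Xs Ms M n ?x l \<omega>) (R n \<omega>) = I.sel (k n) a w"
      unfolding nearest_similarity_eq[OF valid \<omega> m a many] I.sel_def
      using wi by (intro nearest_cong) auto
    have term_eq: "(if db_rating Xs Ms M n i \<omega> = 0 then 0 else Ys i \<omega> / norm (db_rating Xs Ms M n i \<omega>) / k n) =
        rating_ratio s m (w i) / k n" if "i \<in> I.sel (k n) a w" for i
    proof -
      have i: "i \<in> a" "i \<noteq> 0"
        using that I.sel_subset aR R by force+
      have "common_mask Ms M n i \<omega> = m"
        using i(1) a m by (auto simp: good_users_def common_mask_def)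
      moreover have user: "user i \<omega> = (Xs i \<omega>, Ys i \<omega>)"
        using i(2) by (simp add: user_def)
      ultimately have db: "db_rating Xs Ms M n i \<omega> = masked m (fst (user i \<omega>))"
        by (simp add: db_rating_def)
      have valid_i: "valid_user s (user i \<omega>)"
        using valid by blast
      then have "1 \<le> norm (masked m (fst (user i \<omega>)))"
        using mne by (intro one_le_norm_masked) (auto simp: valid_user_def)
      then have "db_rating Xs Ms M n i \<omega> \<noteq> 0"
        unfolding db by auto
      then show ?thesis
        using i(1) wi[of i] rating_ratio_eq[OF valid_i mne] db user by simp
    qed
    have "knn_estimate Xs Ys Ms M R k n ?x \<omega> = norm ?x * I.knn_mean (k n) a w"
      unfolding knn_estimate_eq[where k=k, OF conjunct2[OF conjunct2[OF R]] kR] sel I.knn_mean_def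
      using term_eq by (simp add: sum_divide_distrib)
    then have "\<bar>knn_estimate Xs Ys Ms M R k n ?x \<omega> - norm ?x * t\<bar> = norm ?x * \<bar>I.knn_mean (k n) a w - t\<bar>"
      by (simp add: abs_mult flip: right_diff_distrib)
    also have "\<dots> \<le> ?c * \<bar>I.knn_mean (k n) a w - t\<bar>"
      using x by (intro mult_right_mono) auto
    finally show ?thesis
      using False by simp
  qed
qed

subsection \<open>Most available users have complete masks\<close>

lemma measurable_G [measurable]: "n \<ge> 1 \<Longrightarrow> G n \<in> measurable P (count_space UNIV)"
  by (rule measurable_compose[OF generic_mask_measurable]) simp_all

lemma measurable_Ms [measurable]: "i \<ge> 1 \<Longrightarrow> n \<ge> 1 \<Longrightarrow> Ms i n \<in> measurable P (count_space UNIV)"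
  by (rule measurable_compose[OF db_mask_measurable]) simp_all

lemma prob_mask_not_full:
  assumes "i \<ge> 1" "n \<ge> 1"
  shows "prob {\<omega> \<in> space P. Ms i n \<omega> \<noteq> UNIV} = prob {\<omega> \<in> space P. G n \<omega> \<noteq> UNIV}"
proof -
  let ?S = "(\<lambda>a. a n) -` (- {UNIV}) \<inter> space (mask_seq_space :: (nat \<Rightarrow> 'd set) measure)"
  have "(\<lambda>a. a n) \<in> measurable mask_seq_space (count_space UNIV)"
    using assms(2) by (intro measurable_component_singleton) auto
  then have S: "?S \<in> sets mask_seq_space"
    by (rule measurable_sets) simp
  have meas: "mask_seq H \<in> measurable P mask_seq_space"
    if "\<And>n. n \<ge> 1 \<Longrightarrow> H n \<in> measurable P (count_space UNIV)" for H :: "nat \<Rightarrow> 'w \<Rightarrow> 'd set"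
    unfolding mask_seq_def[abs_def] using that by (intro measurable_restrict) auto
  have eq: "measure (distr P mask_seq_space (mask_seq H)) ?S = prob {\<omega> \<in> space P. H n \<omega> \<noteq> UNIV}"
    if "\<And>n. n \<ge> 1 \<Longrightarrow> H n \<in> measurable P (count_space UNIV)" for H :: "nat \<Rightarrow> 'w \<Rightarrow> 'd set"
  proof -
    have "mask_seq H -` ?S \<inter> space P = {\<omega> \<in> space P. H n \<omega> \<noteq> UNIV}"
      using assms(2) by (auto simp: mask_seq_def space_PiM)
    then show ?thesis
      using measure_distr[OF meas[OF that] S] by simp
  qed
  show ?thesis
    using eq[of "Ms i"] eq[of G] db_mask_distr[OF assms(1)] measurable_Ms[OF assms(1)] measurable_G
    by simp
qed

text \<open>The time \<open>n0\<close> is finite everywhere, so the events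
  \<open>n < n0 \<omega>\<close> decrease to the empty set. The common law of the mask sequences
  makes L valid for all users i.\<close>

lemma prob_mask_not_full_tendsto:
  assumes "\<epsilon> > 0"
  obtains L where "\<And>i n. i \<ge> 1 \<Longrightarrow> n \<ge> L \<Longrightarrow> n \<ge> 1 \<Longrightarrow> prob {\<omega> \<in> space P. Ms i n \<omega> \<noteq> UNIV} \<le> \<epsilon>"
proof -
  obtain n0 :: "'w \<Rightarrow> nat" where [measurable]: "n0 \<in> measurable P (count_space UNIV)"
    and n0: "\<And>\<omega> n. \<omega> \<in> space P \<Longrightarrow> n \<ge> n0 \<omega> \<Longrightarrow> G n \<omega> = UNIV"
    using generic_mask_full by blast
  define A where "A n = {\<omega> \<in> space P. n < n0 \<omega>}" for n
  have "(\<lambda>n. prob (A n)) \<longlonglongrightarrow> prob (\<Inter>n. A n)"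
    by (rule finite_Lim_measure_decseq) (auto simp: A_def decseq_def)
  moreover have "(\<Inter>n. A n) = {}"
    by (auto simp: A_def)
  ultimately have "(\<lambda>n. prob (A n)) \<longlonglongrightarrow> 0"
    by simp
  then have "eventually (\<lambda>n. prob (A n) < \<epsilon>) sequentially"
    using assms by (rule order_tendstoD(2))
  then obtain L where L: "\<And>n. n \<ge> L \<Longrightarrow> prob (A n) < \<epsilon>"
    by (auto simp: eventually_sequentially)
  show thesis
  proof (rule that)
    fix i n :: nat assume "i \<ge> 1" "n \<ge> L" "n \<ge> 1"
    have "prob {\<omega> \<in> space P. G n \<omega> \<noteq> UNIV} \<le> prob (A n)"
      using n0 by (intro finite_measure_mono) (auto simp: A_def not_le[symmetric])
    then show "prob {\<omega> \<in> space P. Ms i n \<omega> \<noteq> UNIV} \<le> \<epsilon>"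
      using prob_mask_not_full[OF \<open>i \<ge> 1\<close> \<open>n \<ge> 1\<close>] L[OF \<open>n \<ge> L\<close>] by simp
  qed
qed


text \<open>Takes finitely many values, each on an event that is independent of the users by
  \<open>users_indep_R_masks\<close>; this is how the random index set gets frozen.\<close>

definition profile :: "nat \<Rightarrow> 'w \<Rightarrow> nat set \<times> 'd set \<times> nat set" where
  "profile n \<omega> = (R n \<omega>, M \<omega>, good_users n (R n \<omega>) (M \<omega>) \<omega>)"

abbreviation profiles :: "nat \<Rightarrow> (nat set \<times> 'd set \<times> nat set) set" where
  "profiles n \<equiv> Pow {1..n} \<times> UNIV \<times> Pow {1..n}"

lemma profile_in: "n \<ge> 1 \<Longrightarrow> \<omega> \<in> space P \<Longrightarrow> profile n \<omega> \<in> profiles n"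
  using finite_R[of n \<omega>] by (auto simp: profile_def good_users_def)

lemma profile_event_eq:
  "{\<omega> \<in> space P. profile n \<omega> = (r, m, a)} =
    {\<omega> \<in> space P. R n \<omega> = r} \<inter> {\<omega> \<in> space P. M \<omega> = m \<and> good_users n r m \<omega> = a}"
  by (auto simp: profile_def)

lemma mask_events_sub: "mask_events \<subseteq> events"
  using indep_masks_users by (simp add: indep_setD_ev1)

lemma R_measurable_count_space [measurable]: "n \<ge> 1 \<Longrightarrow> R n \<in> measurable P (count_space UNIV)"
  by (rule measurable_compose[OF R_measurable]) simp_all

lemma measurable_profile [measurable]:
  assumes "n \<ge> 1"
  shows "profile n \<in> measurable P (count_space UNIV)"
proof -
  have "profile n -` {t} \<inter> space P \<in> events" if t: "t \<in> profiles n" for t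
  proof -
    obtain r m a where rma: "t = (r, m, a)" "r \<subseteq> {1..n}"
      using t by auto
    have "{\<omega> \<in> space P. R n \<omega> = r} \<in> events"
      using assms by measurable
    then have "{\<omega> \<in> space P. profile n \<omega> = (r, m, a)} \<in> events"
      unfolding profile_event_eq
      using subsetD[OF mask_events_sub good_users_event[OF rma(2)]] by (rule sets.Int)
    moreover have "profile n -` {t} \<inter> space P = {\<omega> \<in> space P. profile n \<omega> = (r, m, a)}"
      by (auto simp: rma)
    ultimately show ?thesis
      by simp
  qed
  then have "profile n \<in> measurable P (count_space (profiles n))"
    using profile_in[OF assms] by (subst measurable_count_space_eq2) (auto simp del: mem_Sigma_iff)
  then show ?thesis
    by (rule measurable_compose) simp
qed

text \<open>Summing over the values r of \<open>R n\<close> and using its independence of the masks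
  leaves the mask probabilities of a fixed set r. Users younger than L steps are counted with
  probability 1, the others with \<epsilon>. Asking for the full mask, rather than for one
  containing \<open>M \<omega>\<close>, keeps M out of the event.\<close>

lemma expectation_incomplete_le:
  fixes \<epsilon> :: real and L :: nat
  assumes n: "n \<ge> 1" and \<epsilon>: "\<epsilon> \<ge> 0"
    and L: "\<And>i n. i \<ge> 1 \<Longrightarrow> n \<ge> L \<Longrightarrow> n \<ge> 1 \<Longrightarrow> prob {\<omega> \<in> space P. Ms i n \<omega> \<noteq> UNIV} \<le> \<epsilon>"
  shows "integrable P (\<lambda>\<omega>. real (card {i \<in> R n \<omega>. Ms i (n + 1 - i) \<omega> \<noteq> UNIV}) / card (R n \<omega>))"
    "expectation (\<lambda>\<omega>. real (card {i \<in> R n \<omega>. Ms i (n + 1 - i) \<omega> \<noteq> UNIV}) / card (R n \<omega>)) \<le>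
      expectation (\<lambda>\<omega>. L / card (R n \<omega>) + \<epsilon>)"
proof -
  let ?B = "\<lambda>r. {\<omega> \<in> space P. R n \<omega> = r}" and ?E = "\<lambda>i. {\<omega> \<in> space P. Ms i (n + 1 - i) \<omega> \<noteq> UNIV}"
  let ?T = "Pow {1..n} - {{}}"
  have le: "(\<Sum>i\<in>r. prob (?E i)) / card r \<le> L / card r + \<epsilon>" if r: "r \<in> ?T" for r
  proof -
    have fin: "finite r"
      using r by (auto intro: finite_subset)
    have "(\<Sum>i\<in>r. prob (?E i)) \<le> (\<Sum>i\<in>r. of_bool (n + 1 - i < L) + \<epsilon>)"
    proof (rule sum_mono)
      fix i assume "i \<in> r"
      then have "i \<in> {1..n}"
        using r by blast
      then have i: "1 \<le> i" "1 \<le> n + 1 - i"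
        by auto
      show "prob (?E i) \<le> of_bool (n + 1 - i < L) + \<epsilon>"
      proof (cases "n + 1 - i < L")
        case True
        then show ?thesis
          using prob_le_1[of "?E i"] \<epsilon> by (simp only: of_bool_eq)
      next
        case False
        then show ?thesis
          using L[OF i(1) _ i(2)] by simp
      qed
    qed
    also have "\<dots> = card {i \<in> r. n + 1 - i < L} + card r * \<epsilon>"
      using fin by (simp add: sum.distrib Int_def)
    also have "\<dots> \<le> L + card r * \<epsilon>"
    proof -
      \<comment> \<open>Every i in r is at most n, so the subtraction does not truncate and distinct
        users have distinct ages.\<close>
      have "inj_on (\<lambda>i. n + 1 - i) {i \<in> r. n + 1 - i < L}"
      proof (rule inj_onI)
        fix i j assume "i \<in> {i \<in> r. n + 1 - i < L}" "j \<in> {i \<in> r. n + 1 - i < L}" "n + 1 - i = n + 1 - j"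
        moreover from this have "i \<le> n" "j \<le> n"
          using r by auto
        ultimately show "i = j"
          by linarith
      qed
      then have "card {i \<in> r. n + 1 - i < L} \<le> card {..<L}"
        by (rule card_inj_on_le) auto
      then show ?thesis
        by simp
    qed
    finally have "(\<Sum>i\<in>r. prob (?E i)) / card r \<le> (L + card r * \<epsilon>) / card r"
      by (rule divide_right_mono) simp
    also have "\<dots> = L / card r + \<epsilon>"
      using r fin by (auto simp: add_divide_distrib card_eq_0_iff)
    finally show ?thesis .
  qed
  have R_in: "R n \<omega> \<in> ?T" if "\<omega> \<in> space P" for \<omega>
    using finite_R[OF n that] by auto
  have split: "g (R n \<omega>) = (\<Sum>r\<in>?T. indicator (?B r) \<omega> * g r)" if "\<omega> \<in> space P" for g :: "nat set \<Rightarrow> real" and \<omega>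
  proof -
    have "(\<Sum>r\<in>?T. indicator (?B r) \<omega> * g r) = (\<Sum>r\<in>?T. if r = R n \<omega> then g r else 0)"
      using that by (intro sum.cong) (auto simp: indicator_def)
    then show ?thesis
      using R_in[OF that] by simp
  qed
  have B[measurable]: "?B r \<in> events" for r
    using n by measurable
  have E: "?E i \<in> mask_events" "?E i \<in> events" if "i \<in> r" "r \<in> ?T" for i r
  proof -
    have "i \<in> {1..n}"
      using that by blast
    then have "1 \<le> i" "1 \<le> n + 1 - i"
      by auto
    then show "?E i \<in> mask_events"
      by (rule Db_Mask_event)
    then show "?E i \<in> events"
      using mask_events_sub by blast
  qed
  have indep: "prob (?B r \<inter> ?E i) = prob (?B r) * prob (?E i)" if "i \<in> r" "r \<in> ?T" for i r
    by (rule users_indep_R_masks(3)[OF n R_event[OF n] E(1)[OF that], of "{0}" "\<lambda>_. 0"]) auto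
  let ?h = "\<lambda>\<omega>. \<Sum>r\<in>?T. \<Sum>i\<in>r. indicator (?B r \<inter> ?E i) \<omega> / card r"
  have eq: "real (card {i \<in> R n \<omega>. Ms i (n + 1 - i) \<omega> \<noteq> UNIV}) / card (R n \<omega>) = ?h \<omega>"
    if \<omega>: "\<omega> \<in> space P" for \<omega>
  proof -
    have "real (card {i \<in> R n \<omega>. Ms i (n + 1 - i) \<omega> \<noteq> UNIV}) / card (R n \<omega>) =
        (\<Sum>i\<in>R n \<omega>. indicator (?E i) \<omega>) / card (R n \<omega>)"
      using finite_R[OF n \<omega>] \<omega> by (simp add: indicator_def of_bool_def sum.If_cases Int_def)
    also have "\<dots> = (\<Sum>r\<in>?T. indicator (?B r) \<omega> * ((\<Sum>i\<in>r. indicator (?E i) \<omega>) / card r))"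
      by (rule split[OF \<omega>])
    also have "\<dots> = ?h \<omega>"
      by (simp add: sum_divide_distrib sum_distrib_left indicator_inter_arith)
    finally show ?thesis .
  qed
  have h_int: "integrable P (\<lambda>\<omega>. indicator (?B r \<inter> ?E i) \<omega> / card r)" if "i \<in> r" "r \<in> ?T" for i r
    using E(2)[OF that] B by (intro integrable_divide integrable_real_indicator) (auto simp: emeasure_eq_measure)
  then have "integrable P ?h"
    by (intro Bochner_Integration.integrable_sum) auto
  then show "integrable P (\<lambda>\<omega>. real (card {i \<in> R n \<omega>. Ms i (n + 1 - i) \<omega> \<noteq> UNIV}) / card (R n \<omega>))"
    using eq by (subst Bochner_Integration.integrable_cong[OF refl]) auto
  have "expectation (\<lambda>\<omega>. real (card {i \<in> R n \<omega>. Ms i (n + 1 - i) \<omega> \<noteq> UNIV}) / card (R n \<omega>)) = expectation ?h"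
    using eq by (intro Bochner_Integration.integral_cong) auto
  also have "\<dots> = (\<Sum>r\<in>?T. expectation (\<lambda>\<omega>. \<Sum>i\<in>r. indicator (?B r \<inter> ?E i) \<omega> / card r))"
    using h_int by (intro Bochner_Integration.integral_sum Bochner_Integration.integrable_sum) auto
  also have "\<dots> = (\<Sum>r\<in>?T. \<Sum>i\<in>r. expectation (\<lambda>\<omega>. indicator (?B r \<inter> ?E i) \<omega> / card r))"
    using h_int by (intro sum.cong refl Bochner_Integration.integral_sum) auto
  also have "\<dots> = (\<Sum>r\<in>?T. prob (?B r) * ((\<Sum>i\<in>r. prob (?E i)) / card r))"
  proof (rule sum.cong[OF refl])
    fix r assume r: "r \<in> ?T"
    have "expectation (\<lambda>\<omega>. indicator (?B r \<inter> ?E i) \<omega> / card r) = prob (?B r) * prob (?E i) / card r" if "i \<in> r" for i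
    proof -
      have "expectation (\<lambda>\<omega>. indicator (?B r \<inter> ?E i) \<omega> / card r) =
          expectation (indicator (?B r \<inter> ?E i)) / card r"
        by (rule integral_divide_zero)
      also have "\<dots> = prob (?B r \<inter> ?E i \<inter> space P) / card r"
        by (simp only: Bochner_Integration.integral_indicator)
      also have "?B r \<inter> ?E i \<inter> space P = ?B r \<inter> ?E i"
        by auto
      finally show ?thesis
        by (simp only: indep[OF that r])
    qed
    then have "(\<Sum>i\<in>r. expectation (\<lambda>\<omega>. indicator (?B r \<inter> ?E i) \<omega> / card r)) = (\<Sum>i\<in>r. prob (?B r) * prob (?E i) / card r)"
      by (rule sum.cong[OF refl])
    also have "\<dots> = prob (?B r) * ((\<Sum>i\<in>r. prob (?E i)) / card r)"
      by (simp add: sum_divide_distrib sum_distrib_left)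
    finally show "(\<Sum>i\<in>r. expectation (\<lambda>\<omega>. indicator (?B r \<inter> ?E i) \<omega> / card r)) = prob (?B r) * ((\<Sum>i\<in>r. prob (?E i)) / card r)" .
  qed
  also have "\<dots> \<le> (\<Sum>r\<in>?T. prob (?B r) * (L / card r + \<epsilon>))"
    using le by (intro sum_mono mult_left_mono) auto
  also have "\<dots> = (\<Sum>r\<in>?T. expectation (\<lambda>\<omega>. indicator (?B r) \<omega> * (L / card r + \<epsilon>)))"
    using B by (simp add: Int_def conj_commute)
  also have "\<dots> = expectation (\<lambda>\<omega>. \<Sum>r\<in>?T. indicator (?B r) \<omega> * (L / card r + \<epsilon>))"
    using B by (intro Bochner_Integration.integral_sum[symmetric] integrable_mult_left integrable_real_indicator)
      (auto simp: emeasure_eq_measure)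
  also have "\<dots> = expectation (\<lambda>\<omega>. L / card (R n \<omega>) + \<epsilon>)"
    using split[of _ "\<lambda>r. L / card r + \<epsilon>"] by (intro Bochner_Integration.integral_cong) auto
  finally show "expectation (\<lambda>\<omega>. real (card {i \<in> R n \<omega>. Ms i (n + 1 - i) \<omega> \<noteq> UNIV}) / card (R n \<omega>)) \<le>
      expectation (\<lambda>\<omega>. L / card (R n \<omega>) + \<epsilon>)" .
qed

text \<open>An available user outside A has an incomplete mask. So on the event in question
  \<open>card R\<close> is at most \<open>k / \<delta>\<close> plus the number of incomplete masks,
  and division by \<open>card R\<close> bounds the indicator of the event by quantities of known
  mean.\<close>

lemma prob_few_good_users_le:
  fixes \<epsilon> \<delta> :: real and L :: nat
  assumes n: "n \<ge> 1" and k: "1 \<le> k" and "\<delta> > 0" and \<epsilon>: "\<epsilon> \<ge> 0"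
    and L: "\<And>i n. i \<ge> 1 \<Longrightarrow> n \<ge> L \<Longrightarrow> n \<ge> 1 \<Longrightarrow> prob {\<omega> \<in> space P. Ms i n \<omega> \<noteq> UNIV} \<le> \<epsilon>"
  shows "prob {\<omega> \<in> space P. real k > \<delta> * card (good_users n (R n \<omega>) (M \<omega>) \<omega>)} \<le>
    (2 / \<delta> + 2 * L) * expectation (\<lambda>\<omega>. real k / card (R n \<omega>)) + 2 * \<epsilon>"
proof -
  let ?A = "\<lambda>\<omega>. good_users n (R n \<omega>) (M \<omega>) \<omega>"
  let ?b = "\<lambda>\<omega>. real (card {i \<in> R n \<omega>. Ms i (n + 1 - i) \<omega> \<noteq> UNIV})"
  let ?r = "\<lambda>\<omega>. real (card (R n \<omega>))"
  note [measurable] = R_measurable_count_space[OF n]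
  have r: "1 \<le> ?r \<omega>" if "\<omega> \<in> space P" for \<omega>
    using finite_R[OF n that] by (simp add: Suc_le_eq card_gt_0_iff)
  have int_r: "integrable P (\<lambda>\<omega>. c / ?r \<omega>)" for c
  proof (rule integrable_const_bound[where B="\<bar>c\<bar>"])
    show "AE \<omega> in P. norm (c / ?r \<omega>) \<le> \<bar>c\<bar>"
    proof (rule AE_I2)
      fix \<omega> assume "\<omega> \<in> space P"
      then have "\<bar>c\<bar> / ?r \<omega> \<le> \<bar>c\<bar> / 1"
        using r by (intro divide_left_mono) (auto intro: order_less_le_trans[OF zero_less_one])
      then show "norm (c / ?r \<omega>) \<le> \<bar>c\<bar>"
        by simp
    qed
  qed measurable
  note b = expectation_incomplete_le[OF n \<epsilon> L]
  have "prob {\<omega> \<in> space P. real k > \<delta> * card (?A \<omega>)} = expectation (\<lambda>\<omega>. of_bool (real k > \<delta> * card (?A \<omega>)))"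
    by (rule integral_of_bool[symmetric])
  also have "\<dots> \<le> expectation (\<lambda>\<omega>. (2 / \<delta>) * (k / ?r \<omega>) + 2 * (?b \<omega> / ?r \<omega>))"
  proof (rule integral_mono')
    show "integrable P (\<lambda>\<omega>. (2 / \<delta>) * (k / ?r \<omega>) + 2 * (?b \<omega> / ?r \<omega>))"
      by (intro Bochner_Integration.integrable_add integrable_mult_right int_r b(1))
    fix \<omega> assume \<omega>: "\<omega> \<in> space P"
    show nonneg: "0 \<le> (2 / \<delta>) * (k / ?r \<omega>) + 2 * (?b \<omega> / ?r \<omega>)"
      using \<open>\<delta> > 0\<close> by simp
    show "of_bool (real k > \<delta> * card (?A \<omega>)) \<le> (2 / \<delta>) * (k / ?r \<omega>) + 2 * (?b \<omega> / ?r \<omega>)"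
    proof (cases "real k > \<delta> * card (?A \<omega>)")
      case True
      have "R n \<omega> \<subseteq> ?A \<omega> \<union> {i \<in> R n \<omega>. Ms i (n + 1 - i) \<omega> \<noteq> UNIV}"
        by (auto simp: good_users_def)
      then have "card (R n \<omega>) \<le> card (?A \<omega> \<union> {i \<in> R n \<omega>. Ms i (n + 1 - i) \<omega> \<noteq> UNIV})"
        using finite_R[OF n \<omega>] by (intro card_mono) (auto simp: good_users_def)
      also have "\<dots> \<le> card (?A \<omega>) + card {i \<in> R n \<omega>. Ms i (n + 1 - i) \<omega> \<noteq> UNIV}"
        by (rule card_Un_le)
      finally have "?r \<omega> \<le> card (?A \<omega>) + ?b \<omega>"
        by linarith
      moreover have "card (?A \<omega>) \<le> k / \<delta>"
        using True \<open>\<delta> > 0\<close> by (simp add: field_simps)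
      ultimately have "?r \<omega> \<le> k / \<delta> + ?b \<omega>"
        by linarith
      then have "?r \<omega> / ?r \<omega> \<le> (k / \<delta> + ?b \<omega>) / ?r \<omega>"
        by (rule divide_right_mono) simp
      then have "1 \<le> (1 / \<delta>) * (k / ?r \<omega>) + ?b \<omega> / ?r \<omega>"
        using r[OF \<omega>] by (simp add: add_divide_distrib)
      moreover have "0 \<le> (1 / \<delta>) * (k / ?r \<omega>) + ?b \<omega> / ?r \<omega>"
        using \<open>\<delta> > 0\<close> by simp
      ultimately show ?thesis
        using True by simp
    qed (use nonneg in simp)
  qed
  also have "\<dots> = (2 / \<delta>) * expectation (\<lambda>\<omega>. k / ?r \<omega>) + 2 * expectation (\<lambda>\<omega>. ?b \<omega> / ?r \<omega>)"
  proof -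
    have "expectation (\<lambda>\<omega>. (2 / \<delta>) * (k / ?r \<omega>) + 2 * (?b \<omega> / ?r \<omega>)) =
        expectation (\<lambda>\<omega>. (2 / \<delta>) * (k / ?r \<omega>)) + expectation (\<lambda>\<omega>. 2 * (?b \<omega> / ?r \<omega>))"
      by (intro Bochner_Integration.integral_add integrable_mult_right int_r b(1))
    then show ?thesis
      by (simp only: Bochner_Integration.integral_mult_right_zero)
  qed
  also have "\<dots> \<le> (2 / \<delta>) * expectation (\<lambda>\<omega>. k / ?r \<omega>) + 2 * (L * expectation (\<lambda>\<omega>. k / ?r \<omega>) + \<epsilon>)"
  proof -
    have "expectation (\<lambda>\<omega>. ?b \<omega> / ?r \<omega>) \<le> expectation (\<lambda>\<omega>. L / ?r \<omega> + \<epsilon>)"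
      by (rule b(2))
    also have "\<dots> \<le> expectation (\<lambda>\<omega>. L * (k / ?r \<omega>) + \<epsilon>)"
    proof (rule integral_mono)
      show "integrable P (\<lambda>\<omega>. L / ?r \<omega> + \<epsilon>)" "integrable P (\<lambda>\<omega>. L * (k / ?r \<omega>) + \<epsilon>)"
        using int_r by simp_all
      fix \<omega> assume \<omega>: "\<omega> \<in> space P"
      have "real L * 1 \<le> real L * real k"
        using k by (intro mult_left_mono) auto
      \<comment> \<open>As \<open>k \<ge> 1\<close>, the term from the latest users is absorbed into
        the ratio that tends to 0 by hypothesis.\<close>
      then have "L / ?r \<omega> \<le> (L * k) / ?r \<omega>"
        by (intro divide_right_mono) auto
      then show "L / ?r \<omega> + \<epsilon> \<le> L * (k / ?r \<omega>) + \<epsilon>"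
        by simp
    qed
    also have "\<dots> = L * expectation (\<lambda>\<omega>. k / ?r \<omega>) + \<epsilon>"
    proof -
      have "expectation (\<lambda>\<omega>. L * (k / ?r \<omega>) + \<epsilon>) = expectation (\<lambda>\<omega>. L * (k / ?r \<omega>)) + expectation (\<lambda>_. \<epsilon>)"
        by (intro Bochner_Integration.integral_add integrable_mult_right int_r) simp
      moreover have "expectation (\<lambda>_. \<epsilon>) = \<epsilon>"
        by (simp add: prob_space)
      ultimately show ?thesis
        by (simp only: Bochner_Integration.integral_mult_right_zero)
    qed
    finally show ?thesis
      by simp
  qed
  also have "\<dots> = (2 / \<delta> + 2 * L) * expectation (\<lambda>\<omega>. k / ?r \<omega>) + 2 * \<epsilon>"
    by (simp add: algebra_simps)
  finally show ?thesis .
qed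

lemma prob_few_good_users_tendsto:
  fixes \<delta> :: real
  assumes k: "\<And>n. n \<ge> 1 \<Longrightarrow> 1 \<le> k n"
    and lim: "(\<lambda>n. expectation (\<lambda>\<omega>. real (k n) / real (card (R n \<omega>)))) \<longlonglongrightarrow> 0"
    and "\<delta> > 0"
  shows "(\<lambda>n. prob {\<omega> \<in> space P. real (k n) > \<delta> * card (good_users n (R n \<omega>) (M \<omega>) \<omega>)}) \<longlonglongrightarrow> 0"
proof (rule LIMSEQ_I)
  fix e :: real assume e: "e > 0"
  \<comment> \<open>L is fixed first, from the tolerance e/4 for incomplete masks. It is then a
    constant factor in front of the vanishing ratio, which takes the other half of e.\<close>
  then have "e / 4 > 0"
    by simp
  then obtain L :: nat where L: "\<And>i n. i \<ge> 1 \<Longrightarrow> n \<ge> L \<Longrightarrow> n \<ge> 1 \<Longrightarrow> prob {\<omega> \<in> space P. Ms i n \<omega> \<noteq> UNIV} \<le> e / 4"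
    using prob_mask_not_full_tendsto by blast
  let ?u = "\<lambda>n. expectation (\<lambda>\<omega>. real (k n) / card (R n \<omega>))"
  have "(\<lambda>n. (2 / \<delta> + 2 * L) * ?u n) \<longlonglongrightarrow> (2 / \<delta> + 2 * L) * 0"
    using lim by (intro tendsto_intros)
  then have "eventually (\<lambda>n. (2 / \<delta> + 2 * L) * ?u n < e / 2) sequentially"
    using e by (intro order_tendstoD(2)) auto
  then obtain N where N: "\<And>n. n \<ge> N \<Longrightarrow> (2 / \<delta> + 2 * L) * ?u n < e / 2"
    by (auto simp: eventually_sequentially)
  show "\<exists>N. \<forall>n\<ge>N. norm (prob {\<omega> \<in> space P. real (k n) > \<delta> * card (good_users n (R n \<omega>) (M \<omega>) \<omega>)} - 0) < e"
  proof (intro exI[of _ "max 1 N"] allI impI)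
    fix n assume "max 1 N \<le> n"
    then have n: "1 \<le> n" "N \<le> n"
      by auto
    have "prob {\<omega> \<in> space P. real (k n) > \<delta> * card (good_users n (R n \<omega>) (M \<omega>) \<omega>)} \<le>
        (2 / \<delta> + 2 * L) * ?u n + 2 * (e / 4)"
      using e by (intro prob_few_good_users_le[OF n(1) k[OF n(1)] \<open>\<delta> > 0\<close> _ L]) auto
    then show "norm (prob {\<omega> \<in> space P. real (k n) > \<delta> * card (good_users n (R n \<omega>) (M \<omega>) \<omega>)} - 0) < e"
      using N[OF n(2)] by simp
  qed
qed


section \<open>From fixed index sets to the estimate\<close>

lemma knn_regression_uniform:
  assumes psi: "regression_fun P (\<lambda>\<omega>. revealed X M \<omega> /\<^sub>R norm (revealed X M \<omega>))
                  (\<lambda>\<omega>. Y \<omega> / norm (revealed X M \<omega>)) \<psi>"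
    and "\<epsilon> > 0"
  shows "\<exists>(K::nat) (\<delta>::real). \<delta> > 0 \<and> (\<forall>m a k. prob {\<omega> \<in> space P. M \<omega> = m} > 0 \<longrightarrow>
    finite a \<longrightarrow> 0 \<notin> a \<longrightarrow> K \<le> k \<longrightarrow> real k \<le> \<delta> * card a \<longrightarrow>
    (\<integral>w. \<bar>iid_regression.knn_mean (direction m) (rating_ratio s m) k a w - clip \<psi> (direction m (w 0))\<bar>
      \<partial>Pi\<^sub>M (insert 0 a) (\<lambda>_. user_distr)) \<le> \<epsilon> \<and>
    measure (Pi\<^sub>M (insert 0 a) (\<lambda>_. user_distr))
      {w \<in> space (Pi\<^sub>M (insert 0 a) (\<lambda>_. user_distr)). iid_regression.few (direction m) (sqrt (2 / card m)) k a w} \<le> \<epsilon>)"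
proof -
  define good where "good m K \<delta> \<longleftrightarrow> (\<forall>a k. finite a \<longrightarrow> 0 \<notin> a \<longrightarrow> K \<le> k \<longrightarrow> real k \<le> \<delta> * card a \<longrightarrow>
    (\<integral>w. \<bar>iid_regression.knn_mean (direction m) (rating_ratio s m) k a w - clip \<psi> (direction m (w 0))\<bar>
      \<partial>Pi\<^sub>M (insert 0 a) (\<lambda>_. user_distr)) \<le> \<epsilon> \<and>
    measure (Pi\<^sub>M (insert 0 a) (\<lambda>_. user_distr))
      {w \<in> space (Pi\<^sub>M (insert 0 a) (\<lambda>_. user_distr)). iid_regression.few (direction m) (sqrt (2 / card m)) k a w} \<le> \<epsilon>)"
    for m :: "'d set" and K :: nat and \<delta> :: real
  have "\<exists>K \<delta>. \<delta> > 0 \<and> (prob {\<omega> \<in> space P. M \<omega> = m} > 0 \<longrightarrow> good m K \<delta>)" for m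
  proof (cases "prob {\<omega> \<in> space P. M \<omega> = m} > 0")
    case True
    then interpret I: iid_regression user_distr "direction m" "rating_ratio s m" "clip \<psi>" s
      by (rule iid_regression_direction[OF psi])
    have "m \<noteq> {}"
    proof
      assume "m = {}"
      then have "{\<omega> \<in> space P. M \<omega> = m} = {}"
        using M_nonempty by auto
      with True show False
        by (simp only: measure_empty)
    qed
    then have "sqrt (2 / card m) > 0"
      by (simp add: card_gt_0_iff)
    from I.knn_mean_consistent[OF assms(2) this] show ?thesis
      unfolding good_def by blast
  qed (auto intro: exI[of _ 1])
  then obtain K \<delta> where K: "\<And>m. \<delta> m > 0" "\<And>m. prob {\<omega> \<in> space P. M \<omega> = m} > 0 \<Longrightarrow> good m (K m) (\<delta> m)"
    by metis
  \<comment> \<open>There are finitely many masks: the sum dominates every threshold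
    \<open>K m\<close>, and the minimum of the \<delta> m stays positive.\<close>
  define K' where "K' = (\<Sum>m\<in>UNIV. K m)"
  define \<delta>' where "\<delta>' = Min (range \<delta>)"
  have "K m \<le> K'" for m
    unfolding K'_def by (rule member_le_sum) auto
  moreover have "\<delta>' \<le> \<delta> m" for m
    unfolding \<delta>'_def by (rule Min_le) auto
  ultimately have "good m K' \<delta>'" if "prob {\<omega> \<in> space P. M \<omega> = m} > 0" for m
    using K(2)[OF that] unfolding good_def by (meson mult_right_mono of_nat_0_le_iff order_trans)
  moreover have "\<delta>' > 0"
    unfolding \<delta>'_def using K(1) by simp
  ultimately show ?thesis
    unfolding good_def by blast
qed

text \<open>Each of the finitely many masks of probability 0 is attained on a null set only. The
  structure \<open>iid_regression\<close> has been established for the remaining masks.\<close>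

lemma AE_M_charged: "AE \<omega> in P. prob {\<omega>' \<in> space P. M \<omega>' = M \<omega>} > 0"
proof -
  have "AE \<omega> in P. prob {\<omega>' \<in> space P. M \<omega>' = m} = 0 \<longrightarrow> M \<omega> \<noteq> m" for m
  proof (cases "prob {\<omega> \<in> space P. M \<omega> = m} = 0")
    case True
    have "{\<omega> \<in> space P. M \<omega> = m} \<in> events"
      by measurable
    then show ?thesis
      using True by (subst (asm) prob_eq_0) auto
  qed simp
  then have "AE \<omega> in P. \<forall>m\<in>UNIV. prob {\<omega>' \<in> space P. M \<omega>' = m} = 0 \<longrightarrow> M \<omega> \<noteq> m"
    by (intro AE_finite_allI) auto
  then show ?thesis
    by eventually_elim (metis UNIV_I measure_nonneg order_less_le)
qed

text \<open>Measurability of the estimate is not needed: an integral on the left-hand side that does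
  not exist is \<open>0\<close>.\<close>

lemma knn_estimate_expectation_le:
  fixes \<delta> \<epsilon> :: real
  assumes psi: "regression_fun P (\<lambda>\<omega>. revealed X M \<omega> /\<^sub>R norm (revealed X M \<omega>))
                  (\<lambda>\<omega>. Y \<omega> / norm (revealed X M \<omega>)) \<psi>"
    and eta: "AE \<omega> in P. \<eta> (revealed X M \<omega>) = norm (revealed X M \<omega>) * \<psi> (revealed X M \<omega> /\<^sub>R norm (revealed X M \<omega>))"
    and \<delta>: "\<And>m a. prob {\<omega> \<in> space P. M \<omega> = m} > 0 \<Longrightarrow> finite a \<Longrightarrow> 0 \<notin> a \<Longrightarrow> real (k n) \<le> \<delta> * card a \<Longrightarrow>
      (\<integral>w. \<bar>iid_regression.knn_mean (direction m) (rating_ratio s m) (k n) a w - clip \<psi> (direction m (w 0))\<bar>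
        \<partial>Pi\<^sub>M (insert 0 a) (\<lambda>_. user_distr)) \<le> \<epsilon> \<and>
      measure (Pi\<^sub>M (insert 0 a) (\<lambda>_. user_distr))
        {w \<in> space (Pi\<^sub>M (insert 0 a) (\<lambda>_. user_distr)). iid_regression.few (direction m) (sqrt (2 / card m)) (k n) a w} \<le> \<epsilon>"
    and n: "n \<ge> 1" and \<epsilon>: "\<epsilon> \<ge> 0"
  shows "expectation (\<lambda>\<omega>. \<bar>knn_estimate Xs Ys Ms M R k n (revealed X M \<omega>) \<omega> - \<eta> (revealed X M \<omega>)\<bar>) \<le>
    s * CARD('d) * (1 + 2 * s) * \<epsilon> +
    3 * s * (s * CARD('d)) * prob {\<omega> \<in> space P. real (k n) > \<delta> * card (good_users n (R n \<omega>) (M \<omega>) \<omega>)}"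
proof -
  let ?c = "s * CARD('d)"
  have c: "0 \<le> ?c" "0 \<le> s"
    using s_gt_1 by simp_all
  let ?charged = "\<lambda>m. prob {\<omega> \<in> space P. M \<omega> = m} > 0"
  let ?Q = "\<lambda>a. Pi\<^sub>M (insert 0 a) (\<lambda>_. user_distr)"
  let ?dev = "\<lambda>m a w. \<bar>iid_regression.knn_mean (direction m) (rating_ratio s m) (k n) a w - clip \<psi> (direction m (w 0))\<bar>"
  let ?few = "\<lambda>m a w. iid_regression.few (direction m) (sqrt (2 / card m)) (k n) a w"
  \<comment> \<open>The bound of \<open>knn_estimate_error\<close> as a function of the sample. It
    is set to 0 for masks of probability 0, where no regression statement backs its
    integrability.\<close>
  define F where "F m a w = (if ?charged m then ?c * ?dev m a w + 2 * s * ?c * of_bool (?few m a w) else 0)" for m a w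
  \<comment> \<open>If k is small compared with a, both integrals are at most \<epsilon>. Otherwise
    the deviation is at most s and the probability at most 1, which gives the factor
    \<open>s + 2 * s\<close>.\<close>
  define g where "g a = ?c * (1 + 2 * s) * \<epsilon> + 3 * s * ?c * of_bool (real (k n) > \<delta> * card a)" for a :: "nat set"
  let ?B = "\<lambda>t. {\<omega> \<in> space P. profile n \<omega> = t}"
  let ?w = "\<lambda>a \<omega>. \<lambda>i\<in>insert 0 a. user i \<omega>"
  have g_nonneg: "0 \<le> g a" for a
    using c \<epsilon> by (auto simp: g_def intro!: add_nonneg_nonneg mult_nonneg_nonneg)
  have F: "integrable (?Q a) (F m a)" "(\<integral>w. F m a w \<partial>?Q a) \<le> g a" "0 \<le> F m a w"
    if a: "a \<subseteq> {1..n}" for m a w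
  proof -
    have fin: "finite a" "0 \<notin> a"
      using a by (auto intro: finite_subset)
    interpret Q: prob_space "?Q a"
      by (intro prob_space_PiM prob_space_user_distr)
    show "0 \<le> F m a w"
      using c by (auto simp: F_def)
    have "integrable (?Q a) (F m a) \<and> (\<integral>w. F m a w \<partial>?Q a) \<le> g a"
    proof (cases "?charged m")
      case True
      then interpret I: iid_regression user_distr "direction m" "rating_ratio s m" "clip \<psi>" s
        by (rule iid_regression_direction[OF psi])
      note [measurable] = I.measurable_few[OF fin(1)] I.measurable_knn_mean[OF fin(1)]
      have dev_le: "?dev m a w \<le> s" if "w \<in> space (?Q a)" for w
        using I.knn_mean_bounds[OF fin(1) that, of "k n"] I.\<psi>_bounds[of "direction m (w 0)"] by linarith
      have i1: "integrable (?Q a) (?dev m a)"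
        using dev_le by (intro Q.integrable_const_bound[where B=s] AE_I2) auto
      have i2: "integrable (?Q a) (\<lambda>w. of_bool (?few m a w) :: real)"
        by (intro Q.integrable_const_bound[where B=1] AE_I2) auto
      have F_eq: "F m a = (\<lambda>w. ?c * ?dev m a w + 2 * s * ?c * of_bool (?few m a w))"
        using True by (simp add: F_def fun_eq_iff)
      have int: "integrable (?Q a) (F m a)"
        unfolding F_eq by (intro Bochner_Integration.integrable_add integrable_mult_right i1 i2)
      have "(\<integral>w. F m a w \<partial>?Q a) =
          (\<integral>w. ?c * ?dev m a w \<partial>?Q a) + (\<integral>w. 2 * s * ?c * of_bool (?few m a w) \<partial>?Q a)"
        unfolding F_eq by (intro Bochner_Integration.integral_add integrable_mult_right i1 i2)
      also have "\<dots> = ?c * (\<integral>w. ?dev m a w \<partial>?Q a) + 2 * s * ?c * measure (?Q a) {w \<in> space (?Q a). ?few m a w}"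
        by (simp only: Bochner_Integration.integral_mult_right_zero integral_of_bool)
      also have "\<dots> \<le> g a"
      proof (cases "real (k n) \<le> \<delta> * card a")
        case le: True
        have "?c * (\<integral>w. ?dev m a w \<partial>?Q a) + 2 * s * ?c * measure (?Q a) {w \<in> space (?Q a). ?few m a w} \<le>
            ?c * \<epsilon> + 2 * s * ?c * \<epsilon>"
          using \<delta>[OF True fin le] c by (intro add_mono mult_left_mono) auto
        also have "\<dots> = ?c * (1 + 2 * s) * \<epsilon>"
          by (simp add: algebra_simps)
        also have "\<dots> = g a"
          using le by (simp add: g_def)
        finally show ?thesis .
      next
        case False
        have "(\<integral>w. ?dev m a w \<partial>?Q a) \<le> (\<integral>w. s \<partial>?Q a)"
          using i1 dev_le by (intro integral_mono) auto
        then have "(\<integral>w. ?dev m a w \<partial>?Q a) \<le> s"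
          by (simp add: Q.prob_space)
        then have "?c * (\<integral>w. ?dev m a w \<partial>?Q a) + 2 * s * ?c * measure (?Q a) {w \<in> space (?Q a). ?few m a w} \<le>
            ?c * s + 2 * s * ?c * 1"
          using c by (intro add_mono mult_left_mono Q.prob_le_1) auto
        also have "\<dots> = 3 * s * ?c"
          by simp
        also have "\<dots> \<le> g a"
          using False c \<epsilon> by (simp add: g_def)
        finally show ?thesis .
      qed
      finally show ?thesis
        using int by simp
    next
      case False
      then have "F m a = (\<lambda>_. 0)"
        by (auto simp: F_def)
      then show ?thesis
        using g_nonneg by simp
    qed
    then show "integrable (?Q a) (F m a)" "(\<integral>w. F m a w \<partial>?Q a) \<le> g a"
      by auto
  qed
  have split: "(\<Sum>t\<in>profiles n. indicator (?B t) \<omega> * h t) = h (profile n \<omega>)"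
    if "\<omega> \<in> space P" for \<omega> and h :: "_ \<Rightarrow> real"
  proof -
    have "(\<Sum>t\<in>profiles n. indicator (?B t) \<omega> * h t) = (\<Sum>t\<in>profiles n. if t = profile n \<omega> then h t else 0)"
      using that by (intro sum.cong) (auto simp: indicator_def)
    then show ?thesis
      using profile_in[OF n that] by (simp add: finite_cartesian_product del: mem_Sigma_iff)
  qed
  let ?H = "\<lambda>\<omega>. \<Sum>t\<in>profiles n. indicator (?B t) \<omega> * F (fst (snd t)) (snd (snd t)) (?w (snd (snd t)) \<omega>)"
  have term_int: "integrable P (\<lambda>\<omega>. indicator (?B t) \<omega> * F (fst (snd t)) (snd (snd t)) (?w (snd (snd t)) \<omega>))"
    and term_eq: "expectation (\<lambda>\<omega>. indicator (?B t) \<omega> * F (fst (snd t)) (snd (snd t)) (?w (snd (snd t)) \<omega>)) =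
      prob (?B t) * (\<integral>w. F (fst (snd t)) (snd (snd t)) w \<partial>?Q (snd (snd t)))" if t: "t \<in> profiles n" for t
  proof -
    obtain r m a where rma: "t = (r, m, a)" "r \<subseteq> {1..n}" "a \<subseteq> {1..n}"
      using t by auto
    note * = users_indep_R_masks[OF n R_event[OF n] good_users_event[OF rma(2)] insert_not_empty F(1)[OF rma(3)]]
    show "integrable P (\<lambda>\<omega>. indicator (?B t) \<omega> * F (fst (snd t)) (snd (snd t)) (?w (snd (snd t)) \<omega>))"
      "expectation (\<lambda>\<omega>. indicator (?B t) \<omega> * F (fst (snd t)) (snd (snd t)) (?w (snd (snd t)) \<omega>)) =
      prob (?B t) * (\<integral>w. F (fst (snd t)) (snd (snd t)) w \<partial>?Q (snd (snd t)))"
      unfolding rma(1) fst_conv snd_conv profile_event_eq by (rule *(2), rule *(1))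
  qed
  have "expectation (\<lambda>\<omega>. \<bar>knn_estimate Xs Ys Ms M R k n (revealed X M \<omega>) \<omega> - \<eta> (revealed X M \<omega>)\<bar>) \<le> expectation ?H"
  proof (rule integral_mono_AE')
    show "integrable P ?H"
      by (intro Bochner_Integration.integrable_sum term_int)
    show "AE \<omega> in P. 0 \<le> ?H \<omega>"
      using F(3) by (intro AE_I2 sum_nonneg mult_nonneg_nonneg) auto
    show "AE \<omega> in P. \<bar>knn_estimate Xs Ys Ms M R k n (revealed X M \<omega>) \<omega> - \<eta> (revealed X M \<omega>)\<bar> \<le> ?H \<omega>"
      using eta AE_clip[OF psi] AE_M_charged AE_valid_users AE_space
    proof eventually_elim
      fix \<omega>
      assume eta: "\<eta> (revealed X M \<omega>) = norm (revealed X M \<omega>) * \<psi> (revealed X M \<omega> /\<^sub>R norm (revealed X M \<omega>))"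
        and clip_eq: "\<psi> (revealed X M \<omega> /\<^sub>R norm (revealed X M \<omega>)) = clip \<psi> (revealed X M \<omega> /\<^sub>R norm (revealed X M \<omega>))"
        and charged: "?charged (M \<omega>)" and valid: "\<forall>i. valid_user s (user i \<omega>)" and \<omega>: "\<omega> \<in> space P"
      let ?m = "M \<omega>" and ?a = "good_users n (R n \<omega>) (M \<omega>) \<omega>"
      interpret I: iid_regression user_distr "direction ?m" "rating_ratio s ?m" "clip \<psi>" s
        using charged by (rule iid_regression_direction[OF psi])
      have Z: "revealed X M \<omega> /\<^sub>R norm (revealed X M \<omega>) = direction ?m (user 0 \<omega>)"
        by (simp add: direction_def revealed_eq)
      have "\<bar>knn_estimate Xs Ys Ms M R k n (revealed X M \<omega>) \<omega> - \<eta> (revealed X M \<omega>)\<bar> =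
          \<bar>knn_estimate Xs Ys Ms M R k n (revealed X M \<omega>) \<omega> - norm (revealed X M \<omega>) * clip \<psi> (direction ?m (user 0 \<omega>))\<bar>"
        using eta clip_eq Z by simp
      also have "\<dots> \<le> ?c * \<bar>I.knn_mean (k n) ?a (?w ?a \<omega>) - clip \<psi> (direction ?m (user 0 \<omega>))\<bar> +
          2 * s * ?c * of_bool (I.few (sqrt (2 / card ?m)) (k n) ?a (?w ?a \<omega>))"
        by (rule knn_estimate_error[OF valid \<omega> n refl refl I.\<psi>_bounds I.iid_regression_axioms refl])
      also have "\<dots> = F ?m ?a (?w ?a \<omega>)"
        using charged by (simp add: F_def)
      also have "\<dots> = ?H \<omega>"
        unfolding split[OF \<omega>] by (simp add: profile_def)
      finally show "\<bar>knn_estimate Xs Ys Ms M R k n (revealed X M \<omega>) \<omega> - \<eta> (revealed X M \<omega>)\<bar> \<le> ?H \<omega>" .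
    qed
  qed
  also have "\<dots> = (\<Sum>t\<in>profiles n. prob (?B t) * (\<integral>w. F (fst (snd t)) (snd (snd t)) w \<partial>?Q (snd (snd t))))"
    using term_int term_eq by (subst Bochner_Integration.integral_sum) (auto intro!: sum.cong)
  also have "\<dots> \<le> (\<Sum>t\<in>profiles n. prob (?B t) * g (snd (snd t)))"
    using F(2) by (intro sum_mono mult_left_mono) auto
  also have "\<dots> = (\<Sum>t\<in>profiles n. expectation (\<lambda>\<omega>. indicator (?B t) \<omega> * g (snd (snd t))))"
  proof (rule sum.cong[OF refl])
    fix t
    have "?B t \<inter> space P = ?B t"
      by auto
    then show "prob (?B t) * g (snd (snd t)) = expectation (\<lambda>\<omega>. indicator (?B t) \<omega> * g (snd (snd t)))"
      by (simp only: Bochner_Integration.integral_mult_left_zero Bochner_Integration.integral_indicator)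
  qed
  also have "\<dots> = expectation (\<lambda>\<omega>. \<Sum>t\<in>profiles n. indicator (?B t) \<omega> * g (snd (snd t)))"
  proof (rule Bochner_Integration.integral_sum[symmetric])
    have "?B t \<in> events" for t
      using n by measurable
    then show "integrable P (\<lambda>\<omega>. indicator (?B t) \<omega> * g (snd (snd t)))" for t
      by (intro integrable_mult_left integrable_real_indicator) (auto simp: emeasure_eq_measure)
  qed
  also have "\<dots> = expectation (\<lambda>\<omega>. g (good_users n (R n \<omega>) (M \<omega>) \<omega>))"
  proof (rule Bochner_Integration.integral_cong[OF refl])
    fix \<omega> assume "\<omega> \<in> space P"
    then show "(\<Sum>t\<in>profiles n. indicator (?B t) \<omega> * g (snd (snd t))) = g (good_users n (R n \<omega>) (M \<omega>) \<omega>)"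
      using split[of \<omega> "\<lambda>t. g (snd (snd t))"] by (simp only: profile_def snd_conv)
  qed
  also have "\<dots> = ?c * (1 + 2 * s) * \<epsilon> +
      3 * s * ?c * prob {\<omega> \<in> space P. real (k n) > \<delta> * card (good_users n (R n \<omega>) (M \<omega>) \<omega>)}"
  proof -
    let ?P = "\<lambda>\<omega>. real (k n) > \<delta> * card (snd (snd (profile n \<omega>)))"
    have [measurable]: "Measurable.pred P ?P"
      using measurable_compose[OF measurable_profile[OF n], of "\<lambda>t. real (k n) > \<delta> * card (snd (snd t))" "count_space UNIV"]
      by simp
    have "integrable P (\<lambda>\<omega>. of_bool (?P \<omega>) :: real)"
      by (intro integrable_const_bound[where B=1] AE_I2) auto
    then have "expectation (\<lambda>\<omega>. ?c * (1 + 2 * s) * \<epsilon> + 3 * s * ?c * of_bool (?P \<omega>)) =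
        expectation (\<lambda>\<omega>. ?c * (1 + 2 * s) * \<epsilon>) + expectation (\<lambda>\<omega>. 3 * s * ?c * of_bool (?P \<omega>))"
      by (intro Bochner_Integration.integral_add integrable_mult_right) auto
    also have "\<dots> = ?c * (1 + 2 * s) * \<epsilon> + 3 * s * ?c * prob {\<omega> \<in> space P. ?P \<omega>}"
      by (simp only: Bochner_Integration.integral_mult_right_zero integral_of_bool) (simp add: prob_space)
    finally show ?thesis
      by (simp add: g_def profile_def)
  qed
  finally show ?thesis .
qed

theorem knn_estimate_consistent:
  assumes k_range: "\<And>n. n \<ge> 1 \<Longrightarrow> 1 \<le> k n"
    and psi: "regression_fun P (\<lambda>\<omega>. revealed X M \<omega> /\<^sub>R norm (revealed X M \<omega>))
                (\<lambda>\<omega>. Y \<omega> / norm (revealed X M \<omega>)) \<psi>"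
    and eta: "AE \<omega> in P. \<eta> (revealed X M \<omega>) = norm (revealed X M \<omega>) * \<psi> (revealed X M \<omega> /\<^sub>R norm (revealed X M \<omega>))"
    and k_lim: "filterlim k at_top sequentially"
    and ratio_lim: "(\<lambda>n. expectation (\<lambda>\<omega>. real (k n) / real (card (R n \<omega>)))) \<longlonglongrightarrow> 0"
  shows "(\<lambda>n. expectation (\<lambda>\<omega>. \<bar>knn_estimate Xs Ys Ms M R k n (revealed X M \<omega>) \<omega> - \<eta> (revealed X M \<omega>)\<bar>)) \<longlonglongrightarrow> 0"
proof (rule LIMSEQ_I)
  let ?E = "\<lambda>n. expectation (\<lambda>\<omega>. \<bar>knn_estimate Xs Ys Ms M R k n (revealed X M \<omega>) \<omega> - \<eta> (revealed X M \<omega>)\<bar>)"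
  let ?c = "s * CARD('d)"
  fix e :: real assume e: "e > 0"
  \<comment> \<open>Chosen so that the main term of \<open>knn_estimate_expectation_le\<close>
    equals e/2; the other half of e is left for the outcomes with too few complete users.\<close>
  define \<epsilon> where "\<epsilon> = e / (2 * (?c * (1 + 2 * s)))"
  have c: "?c * (1 + 2 * s) > 0"
    using s_gt_1 by (simp add: pos_add_strict)
  have half: "C * (e / (2 * C)) = e / 2" if "C > 0" for C :: real
    using that by simp
  have \<epsilon>: "\<epsilon> > 0" "?c * (1 + 2 * s) * \<epsilon> = e / 2"
    unfolding \<epsilon>_def by (rule divide_pos_pos[OF e mult_pos_pos[OF _ c]], simp) (rule half[OF c])
  obtain K :: nat and \<delta> :: real where \<delta>: "\<delta> > 0" and K: "\<forall>m a k. prob {\<omega> \<in> space P. M \<omega> = m} > 0 \<longrightarrow>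
      finite a \<longrightarrow> 0 \<notin> a \<longrightarrow> K \<le> k \<longrightarrow> real k \<le> \<delta> * card a \<longrightarrow>
      (\<integral>w. \<bar>iid_regression.knn_mean (direction m) (rating_ratio s m) k a w - clip \<psi> (direction m (w 0))\<bar>
        \<partial>Pi\<^sub>M (insert 0 a) (\<lambda>_. user_distr)) \<le> \<epsilon> \<and>
      measure (Pi\<^sub>M (insert 0 a) (\<lambda>_. user_distr))
        {w \<in> space (Pi\<^sub>M (insert 0 a) (\<lambda>_. user_distr)). iid_regression.few (direction m) (sqrt (2 / card m)) k a w} \<le> \<epsilon>"
    using knn_regression_uniform[OF psi \<epsilon>(1)] by (elim exE conjE)
  let ?p = "\<lambda>n. prob {\<omega> \<in> space P. real (k n) > \<delta> * card (good_users n (R n \<omega>) (M \<omega>) \<omega>)}"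
  have "(\<lambda>n. 3 * s * ?c * ?p n) \<longlonglongrightarrow> 3 * s * ?c * 0"
    using prob_few_good_users_tendsto[OF k_range ratio_lim \<delta>] by (intro tendsto_intros)
  then have "eventually (\<lambda>n. 3 * s * ?c * ?p n < e / 2) sequentially"
    using e by (intro order_tendstoD(2)) auto
  moreover have "eventually (\<lambda>n. K \<le> k n) sequentially"
    using k_lim by (auto simp: filterlim_at_top)
  ultimately have "eventually (\<lambda>n. 3 * s * ?c * ?p n < e / 2 \<and> K \<le> k n \<and> 1 \<le> n) sequentially"
    using eventually_ge_at_top[of "1::nat"] by eventually_elim auto
  then obtain N where N: "\<And>n. n \<ge> N \<Longrightarrow> 3 * s * ?c * ?p n < e / 2 \<and> K \<le> k n \<and> 1 \<le> n"
    by (auto simp: eventually_sequentially)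
  show "\<exists>N. \<forall>n\<ge>N. norm (?E n - 0) < e"
  proof (intro exI[of _ N] allI impI)
    fix n assume "n \<ge> N"
    note n = N[OF this]
    have "?E n \<le> ?c * (1 + 2 * s) * \<epsilon> + 3 * s * ?c * ?p n"
      using K n \<epsilon>(1) by (intro knn_estimate_expectation_le[OF psi eta]) auto
    moreover have "0 \<le> ?E n"
      by (intro Bochner_Integration.integral_nonneg) simp
    ultimately show "norm (?E n - 0) < e"
      using n \<epsilon>(2) by simp
  qed
qed

end

theorem theorem4p1:
  fixes P :: "'w measure" and s :: real
    and X :: "'w \<Rightarrow> real^'d::finite" and Y :: "'w \<Rightarrow> real" and M :: "'w \<Rightarrow> 'd set"
    and Xs :: "nat \<Rightarrow> 'w \<Rightarrow> real^'d" and Ys :: "nat \<Rightarrow> 'w \<Rightarrow> real"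
    and G :: "nat \<Rightarrow> 'w \<Rightarrow> 'd set" and Ms :: "nat \<Rightarrow> nat \<Rightarrow> 'w \<Rightarrow> 'd set"
    and R :: "nat \<Rightarrow> 'w \<Rightarrow> nat set" and k :: "nat \<Rightarrow> nat"
    and \<eta> \<phi> \<psi> :: "real^'d \<Rightarrow> real"
  assumes model: "recommendation_model P s X Y M Xs Ys G Ms R"
    and k_range: "\<And>n. n \<ge> 1 \<Longrightarrow> 1 \<le> k n \<and> k n \<le> n"
    and M_card: "AE \<omega> in P. card (M \<omega>) \<ge> 2"
    and eta: "regression_fun P (revealed X M) Y \<eta>"
    and psi: "regression_fun P (\<lambda>\<omega>. revealed X M \<omega> /\<^sub>R norm (revealed X M \<omega>))
                (\<lambda>\<omega>. Y \<omega> / norm (revealed X M \<omega>)) \<psi>"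
    and phi: "\<And>x. x \<noteq> 0 \<Longrightarrow> \<phi> x = \<psi> (x /\<^sub>R norm x)"
    and eta_form: "AE x in distr P borel (revealed X M). \<eta> x = norm x * \<phi> x"
    and k_lim: "filterlim k at_top sequentially"
    and R_lim: "AE \<omega> in P. filterlim (\<lambda>n. card (R n \<omega>)) at_top sequentially"
    and ratio_lim:
      "(\<lambda>n. \<integral>\<omega>. real (k n) / real (card (R n \<omega>)) \<partial>P) \<longlonglongrightarrow> 0"
  shows "(\<lambda>n. \<integral>\<omega>. \<bar>knn_estimate Xs Ys Ms M R k n (revealed X M \<omega>) \<omega> - \<eta> (revealed X M \<omega>)\<bar> \<partial>P)
           \<longlonglongrightarrow> 0"
proof -
  interpret recommendation_model P s X Y M Xs Ys G Ms R
    by (rule model)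
  have "AE \<omega> in P. \<eta> (revealed X M \<omega>) = norm (revealed X M \<omega>) * \<phi> (revealed X M \<omega>)"
    using AE_distrD[OF measurable_revealed eta_form] .
  then have "AE \<omega> in P. \<eta> (revealed X M \<omega>) =
      norm (revealed X M \<omega>) * \<psi> (revealed X M \<omega> /\<^sub>R norm (revealed X M \<omega>))"
  proof eventually_elim
    case (elim \<omega>)
    \<comment> \<open>The relation between \<phi> and \<psi> is given away from 0; at 0 both sides
      vanish through the factor \<open>norm\<close>.\<close>
    then show ?case
      using phi[of "revealed X M \<omega>"] by (cases "revealed X M \<omega> = 0") auto
  qed
  then show ?thesis
    using k_range psi k_lim ratio_lim by (intro knn_estimate_consistent) auto
qed

end
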